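(* Let $\rho>0$, $1<s<2$, $0<\eta<2-s$, $\alpha\in\Omega(\eta)$, and $V\in G^{s}_{\rho}(\mathbb{T},\mathbb{R})$. Then the function $E\mapsto L(\alpha,E)$ is continuous in $E\in\mathbb{R}$, where $L(\alpha,E):=L(\alpha,A_E^V)$ is the Lyapunov exponent of the Schrödinger cocycle $$A_E^V(\theta)=\begin{pmatrix}E-V(\theta)&-1\\1&0\end{pmatrix}.$$
   Context: $\mathbb{T}=\mathbb{R}/\mathbb{Z}$. For $\rho>0$ and $s>1$, $G^{s}_{\rho}(\mathbb{T},\mathbb{R})$ is the space of real-valued functions $f(\theta)=\sum_{k\in\mathbb{Z}}\hat f_k e^{2\pi i k\theta}$ on $\mathbb{T}$ with $\|f\|_{s,\rho}:=\sum_{k\in\mathbb{Z}}|\hat f_k|e^{\rho|2\pi k|^{1/s}}<\infty$. For irrational $\alpha\in\mathbb{R}$ let $p_n/q_n$ be its continued fraction convergents. For $0<\eta<1$, $\Omega(\eta)$ is the set of $\alpha\in\mathbb{R}\setminus\mathbb{Q}$ for which there is $C_\alpha>0$ with $\ln q_{n+1}\leq C_\alpha q_n^{\eta}$ for all $n$. For $\alpha\in\mathbb{R}\setminus\mathbb{Q}$, $A:\mathbb{T}\to\mathrm{SL}(2,\mathbb{R})$ and $N\geq1$, put $A_N(\theta)=A(\theta+(N-1)\alpha)\cdots A(\theta+\alpha)A(\theta)$, $L_N(\alpha,A)=\frac1N\int_{\mathbb{T}}\ln\|A_N(\theta)\|\,d\theta$, and define the Lyapunov exponent $L(\alpha,A)=\lim_{N\to\infty}L_N(\alpha,A)=\inf_{N\geq1}L_N(\alpha,A)$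 (the limit exists by subadditivity). *)

theory Defs
  imports "HOL-Analysis.Analysis"
begin

text \<open>
  Functions on the torus (the reals modulo the integers) are represented by 1-periodic functions
  on the reals, and integrals over the torus are integrals over the unit interval.
\<close>

definition fourier_coeff :: "(real \<Rightarrow> real) \<Rightarrow> int \<Rightarrow> complex" where
  "fourier_coeff f k =
     (LINT \<theta>:{0..1}|lborel. complex_of_real (f \<theta>) * cis (- (2 * pi * real_of_int k * \<theta>)))"

text \<open>
  The summands of the weighted norm are nonnegative, so its finiteness is summability of the
  family. Note that \<open>0 powr (1 / s) = 0\<close>, so the weight of the zeroth coefficient is 1.
\<close>
definition gevrey :: "real \<Rightarrow> real \<Rightarrow> (real \<Rightarrow> real) set" where
  "gevrey s \<rho> = {f. (\<forall>\<theta>. f (\<theta> + 1) = f \<theta>) \<and>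
     (\<lambda>k::int. cmod (fourier_coeff f k) * exp (\<rho> * \<bar>2 * pi * real_of_int k\<bar> powr (1 / s)))
        summable_on UNIV \<and>
     (\<forall>\<theta>. ((\<lambda>k::int. fourier_coeff f k * cis (2 * pi * real_of_int k * \<theta>))
        has_sum complex_of_real (f \<theta>)) UNIV)}"

text \<open>
  Complete quotients, partial quotients and convergents of the regular continued fraction
  expansion; the expansion is infinite exactly for irrational arguments, the only ones used.
\<close>
fun cf_complete_quotient :: "real \<Rightarrow> nat \<Rightarrow> real" where
  "cf_complete_quotient \<alpha> 0 = \<alpha>"
| "cf_complete_quotient \<alpha> (Suc n) = 1 / frac (cf_complete_quotient \<alpha> n)"

definition cf_quotient :: "real \<Rightarrow> nat \<Rightarrow> int" where
  "cf_quotient \<alpha> n = \<lfloor>cf_complete_quotient \<alpha> n\<rfloor>"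

fun cf_num :: "real \<Rightarrow> nat \<Rightarrow> int" where
  "cf_num \<alpha> 0 = cf_quotient \<alpha> 0"
| "cf_num \<alpha> (Suc 0) = cf_quotient \<alpha> 1 * cf_quotient \<alpha> 0 + 1"
| "cf_num \<alpha> (Suc (Suc n)) = cf_quotient \<alpha> (Suc (Suc n)) * cf_num \<alpha> (Suc n) + cf_num \<alpha> n"

fun cf_den :: "real \<Rightarrow> nat \<Rightarrow> int" where
  "cf_den \<alpha> 0 = 1"
| "cf_den \<alpha> (Suc 0) = cf_quotient \<alpha> 1"
| "cf_den \<alpha> (Suc (Suc n)) = cf_quotient \<alpha> (Suc (Suc n)) * cf_den \<alpha> (Suc n) + cf_den \<alpha> n"

definition Omega :: "real \<Rightarrow> real set" where
  "Omega \<eta> = {\<alpha>. \<alpha> \<notin> \<rat> \<and>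
     (\<exists>C>0. \<forall>n. ln (real_of_int (cf_den \<alpha> (Suc n))) \<le> C * real_of_int (cf_den \<alpha> n) powr \<eta>)}"

fun cocycle_iterate :: "real \<Rightarrow> (real \<Rightarrow> real^2^2) \<Rightarrow> nat \<Rightarrow> real \<Rightarrow> real^2^2" where
  "cocycle_iterate \<alpha> A 0 \<theta> = mat 1"
| "cocycle_iterate \<alpha> A (Suc N) \<theta> = A (\<theta> + real N * \<alpha>) ** cocycle_iterate \<alpha> A N \<theta>"

text \<open>
  The matrix norm is the operator norm for the Euclidean norm on the plane; the type class
  \<open>norm\<close> on matrices would be the Frobenius norm.
\<close>
definition finite_lyapunov :: "real \<Rightarrow> (real \<Rightarrow> real^2^2) \<Rightarrow> nat \<Rightarrow> real" where
  "finite_lyapunov \<alpha> A N =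
     1 / real N * (LINT \<theta>:{0..1}|lborel. ln (onorm ((*v) (cocycle_iterate \<alpha> A N \<theta>))))"

text \<open>The limit ignores the meaningless value at \<open>N = 0\<close>.\<close>
definition lyapunov :: "real \<Rightarrow> (real \<Rightarrow> real^2^2) \<Rightarrow> real" where
  "lyapunov \<alpha> A = lim (finite_lyapunov \<alpha> A)"

definition schrodinger_cocycle :: "(real \<Rightarrow> real) \<Rightarrow> real \<Rightarrow> real \<Rightarrow> real^2^2" where
  "schrodinger_cocycle V E \<theta> = vector [vector [E - V \<theta>, -1], vector [1, 0]]"

lemma det_schrodinger_cocycle: "det (schrodinger_cocycle V E \<theta>) = 1"
  by (simp add: schrodinger_cocycle_def det_2)

end

theory Submission
  imports Defs "HOL-Complex_Analysis.Complex_Analysis" "HOL-Real_Asymp.Real_Asymp"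
begin

unbundle no fps_syntax

text \<open>
  Upper semicontinuity is subadditivity. Lower semicontinuity at an energy with positive exponent
  combines the avalanche principle with a large deviation estimate at scales \<open>N \<approx> q\<^bsup>1+e\<^esup>\<close>, where
  \<open>q\<close> is the denominator of a convergent.

  For the estimate, truncate \<open>V\<close> so that it is analytic on a strip of width \<open>h \<approx> N\<^bsup>1-s\<^esup>\<close>, up to
  an error negligible for products of length \<open>N\<close>. The squared Hilbert--Schmidt norm of the product
  then extends to a holomorphic function \<open>F \<ge> 1\<close> on the circle with \<open>ln \<bar>F\<bar> \<lesssim> N\<close> on the strip, so that
  \<open>F\<close> has \<open>O(N / h)\<close> zeros there. Hence \<open>G(z) = \<Prod>\<^sub>j\<^sub><\<^sub>q F(z + j\<alpha>)\<close> has \<open>O(N / h)\<close> zeros in every disc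
  of radius \<open>O(1 / q)\<close>, and \<open>ln \<bar>G\<bar> \<le> q max ln F + O(N / h)\<close> in that disc by three lines. Since \<open>ln F\<close> changes
  by \<open>O(1)\<close> under rotation by \<open>\<alpha>\<close>, every such disc contains points where \<open>G\<close> is almost maximal, and
  Harnack's inequality bounds \<open>G\<close> from below away from its zeros. The exceptional set has measure
  about \<open>exp(- q h) \<approx> exp(- q\<^bsup>2-s\<^esup>)\<close>, up to small losses in the exponents. As \<open>\<eta> < 2 - s\<close>, this is
  far smaller than the reciprocal of the next denominator, which is at most about \<open>exp(q\<^bsup>\<eta>\<^esup>)\<close>, and
  the next scale is reached in a single application of the avalanche principle.
\<close>

text \<open>A Gevrey potential with s > 1 need not extend to any fixed strip. The truncation error
  has to beat the growth \<open>exp (N * \<Gamma>)\<close> of the products, so all modes with |2 pi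
  k|^(1/s) up to order N are kept, and h shrinks like N^(1-s). Up to order N/h zeros are then
  possible, many more than N. Taking the product over q orbit points leaves the loss in Harnack's
  inequality of order N/h per disc, and division by q turns it into N/(q h). This is small against N
  because q h is a positive power of q when s < 2 and N is only slightly larger than q. The drift of
  order q of ln F along the orbit is small against N because N is at least q^(1+e).

  Deviations are measured from the maximum over the circle, not from the mean. The maximum is what
  three lines and Harnack see, it is subadditive in N, and it dominates the mean, so its limiting
  rate is at least the exponent. A mean is needed only at the end, where it is bounded below off the
  tiny exceptional set.\<close>

lemma periodic_of_int:
  fixes f :: "'a::ring_1 \<Rightarrow> 'b"
  assumes "\<And>x. f (x + 1) = f x"
  shows "f (x + of_int k) = f x"
proof (induction k arbitrary: x rule: int_induct [where k = 0])
  case (step1 i)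
  show ?case using step1(2)[of x] assms[of "x + of_int i"] by (simp add: algebra_simps)
next
  case (step2 i)
  show ?case using step2(2)[of x] assms[of "x + of_int (i - 1)"] by (simp add: algebra_simps)
qed auto

lemma sublevel_fmeasurable:
  fixes f :: "real \<Rightarrow> real"
  assumes "continuous_on UNIV f"
  shows "{x\<in>{0..1}. f x < a} \<in> fmeasurable lborel"
proof -
  have "f \<in> borel_measurable borel" using assms by (rule borel_measurable_continuous_onI)
  then have "{x\<in>{0..1}. f x < a} \<in> sets lborel" by measurable
  then show ?thesis
    by (intro fmeasurableI2[OF fmeasurable_compact[OF compact_Icc[of 0 1]]]) auto
qed

lemma holomorphic_shift:
  assumes "f holomorphic_on UNIV"
  shows "(\<lambda>z. f (z + a)) holomorphic_on UNIV"
proof -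
  have "(\<lambda>z. z + a) holomorphic_on UNIV" by (intro holomorphic_intros)
  then have "(f \<circ> (\<lambda>z. z + a)) holomorphic_on UNIV"
    by (rule holomorphic_on_compose) (rule holomorphic_on_subset[OF assms], simp)
  then show ?thesis by (simp add: o_def)
qed

lemma cauchy_schwarz_2: "(p * r + q * s)\<^sup>2 \<le> (p\<^sup>2 + q\<^sup>2) * (r\<^sup>2 + s\<^sup>2)" for p q r s :: real
  using zero_le_power2 [of "p * s - q * r"] by (simp add: power2_eq_square algebra_simps)

section \<open>Products of unimodular matrices\<close>

text \<open>\<open>norm\<close> on matrices is the Hilbert--Schmidt norm. For real matrices its
  square is a polynomial in the entries, which later provides a holomorphic extension; the operator
  norm is not of this form.\<close>

lemma norm_matrix_2_sq:
  fixes A :: "'a::real_normed_vector^2^2"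
  shows "(norm A)\<^sup>2 = (norm (A$1$1))\<^sup>2 + (norm (A$1$2))\<^sup>2 + (norm (A$2$1))\<^sup>2 + (norm (A$2$2))\<^sup>2"
  by (simp add: norm_vec_def L2_set_def sum_2 real_sqrt_pow2 sum_nonneg add_nonneg_nonneg)

lemma norm_matrix_mult_le:
  fixes A B :: "'a::{real_normed_algebra,semiring_1}^2^2"
  shows "norm (A ** B) \<le> norm A * norm B"
proof -
  have ent: "(norm ((A ** B)$i$j))\<^sup>2
      \<le> ((norm (A$i$1))\<^sup>2 + (norm (A$i$2))\<^sup>2) * ((norm (B$1$j))\<^sup>2 + (norm (B$2$j))\<^sup>2)" for i j
  proof -
    have "norm ((A ** B)$i$j) \<le> norm (A$i$1) * norm (B$1$j) + norm (A$i$2) * norm (B$2$j)"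
      unfolding matrix_matrix_mult_def
      by (simp add: sum_2) (meson add_mono norm_mult_ineq norm_triangle_le)
    then have "(norm ((A ** B)$i$j))\<^sup>2 \<le> (norm (A$i$1) * norm (B$1$j) + norm (A$i$2) * norm (B$2$j))\<^sup>2"
      by (simp add: power_mono)
    with cauchy_schwarz_2 show ?thesis by (meson order_trans)
  qed
  have "(norm (A ** B))\<^sup>2 \<le> (norm A)\<^sup>2 * (norm B)\<^sup>2"
    unfolding norm_matrix_2_sq
    using ent[of 1 1] ent[of 1 2] ent[of 2 1] ent[of 2 2] by (simp add: algebra_simps)
  then have "(norm (A ** B))\<^sup>2 \<le> (norm A * norm B)\<^sup>2"
    by (simp add: power_mult_distrib)
  then show ?thesis
    by (meson mult_nonneg_nonneg norm_ge_zero power2_le_imp_le)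
qed

lemma norm_mat_1_2: "norm (mat 1 :: 'a::{real_normed_algebra_1}^2^2) = sqrt 2"
  using norm_matrix_2_sq[of "mat 1 :: 'a^2^2"]
  by (simp add: mat_def real_sqrt_unique)

text \<open>Completing squares leaves \<open>2 * det A\<close> plus a sum of two squares. Norms of
  at least 1 make their logarithms nonnegative and keep \<open>ln\<close> 1-Lipschitz on
  them.\<close>

lemma norm_ge_sqrt2_if_det_1:
  fixes A :: "real^2^2"
  assumes "det A = 1"
  shows "norm A \<ge> sqrt 2"
proof -
  have "(norm A)\<^sup>2 = (A$1$1 - A$2$2)\<^sup>2 + (A$1$2 + A$2$1)\<^sup>2 + 2 * det A"
    unfolding norm_matrix_2_sq det_2 by (simp add: power2_eq_square algebra_simps)
  then show ?thesis using assms by (simp add: real_le_lsqrt)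
qed

lemma norm_ge_1_if_det_1:
  fixes A :: "real^2^2"
  assumes "det A = 1"
  shows "norm A \<ge> 1"
  using norm_ge_sqrt2_if_det_1[OF assms] by (smt (verit) real_sqrt_ge_1_iff)

text \<open>The adjugate, which is the inverse if \<open>det A = 1\<close>. It permutes the entries
  up to sign and so keeps the norm; hence a unimodular factor can shrink a product at most as much
  as it can enlarge one.\<close>

definition adj2 :: "'a::comm_ring_1^2^2 \<Rightarrow> 'a^2^2" where
  "adj2 A = vector [vector [A$2$2, - (A$1$2)], vector [- (A$2$1), A$1$1]]"

lemma adj2_mult:
  fixes A :: "'a::comm_ring_1^2^2"
  assumes "det A = 1"
  shows "adj2 A ** A = mat 1" "A ** adj2 A = mat 1"
  using assms
  by (auto simp: adj2_def matrix_matrix_mult_def mat_def vec_eq_iff forall_2 sum_2 det_2 algebra_simps)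

lemma norm_adj2: "norm (adj2 A :: real^2^2) = norm A"
proof -
  have "(norm (adj2 A))\<^sup>2 = (norm A)\<^sup>2"
    unfolding norm_matrix_2_sq by (simp add: adj2_def)
  then show ?thesis by simp
qed

lemma norm_le_mult_left:
  fixes A B :: "real^2^2"
  assumes "det A = 1"
  shows "norm B \<le> norm A * norm (A ** B)"
proof -
  have "norm B = norm (adj2 A ** (A ** B))"
    by (simp add: matrix_mul_assoc adj2_mult[OF assms])
  also have "\<dots> \<le> norm (adj2 A) * norm (A ** B)" by (rule norm_matrix_mult_le)
  finally show ?thesis by (simp add: norm_adj2)
qed

lemma norm_le_mult_right:
  fixes A B :: "real^2^2"
  assumes "det A = 1"
  shows "norm B \<le> norm (B ** A) * norm A"
proof -
  have "norm B = norm ((B ** A) ** adj2 A)"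
    by (simp add: matrix_mul_assoc[symmetric] adj2_mult[OF assms])
  also have "\<dots> \<le> norm (B ** A) * norm (adj2 A)" by (rule norm_matrix_mult_le)
  finally show ?thesis by (simp add: norm_adj2)
qed

lemma onorm_le_norm_matrix: "onorm ((*v) (A::real^2^2)) \<le> norm A"
proof (rule onorm_le)
  fix x :: "real^2"
  have "(norm (A *v x))\<^sup>2 \<le> (norm A)\<^sup>2 * (norm x)\<^sup>2"
  proof -
    have nx: "(norm y)\<^sup>2 = (y$1)\<^sup>2 + (y$2)\<^sup>2" for y :: "real^2"
      by (simp add: norm_vec_def L2_set_def sum_2)
    show ?thesis
      unfolding norm_matrix_2_sq nx
      using cauchy_schwarz_2[of "A$1$1" "x$1" "A$1$2" "x$2"] cauchy_schwarz_2[of "A$2$1" "x$1" "A$2$2" "x$2"]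
      by (simp add: matrix_vector_mult_def sum_2 algebra_simps)
  qed
  then have "(norm (A *v x))\<^sup>2 \<le> (norm A * norm x)\<^sup>2" by (simp add: power_mult_distrib)
  then show "norm (A *v x) \<le> norm A * norm x"
    by (meson mult_nonneg_nonneg norm_ge_zero power2_le_imp_le)
qed

text \<open>No entry exceeds the operator norm, so the two norms agree up to a factor 2. After
  taking logarithms and dividing by the length, this factor vanishes in the limit.\<close>

lemma norm_matrix_le_onorm: "norm (A::real^2^2) \<le> 2 * onorm ((*v) A)"
proof -
  have b: "\<bar>A$i$j\<bar> \<le> onorm ((*v) A)" for i j by (rule matrix_component_le_onorm)
  then have "(A$i$j)\<^sup>2 \<le> (onorm ((*v) A))\<^sup>2" for i j
    by (metis abs_ge_zero power2_abs power_mono)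
  from this[of 1 1] this[of 1 2] this[of 2 1] this[of 2 2]
  have "(norm A)\<^sup>2 \<le> (2 * onorm ((*v) A))\<^sup>2"
    unfolding norm_matrix_2_sq by (simp add: power_mult_distrib)
  moreover have "0 \<le> onorm ((*v) A)" using b[of 1 1] by linarith
  ultimately show ?thesis by (meson mult_nonneg_nonneg power2_le_imp_le zero_le_numeral)
qed

text \<open>
  The identity \<open>Y\<^sub>a\<^sub>b X Y Z = (X Y e\<^sub>b) (e\<^sub>a\<^sup>T Y Z) \<plusminus> det Y \<cdot> (X e\<^sub>a') (e\<^sub>b'\<^sup>T Z)\<close>, with primes
  denoting the other index, is summed over all \<open>a, b\<close> in the Hilbert--Schmidt sense.
\<close>
lemma norm_triple_product:
  fixes X Y Z :: "real^2^2"
  assumes "det Y = 1"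
  shows "\<bar>norm Y * norm (X ** Y ** Z) - norm (X ** Y) * norm (Y ** Z)\<bar> \<le> norm X * norm Z"
proof -
  define o2 :: "2 \<Rightarrow> 2" where "o2 i = (if i = 1 then 2 else 1)" for i
  define sg :: "2 \<Rightarrow> 2 \<Rightarrow> real" where "sg a b = (if a = b then 1 else -1)" for a b
  define T1 :: "real^2^2^2^2" where "T1 = (\<chi> a b. Y$a$b *\<^sub>R (X ** Y ** Z))"
  define T2 :: "real^2^2^2^2" where "T2 = (\<chi> a b i j. (X ** Y)$i$b * (Y ** Z)$a$j)"
  define T3 :: "real^2^2^2^2" where "T3 = (\<chi> a b i j. sg a b * (X$i$o2 a * Z$o2 b$j))"
  have n: "(norm T)\<^sup>2 = (\<Sum>a\<in>UNIV. \<Sum>b\<in>UNIV. \<Sum>i\<in>UNIV. \<Sum>j\<in>UNIV. (T$a$b$i$j)\<^sup>2)"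
    for T :: "real^2^2^2^2"
    by (simp add: norm_vec_def L2_set_def sum_2 add_nonneg_nonneg)
  have "norm T1 = norm Y * norm (X ** Y ** Z)"
  proof -
    have "(norm T1)\<^sup>2 = (norm Y * norm (X ** Y ** Z))\<^sup>2"
      unfolding n power_mult_distrib norm_matrix_2_sq T1_def
      by (simp add: sum_2 power_mult_distrib) algebra
    then show ?thesis by (simp)
  qed
  moreover have "norm T2 = norm (X ** Y) * norm (Y ** Z)"
  proof -
    have "(norm T2)\<^sup>2 = (norm (X ** Y) * norm (Y ** Z))\<^sup>2"
      unfolding n power_mult_distrib norm_matrix_2_sq T2_def
      by (simp add: sum_2 power_mult_distrib) algebra
    then show ?thesis by (simp)
  qed
  moreover have "norm T3 = norm X * norm Z"
  proof -
    have "(norm T3)\<^sup>2 = (norm X * norm Z)\<^sup>2"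
      unfolding n power_mult_distrib norm_matrix_2_sq T3_def
      by (simp add: sum_2 power_mult_distrib o2_def sg_def) algebra
    then show ?thesis by (simp)
  qed
  moreover have "T1 - T2 = T3"
  proof -
    have d: "Y$1$1 * Y$2$2 = 1 + Y$1$2 * Y$2$1" using assms by (simp add: det_2)
    show ?thesis
      unfolding T1_def T2_def T3_def vec_eq_iff forall_2 matrix_matrix_mult_def
      using d by (simp add: sum_2 o2_def sg_def) algebra
  qed
  ultimately show ?thesis using norm_triangle_ineq3[of T1 T2] by simp
qed

fun block_prod :: "(nat \<Rightarrow> real^2^2) \<Rightarrow> nat \<Rightarrow> real^2^2" where
  "block_prod B 0 = B 0"
| "block_prod B (Suc n) = B (Suc n) ** block_prod B n"

lemma det_block_prod: "(\<And>j. j \<le> n \<Longrightarrow> det (B j) = 1) \<Longrightarrow> det (block_prod B n) = 1"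
  by (induction n) (auto simp: det_mul)

text \<open>By induction, appending \<open>B (Suc k)\<close> multiplies the norm of the whole
  product by the same factor, up to 2, as it multiplies the norm of \<open>B k\<close> alone. An
  error of \<open>ln 2\<close> per block is affordable: blocks will have length N, so it costs only
  about 1/N in the growth rate.\<close>

lemma avalanche_principle:
  fixes B :: "nat \<Rightarrow> real^2^2"
  assumes det: "\<And>j. j \<le> n \<Longrightarrow> det (B j) = 1"
    and mu: "\<And>j. j \<le> n \<Longrightarrow> norm (B j) \<ge> \<mu>"
    and nu: "\<And>j. j < n \<Longrightarrow> \<nu> * norm (B (Suc j) ** B j) \<ge> norm (B (Suc j)) * norm (B j)"
    and "\<nu> > 0" "4 * \<nu>\<^sup>2 \<le> \<mu>\<^sup>2" "\<mu> > 0"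
  shows "\<bar>ln (norm (block_prod B n)) - ln (norm (B 0))
           - (\<Sum>j<n. ln (norm (B (Suc j) ** B j)) - ln (norm (B j)))\<bar> \<le> real n * ln 2"
proof -
  define P where "P = block_prod B"
  have main: "norm (P (Suc k)) * norm (B k) \<le> 2 * (norm (B (Suc k) ** B k) * norm (P k))
      \<and> norm (B (Suc k) ** B k) * norm (P k) \<le> 2 * (norm (P (Suc k)) * norm (B k))" if "k < n" for k
    using that
  proof (induction k)
    case 0
    then show ?case by (simp add: P_def)
  next
    case (Suc k)
    let ?X = "B (Suc (Suc k))" and ?Y = "B (Suc k)" and ?Z = "P k"
    have PS: "P (Suc k) = ?Y ** ?Z" "P (Suc (Suc k)) = ?X ** ?Y ** ?Z"
      by (auto simp: P_def matrix_mul_assoc)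
    have pos: "0 < norm (B k)" using mu[of k] \<open>\<mu> > 0\<close> Suc by auto
    have IH: "norm (?Y ** B k) * norm ?Z \<le> 2 * (norm (P (Suc k)) * norm (B k))"
      using Suc by auto
    have "norm ?Y * norm (B k) * norm ?Z \<le> \<nu> * norm (?Y ** B k) * norm ?Z"
      using nu[of k] Suc by (intro mult_right_mono) auto
    also have "\<dots> \<le> \<nu> * (2 * (norm (P (Suc k)) * norm (B k)))"
      using IH \<open>\<nu> > 0\<close> by (simp add: mult.assoc)
    finally have "norm (B k) * (norm ?Y * norm ?Z) \<le> norm (B k) * (2 * \<nu> * norm (P (Suc k)))"
      by (simp add: algebra_simps)
    \<comment> \<open>The next block does not cancel against the past product: by the induction
      hypothesis, the absence of cancellation against the last block \<open>B k\<close> carries over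
      to \<open>P k\<close>, at the price of a factor 2.\<close>
    then have a: "norm ?Y * norm ?Z \<le> 2 * \<nu> * norm (P (Suc k))"
      using pos by (simp add: mult_le_cancel_left)
    have b: "norm ?X * norm ?Y \<le> \<nu> * norm (?X ** ?Y)" using nu[of "Suc k"] Suc by auto
    have "(norm ?X * norm ?Y) * (norm ?Y * norm ?Z) \<le> (\<nu> * norm (?X ** ?Y)) * (2 * \<nu> * norm (P (Suc k)))"
      using \<open>\<nu> > 0\<close> by (intro mult_mono[OF b a]) auto
    then have c: "(norm ?Y)\<^sup>2 * (norm ?X * norm ?Z) \<le> 2 * \<nu>\<^sup>2 * (norm (?X ** ?Y) * norm (P (Suc k)))"
      by (simp add: power2_eq_square algebra_simps)
    have "\<mu>\<^sup>2 \<le> (norm ?Y)\<^sup>2" using mu[of "Suc k"] Suc \<open>\<mu> > 0\<close> by (intro power_mono) auto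
    then have "4 * \<nu>\<^sup>2 * (norm ?X * norm ?Z) \<le> (norm ?Y)\<^sup>2 * (norm ?X * norm ?Z)"
      using \<open>4 * \<nu>\<^sup>2 \<le> \<mu>\<^sup>2\<close> by (intro mult_right_mono) auto
    with c have "\<nu>\<^sup>2 * (2 * (norm ?X * norm ?Z)) \<le> \<nu>\<^sup>2 * (norm (?X ** ?Y) * norm (P (Suc k)))"
      by (simp add: algebra_simps)
    \<comment> \<open>This makes the error in \<open>norm_triple_product\<close> at most half of its
      main term, which closes the induction with the same factor 2.\<close>
    then have d: "2 * (norm ?X * norm ?Z) \<le> norm (?X ** ?Y) * norm (P (Suc k))"
      using \<open>\<nu> > 0\<close> by (simp add: mult_le_cancel_left)
    have dY: "det ?Y = 1" using det[of "Suc k"] Suc by auto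
    have e: "\<bar>norm ?Y * norm (P (Suc (Suc k))) - norm (?X ** ?Y) * norm (P (Suc k))\<bar> \<le> norm ?X * norm ?Z"
      using norm_triple_product[OF dY, of ?X ?Z] by (simp add: PS)
    show ?case using d e by (simp add: algebra_simps abs_le_iff)
  qed
  have step: "\<bar>ln (norm (P (Suc k))) - ln (norm (P k))
      - (ln (norm (B (Suc k) ** B k)) - ln (norm (B k)))\<bar> \<le> ln 2" if "k < n" for k
  proof -
    have dP: "det (P m) = 1" if "m \<le> n" for m using det that unfolding P_def
      by (intro det_block_prod) auto
    have p1: "norm (P (Suc k)) > 0" "norm (P k) > 0"
      using norm_ge_1_if_det_1[OF dP, of "Suc k"] norm_ge_1_if_det_1[OF dP, of k] that by auto
    have "det (B (Suc k) ** B k) = 1" "det (B k) = 1" using det[of k] det[of "Suc k"] that by (auto simp: det_mul)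
    then have p2: "norm (B (Suc k) ** B k) > 0" "norm (B k) > 0"
      using norm_ge_1_if_det_1 by force+
    have "ln (norm (P (Suc k)) * norm (B k)) \<le> ln (2 * (norm (B (Suc k) ** B k) * norm (P k)))"
      using main[OF that] p1 p2 by (intro ln_mono) auto
    moreover have "ln (norm (B (Suc k) ** B k) * norm (P k)) \<le> ln (2 * (norm (P (Suc k)) * norm (B k)))"
      using main[OF that] p1 p2 by (intro ln_mono) auto
    ultimately show ?thesis using p1 p2 by (simp add: ln_mult abs_le_iff)
  qed
  have "m \<le> n \<Longrightarrow> \<bar>ln (norm (P m)) - ln (norm (B 0))
           - (\<Sum>j<m. ln (norm (B (Suc j) ** B j)) - ln (norm (B j)))\<bar> \<le> real m * ln 2" for m
  proof (induction m)
    case 0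
    then show ?case by (simp add: P_def)
  next
    case (Suc m)
    then show ?case using step[of m] by (simp add: algebra_simps)
  qed
  then show ?thesis by (simp add: P_def)
qed

section \<open>The Lyapunov exponent of a cocycle\<close>

text \<open>Fekete's lemma; nonnegativity keeps the infimum finite. It serves both the means, whose
  limit is the exponent, and the maxima, whose limit dominates the exponent.\<close>

lemma fekete:
  fixes a :: "nat \<Rightarrow> real"
  assumes sub: "\<And>m n. a (m + n) \<le> a m + a n" and nonneg: "\<And>n. 0 \<le> a n"
  obtains L where "(\<lambda>n. a n / real n) \<longlonglongrightarrow> L" "\<And>n. n \<ge> 1 \<Longrightarrow> L \<le> a n / real n" "L \<ge> 0"
proof -
  define L where "L = (INF n\<in>{1..}. a n / real n)"
  have bdd: "bdd_below ((\<lambda>n. a n / real n) ` {1..})"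
    using nonneg by (intro bdd_belowI2[of _ 0]) auto
  have le: "L \<le> a n / real n" if "n \<ge> 1" for n
    unfolding L_def using that by (intro cINF_lower[OF bdd]) auto
  have L0: "L \<ge> 0" unfolding L_def using nonneg by (intro cINF_greatest) auto
  have mult: "a (k * m) \<le> real k * a m" if "k \<ge> 1" for k m
    using that
  proof (induction k rule: nat_induct_at_least)
    case (Suc k)
    then show ?case using sub[of m "k * m"] by (simp add: algebra_simps)
  qed auto
  have "(\<lambda>n. a n / real n) \<longlonglongrightarrow> L"
  proof (rule LIMSEQ_I)
    fix e :: real assume "e > 0"
    have "\<exists>m\<in>{1..}. a m / real m < L + e / 2"
      using cINF_less_iff[OF _ bdd, of "L + e / 2"] \<open>e > 0\<close> unfolding L_def by auto
    then obtain m where m: "m \<ge> 1" "a m / real m < L + e / 2" by auto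
    \<comment> \<open>A crude bound for \<open>a r\<close> at all remainders \<open>r < m\<close> at
      once, independent of \<open>n\<close>.\<close>
    define K where "K = (\<Sum>r<m. a r)"
    have K: "a r \<le> K" if "r < m" for r
      unfolding K_def using that nonneg by (intro member_le_sum) auto
    obtain N where N: "real N > 2 * K / e" using reals_Archimedean2 by blast
    show "\<exists>no. \<forall>n\<ge>no. norm (a n / real n - L) < e"
    proof (intro exI allI impI)
      fix n assume n: "n \<ge> max (max 1 m) N"
      have "a n = a (n div m * m + n mod m)" by simp
      also have "\<dots> \<le> a (n div m * m) + a (n mod m)" by (rule sub)
      also have "a (n mod m) \<le> K" using m by (intro K) auto
      also have "a (n div m * m) \<le> real (n div m) * a m"
        using n m by (intro mult) (simp add: div_greater_zero_iff Suc_le_eq)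
      also have "real (n div m) * a m \<le> real n / real m * a m"
        using nonneg by (intro mult_right_mono) (simp_all add: of_nat_div_le_of_nat)
      finally have "a n \<le> real n / real m * a m + K" by simp
      then have "a n / real n \<le> (real n / real m * a m + K) / real n" by (intro divide_right_mono) auto
      also have "\<dots> = a m / real m + K / real n" using n m by (simp add: field_simps)
      also have "K / real n < e / 2"
      proof -
        have "2 * K / e < real n" using N n by (smt (verit) max.bounded_iff of_nat_le_iff)
        then show ?thesis using \<open>e > 0\<close> n by (simp add: field_simps)
      qed
      finally have "a n / real n < L + e" using m by linarith
      then show "norm (a n / real n - L) < e" using le[of n] n by simp
    qed
  qed
  then show ?thesis using that le L0 by blast
qed

lemma integral_periodic_shift:
  fixes g :: "real \<Rightarrow> real"
  assumes cont: "continuous_on UNIV g" and per: "\<And>x. g (x + 1) = g x"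
  shows "integral {0..1} (\<lambda>x. g (x + c)) = integral {0..1} g"
proof -
  have per_int: "g (x + of_int k) = g x" for x k
    using per by (rule periodic_of_int)
  have int: "g integrable_on {a..b}" for a b
    by (intro integrable_continuous_real continuous_on_subset[OF cont]) auto
  define d where "d = frac c"
  have d: "0 \<le> d" "d < 1" by (auto simp: d_def frac_lt_1)
  have gd: "g (x + c) = g (x + d)" for x
    using per_int[of "x + d" "\<lfloor>c\<rfloor>"] by (simp add: d_def frac_def algebra_simps)
  have "integral {0..1} (\<lambda>x. g (x + d)) = integral {d..1 + d} g"
    using integral_shift[of 0 d 1 g] continuous_on_subset[OF cont] by (simp add: o_def add.commute)
  also have "\<dots> = integral {d..1} g + integral {1..1 + d} g"
    using Henstock_Kurzweil_Integration.integral_combine[where a = d and c = 1 and b = "1 + d" and f = g] int d by simp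
  also have "integral {1..1 + d} g = integral {0..d} (\<lambda>x. g (x + 1))"
    using integral_shift[of 0 1 d g] continuous_on_subset[OF cont] by (simp add: o_def add.commute)
  also have "\<dots> = integral {0..d} g" by (simp add: per)
  also have "integral {d..1} g + integral {0..d} g = integral {0..1} g"
    using Henstock_Kurzweil_Integration.integral_combine[where a = 0 and c = d and b = 1 and f = g] int d by simp
  finally show ?thesis unfolding gd .
qed

lemma ln_lipschitz_ge_1:
  fixes a b :: real
  assumes "a \<ge> 1" "b \<ge> 1"
  shows "\<bar>ln a - ln b\<bar> \<le> \<bar>a - b\<bar>"
proof -
  have *: "ln a - ln b \<le> \<bar>a - b\<bar>" if "a \<ge> 1" "b \<ge> 1" for a b :: real
  proof -
    have "ln a - ln b = ln (a / b)" using that by (simp add: ln_div)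
    also have "\<dots> \<le> a / b - 1" using that by (intro ln_le_minus_one) auto
    also have "\<dots> = (a - b) / b" using that by (simp add: field_simps)
    also have "\<dots> \<le> \<bar>a - b\<bar> / 1" using that by (intro frac_le) auto
    finally show ?thesis by simp
  qed
  show ?thesis using *[OF assms] *[OF assms(2,1)] by linarith
qed

lemma continuous_on_matrix_mult:
  fixes f g :: "'a::topological_space \<Rightarrow> real^2^2"
  assumes "continuous_on S f" "continuous_on S g"
  shows "continuous_on S (\<lambda>x. f x ** g x)"
  unfolding matrix_matrix_mult_def by (intro continuous_intros assms)

text \<open>\<open>\<Gamma>\<close> bounds the logarithm of the norm of one factor. For Schrodinger
  cocycles it depends only on bounds for the potential and the energy, so constants expressed
  through it are uniform near a given energy. The assumptions constrain \<open>A\<close> alone, so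
  the locale predicate takes \<open>A\<close> and \<open>\<Gamma>\<close>, and
  \<open>\<alpha>\<close> is fixed by each interpretation.\<close>

locale sl2_cocycle =
  fixes \<alpha> :: real and A :: "real \<Rightarrow> real^2^2" and \<Gamma> :: real
  assumes cont: "continuous_on UNIV A" and per: "\<And>x. A (x + 1) = A x"
    and det: "\<And>x. det (A x) = 1" and bound: "\<And>x. norm (A x) \<le> exp \<Gamma>"
begin

abbreviation "It \<equiv> cocycle_iterate \<alpha> A"

definition ell :: "nat \<Rightarrow> real \<Rightarrow> real" where "ell N x = ln (norm (It N x))"

lemma Gamma_nonneg: "\<Gamma> \<ge> 0"
  using bound[of 0] norm_ge_1_if_det_1[OF det[of 0]] by (metis exp_le_cancel_iff exp_zero order_trans)

lemma det_It: "det (It N x) = 1"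
  by (induction N) (simp_all add: det_mul det)

lemma norm_It_ge_1: "norm (It N x) \<ge> 1"
  by (rule norm_ge_1_if_det_1[OF det_It])

lemma norm_It_pos: "norm (It N x) > 0"
  using norm_It_ge_1[of N x] by linarith

lemma It_add: "It (m + n) x = It m (x + real n * \<alpha>) ** It n x"
  by (induction m) (simp_all add: matrix_mul_assoc algebra_simps)

lemma It_1: "It 1 x = A x" by simp

lemma It_per: "It N (x + 1) = It N x"
proof (induction N)
  case (Suc N)
  then show ?case using per[of "x + real N * \<alpha>"] by (simp add: algebra_simps)
qed auto

lemma It_continuous: "continuous_on UNIV (It N)"
proof (induction N)
  case 0
  have "It 0 = (\<lambda>x. mat 1)" by auto
  then show ?case by simp
next
  case (Suc N)
  have "It (Suc N) = (\<lambda>x. A (x + real N * \<alpha>) ** It N x)" by auto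
  moreover have "continuous_on UNIV (\<lambda>x. A (x + real N * \<alpha>))"
    by (intro continuous_on_compose2[OF cont] continuous_intros) auto
  ultimately show ?case using Suc continuous_on_matrix_mult by metis
qed

lemma ell_continuous: "continuous_on S (ell N)"
proof -
  have "norm (It N x) \<noteq> 0" for x using norm_It_pos[of N x] by linarith
  then show ?thesis unfolding ell_def
    by (intro continuous_intros continuous_on_subset[OF It_continuous]) auto
qed

lemma ell_nonneg: "ell N x \<ge> 0"
  unfolding ell_def using norm_It_ge_1 by (intro ln_ge_zero) auto

lemma ell_per: "ell N (x + 1) = ell N x"
  by (simp add: ell_def It_per)

lemma ell_per_int: "ell N (x + of_int k) = ell N x"
  using ell_per by (rule periodic_of_int)

lemma ell_add: "ell (m + n) x \<le> ell m (x + real n * \<alpha>) + ell n x"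
proof -
  have "ln (norm (It (m + n) x)) \<le> ln (norm (It m (x + real n * \<alpha>)) * norm (It n x))"
    unfolding It_add using norm_matrix_mult_le norm_It_pos It_add by (intro ln_mono) (auto, metis)
  then show ?thesis unfolding ell_def using norm_It_pos
    by (simp add: ln_mult less_imp_neq[symmetric])
qed

lemma ln_norm_A: "ln (norm (A x)) \<le> \<Gamma>"
  using bound[of x] norm_It_pos[of 1 x] by (metis It_1 ln_exp ln_mono)

text \<open>A factor and its inverse both have norm at most \<open>exp \<Gamma>\<close>, so one more
  factor changes the logarithm by at most \<open>\<Gamma>\<close> in either direction.\<close>

lemma ell_Suc: "\<bar>ell (Suc N) x - ell N x\<bar> \<le> \<Gamma>"
proof -
  let ?B = "A (x + real N * \<alpha>)"
  have pos: "norm ?B > 0" using norm_It_pos[of 1] by (metis It_1)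
  have "ln (norm (It (Suc N) x)) \<le> ln (norm ?B * norm (It N x))"
    using norm_matrix_mult_le[of ?B "It N x"] norm_It_pos[of "Suc N" x] by (intro ln_mono) auto
  moreover have "ln (norm (It N x)) \<le> ln (norm ?B * norm (It (Suc N) x))"
    using norm_le_mult_left[OF det, of "It N x" "x + real N * \<alpha>"] norm_It_pos[of N x] by (intro ln_mono) auto
  ultimately show ?thesis
    unfolding ell_def ln_mult_pos[OF pos norm_It_pos] using ln_norm_A[of "x + real N * \<alpha>"] by linarith
qed

lemma ell_remainder: "\<bar>ell (N + r) x - ell N x\<bar> \<le> real r * \<Gamma>"
proof (induction r)
  case (Suc r)
  then show ?case using ell_Suc[of "N + r" x] by (simp add: algebra_simps)
qed auto

text \<open>Rotating by \<open>\<alpha>\<close> drops the first factor of the product and appends a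
  new last one. This near invariance, with a bound independent of \<open>N\<close>, is what lets one
  value stand for a whole stretch of the orbit.\<close>

lemma ell_shift: "\<bar>ell N (x + \<alpha>) - ell N x\<bar> \<le> 2 * \<Gamma>"
proof -
  have pos: "norm (A x) > 0" using norm_It_pos[of 1] by (metis It_1)
  have e: "It (Suc N) x = It N (x + \<alpha>) ** A x"
    using It_add[of N 1 x] by simp
  have "ln (norm (It (Suc N) x)) \<le> ln (norm (It N (x + \<alpha>)) * norm (A x))"
    unfolding e using norm_matrix_mult_le[of "It N (x + \<alpha>)" "A x"] norm_It_pos[of "Suc N" x, unfolded e]
    by (intro ln_mono) auto
  moreover have "ln (norm (It N (x + \<alpha>))) \<le> ln (norm (It (Suc N) x) * norm (A x))"
    unfolding e using norm_le_mult_right[OF det, of "It N (x + \<alpha>)" x] norm_It_pos[of N "x + \<alpha>"]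
    by (intro ln_mono) auto
  ultimately have "\<bar>ell N (x + \<alpha>) - ell (Suc N) x\<bar> \<le> \<Gamma>"
    unfolding ell_def ln_mult_pos[OF norm_It_pos pos] using ln_norm_A[of x] by linarith
  then show ?thesis using ell_Suc[of N x] by linarith
qed

text \<open>The \<open>1\<close> absorbs \<open>ell 0 x = ln (sqrt 2)\<close>, as the identity has
  Hilbert--Schmidt norm \<open>sqrt 2\<close>.\<close>

lemma ell_upper: "ell N x \<le> real N * \<Gamma> + 1"
proof -
  have "ln (sqrt 2) \<le> sqrt 2 - 1" by (rule ln_le_minus_one) simp
  also have "\<dots> \<le> 1" using real_sqrt_le_mono[of 2 4] by simp
  finally have "ell 0 x \<le> 1" by (simp add: ell_def norm_mat_1_2)
  then show ?thesis using ell_remainder[of 0 N x] by simp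
qed

definition ell_max :: "nat \<Rightarrow> real" where "ell_max N = (SUP x. ell N x)"

lemma ell_le_max: "ell N x \<le> ell_max N"
  unfolding ell_max_def using ell_upper by (intro cSUP_upper bdd_aboveI2) auto

lemma ell_max_attained: "\<exists>x. ell N x = ell_max N"
proof -
  have ne: "{0..1::real} \<noteq> {}" by auto
  obtain x where x: "\<And>y. y \<in> {0..1} \<Longrightarrow> ell N y \<le> ell N x"
    using continuous_attains_sup[OF compact_Icc ne ell_continuous] by blast
  have "ell N y \<le> ell N x" for y
    using x[of "frac y"] ell_per_int[of N "frac y" "\<lfloor>y\<rfloor>"] frac_lt_1[of y] by (simp add: frac_def less_imp_le)
  then have "ell_max N = ell N x"
    unfolding ell_max_def by (intro cSup_eq_maximum) auto
  then show ?thesis by metis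
qed

lemma ell_max_nonneg: "ell_max N \<ge> 0"
  using ell_nonneg ell_le_max order_trans by blast

lemma ell_max_add: "ell_max (m + n) \<le> ell_max m + ell_max n"
  by (metis ell_max_attained ell_add ell_le_max add_mono order_trans)

definition ell_mean :: "nat \<Rightarrow> real" where "ell_mean N = integral {0..1} (ell N)"

lemma ell_integrable: "ell N integrable_on {0..1}"
  by (rule integrable_continuous_real[OF ell_continuous])

lemma ell_mean_nonneg: "ell_mean N \<ge> 0"
  unfolding ell_mean_def using ell_nonneg by (intro integral_nonneg ell_integrable) auto

lemma ell_mean_le_max: "ell_mean N \<le> ell_max N"
proof -
  have "ell_mean N \<le> integral {0..1} (\<lambda>_::real. ell_max N)"
    unfolding ell_mean_def using ell_le_max by (intro integral_le ell_integrable) auto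
  then show ?thesis by simp
qed

text \<open>Invariance of the integral under rotation removes the shift in
  \<open>ell_add\<close>.\<close>

lemma ell_mean_add: "ell_mean (m + n) \<le> ell_mean m + ell_mean n"
proof -
  have c: "continuous_on {0..1} (\<lambda>x. ell m (x + real n * \<alpha>))"
    by (intro continuous_on_compose2[OF ell_continuous[of UNIV]] continuous_intros) auto
  have "ell_mean (m + n) \<le> integral {0..1} (\<lambda>x. ell m (x + real n * \<alpha>) + ell n x)"
    unfolding ell_mean_def using ell_add
    by (intro integral_le ell_integrable integrable_add integrable_continuous_real[OF c]) auto
  also have "\<dots> = integral {0..1} (\<lambda>x. ell m (x + real n * \<alpha>)) + ell_mean n"
    unfolding ell_mean_def by (intro integral_add ell_integrable integrable_continuous_real[OF c])
  also have "integral {0..1} (\<lambda>x. ell m (x + real n * \<alpha>)) = ell_mean m"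
    unfolding ell_mean_def by (rule integral_periodic_shift[OF ell_continuous ell_per])
  finally show ?thesis .
qed

text \<open>Links the operator norm of the definition to the Hilbert--Schmidt norm of the proof;
  their logarithms differ by at most \<open>ln 2\<close>. Continuity of the operator norm is
  established only to compare the two kinds of integral.\<close>

lemma finite_lyapunov_close:
  assumes "N \<ge> 1"
  shows "\<bar>finite_lyapunov \<alpha> A N - ell_mean N / real N\<bar> \<le> ln 2 / real N"
proof -
  define w where "w x = ln (onorm ((*v) (It N x)))" for x
  have lower: "norm (It N x) / 2 \<le> onorm ((*v) (It N x))" for x
    using norm_matrix_le_onorm[of "It N x"] by simp
  have pos: "onorm ((*v) (It N x)) > 0" for x
    using lower[of x] norm_It_pos[of N x] by linarith
  have lip: "\<bar>onorm ((*v) (B::real^2^2)) - onorm ((*v) C)\<bar> \<le> norm (B - C)" for B C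
  proof -
    have *: "onorm ((*v) (B::real^2^2)) \<le> onorm ((*v) C) + norm (B - C)" for B C
    proof -
      have "(*v) B = (\<lambda>x. C *v x + (B - C) *v x)"
        by (auto simp: matrix_vector_mult_diff_rdistrib)
      then have "onorm ((*v) B) \<le> onorm ((*v) C) + onorm ((*v) (B - C))"
        using onorm_triangle[of "(*v) C" "(*v) (B - C)"] by (simp add: matrix_vector_mul_bounded_linear)
      then show ?thesis using onorm_le_norm_matrix[of "B - C"] by linarith
    qed
    show ?thesis using *[of B C] *[of C B] norm_minus_commute[of B C] by linarith
  qed
  have "continuous_on UNIV (\<lambda>B::real^2^2. onorm ((*v) B))"
    unfolding continuous_on_iff dist_norm real_norm_def
  proof (intro ballI allI impI)
    fix B :: "real^2^2" and e :: real assume "e > 0"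
    then show "\<exists>d>0. \<forall>C\<in>UNIV. norm (C - B) < d \<longrightarrow> \<bar>onorm ((*v) C) - onorm ((*v) B)\<bar> < e"
      using lip by (intro exI[of _ e]) (auto intro: le_less_trans)
  qed
  then have "continuous_on UNIV (\<lambda>x. onorm ((*v) (It N x)))"
    by (rule continuous_on_compose2[OF _ It_continuous]) auto
  then have "continuous_on {0..1} (\<lambda>x. onorm ((*v) (It N x)))"
    by (rule continuous_on_subset) auto
  moreover have "onorm ((*v) (It N x)) \<noteq> 0" for x using pos[of x] by simp
  ultimately have co: "continuous_on {0..1} w"
    unfolding w_def by (intro continuous_on_ln) auto
  have "set_integrable lborel {0..1} w"
    using borel_integrable_compact[OF compact_Icc co] by (simp add: set_integrable_def)
  then have fl: "finite_lyapunov \<alpha> A N = integral {0..1} w / real N"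
    unfolding finite_lyapunov_def w_def[symmetric] by (simp add: set_borel_integral_eq_integral)
  have o1: "w x \<le> ell N x" for x
    unfolding w_def ell_def using pos onorm_le_norm_matrix by (intro ln_mono) auto
  have o2: "ell N x \<le> w x + ln 2" for x
  proof -
    have "ell N x \<le> ln (2 * onorm ((*v) (It N x)))"
      unfolding ell_def using norm_matrix_le_onorm norm_It_pos by (intro ln_mono) auto
    then show ?thesis unfolding w_def using pos[of x] by (simp add: ln_mult)
  qed
  have i1: "integral {0..1} w \<le> ell_mean N" unfolding ell_mean_def
    using o1 by (intro integral_le integrable_continuous_real[OF co] ell_integrable) auto
  have "ell_mean N \<le> integral {0..1} (\<lambda>x. w x + ln 2)" unfolding ell_mean_def
    using o2 by (intro integral_le integrable_add integrable_continuous_real[OF co] ell_integrable) auto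
  also have "\<dots> = integral {0..1} w + ln 2"
    by (subst integral_add) (auto intro: integrable_continuous_real[OF co])
  finally have "\<bar>integral {0..1} w - ell_mean N\<bar> \<le> ln 2" using i1 by linarith
  then have "\<bar>integral {0..1} w - ell_mean N\<bar> / real N \<le> ln 2 / real N" by (rule divide_right_mono) simp
  then show ?thesis using assms by (simp add: fl diff_divide_distrib[symmetric] abs_divide)
qed

text \<open>\<open>lyapunov\<close> is a \<open>lim\<close>, which carries information only once
  convergence is known. Fekete's lemma for the Hilbert--Schmidt means supplies it, together with the
  bound of the limit by every term.\<close>

lemma lyapunov_limit: "(\<lambda>N. ell_mean N / real N) \<longlonglongrightarrow> lyapunov \<alpha> A"
  and lyapunov_le: "N \<ge> 1 \<Longrightarrow> lyapunov \<alpha> A \<le> ell_mean N / real N"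
  and lyapunov_nonneg: "lyapunov \<alpha> A \<ge> 0"
proof -
  obtain L where L: "(\<lambda>n. ell_mean n / real n) \<longlonglongrightarrow> L" "\<And>n. n \<ge> 1 \<Longrightarrow> L \<le> ell_mean n / real n" "L \<ge> 0"
    using fekete[OF ell_mean_add ell_mean_nonneg] by blast
  have "(\<lambda>N. finite_lyapunov \<alpha> A N - ell_mean N / real N) \<longlonglongrightarrow> 0"
  proof (rule Lim_null_comparison)
    show "\<forall>\<^sub>F N in sequentially. norm (finite_lyapunov \<alpha> A N - ell_mean N / real N) \<le> ln 2 / real N"
      using finite_lyapunov_close by (auto simp: eventually_sequentially)
    show "(\<lambda>N. ln 2 / real N) \<longlonglongrightarrow> 0" by (rule lim_const_over_n)
  qed
  from tendsto_add[OF this L(1)] have "finite_lyapunov \<alpha> A \<longlonglongrightarrow> L" by simp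
  then have "lyapunov \<alpha> A = L" unfolding lyapunov_def by (rule limI)
  then show "(\<lambda>N. ell_mean N / real N) \<longlonglongrightarrow> lyapunov \<alpha> A"
    "N \<ge> 1 \<Longrightarrow> lyapunov \<alpha> A \<le> ell_mean N / real N" "lyapunov \<alpha> A \<ge> 0"
    using L by auto
qed

text \<open>One-sided, since no value exceeds the maximum; \<open>\<tau>\<close> is the deviation
  per factor.\<close>

definition deviation_set :: "nat \<Rightarrow> real \<Rightarrow> real set" where
  "deviation_set N \<tau> = {x\<in>{0..1}. ell N x < ell_max N - real N * \<tau>}"

lemma deviation_set_measurable: "deviation_set N \<tau> \<in> fmeasurable lborel"
  unfolding deviation_set_def by (rule sublevel_fmeasurable[OF ell_continuous])

end

text \<open>Telescoping over the position of the replaced factor, then \<open>ln\<close> is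
  1-Lipschitz on norms of at least 1. The exponential constant is why truncations must be
  exponentially accurate in \<open>N\<close>, and why energies are compared only at a fixed
  length.\<close>

lemma ell_perturb:
  assumes "sl2_cocycle A \<Gamma>" "sl2_cocycle B \<Gamma>" and e: "\<And>x. norm (A x - B x) \<le> e"
  shows "\<bar>sl2_cocycle.ell \<alpha> A N x - sl2_cocycle.ell \<alpha> B N x\<bar> \<le> 2 * real N * exp (real N * \<Gamma>) * e"
proof -
  interpret A: sl2_cocycle \<alpha> A \<Gamma> by fact
  interpret B: sl2_cocycle \<alpha> B \<Gamma> by fact
  have bnd: "norm (A.It N x) \<le> 2 * exp (real N * \<Gamma>)" for N
  proof (induction N)
    case 0
    show ?case using real_sqrt_le_mono[of 2 4] by (simp add: norm_mat_1_2)
  next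
    case (Suc N)
    have "norm (A.It (Suc N) x) \<le> norm (A (x + real N * \<alpha>)) * norm (A.It N x)"
      by (simp add: norm_matrix_mult_le)
    also have "\<dots> \<le> exp \<Gamma> * (2 * exp (real N * \<Gamma>))" using Suc A.bound by (intro mult_mono) auto
    also have "\<dots> = 2 * exp (real (Suc N) * \<Gamma>)" by (simp add: exp_add algebra_simps)
    finally show ?case .
  qed
  have e0: "e \<ge> 0" using e[of 0] norm_ge_zero order_trans by blast
  have "norm (A.It N x - B.It N x) \<le> 2 * real N * exp (real N * \<Gamma>) * e"
  proof (induction N)
    case (Suc N)
    let ?y = "x + real N * \<alpha>"
    have "A.It (Suc N) x - B.It (Suc N) x = (A ?y - B ?y) ** A.It N x + B ?y ** (A.It N x - B.It N x)"
      by (simp add: matrix_matrix_mult_def vec_eq_iff sum_2 algebra_simps)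
    then have "norm (A.It (Suc N) x - B.It (Suc N) x)
        \<le> norm (A ?y - B ?y) * norm (A.It N x) + norm (B ?y) * norm (A.It N x - B.It N x)"
      by (metis (no_types, lifting) add_mono norm_matrix_mult_le norm_triangle_le)
    also have "\<dots> \<le> e * (2 * exp (real N * \<Gamma>)) + exp \<Gamma> * (2 * real N * exp (real N * \<Gamma>) * e)"
      using e bnd B.bound Suc e0 by (intro add_mono mult_mono) auto
    also have "\<dots> \<le> e * (2 * (exp \<Gamma> * exp (real N * \<Gamma>))) + exp \<Gamma> * (2 * real N * exp (real N * \<Gamma>) * e)"
      using e0 A.Gamma_nonneg by (intro add_mono mult_left_mono) auto
    also have "\<dots> = 2 * real (Suc N) * exp (real (Suc N) * \<Gamma>) * e"
      by (simp add: exp_add algebra_simps)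
    finally show ?case .
  qed auto
  moreover have "\<bar>A.ell N x - B.ell N x\<bar> \<le> \<bar>norm (A.It N x) - norm (B.It N x)\<bar>"
    unfolding A.ell_def B.ell_def by (intro ln_lipschitz_ge_1 A.norm_It_ge_1 B.norm_It_ge_1)
  ultimately show ?thesis using norm_triangle_ineq3[of "A.It N x" "B.It N x"] by linarith
qed

section \<open>Zeros of entire functions\<close>

text \<open>Hadamard's three lines theorem without a growth argument at infinity: multiplying
  \<open>F\<close> by an exponential equalizes the bounds on the two boundary lines, and although
  the product need not be periodic, its modulus is. The maximum is therefore attained in a compact
  rectangle.\<close>

lemma periodic_three_lines_upper:
  assumes hol: "F holomorphic_on UNIV" and per: "\<And>z. F (z + 1) = F z" and "h > 0"
    and M: "\<And>z. \<bar>Im z\<bar> \<le> h \<Longrightarrow> cmod (F z) \<le> exp M"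
    and S: "\<And>x. cmod (F (complex_of_real x)) \<le> exp S"
    and z: "0 \<le> Im z" "Im z \<le> h"
  shows "cmod (F z) \<le> exp (S + Im z / h * (M - S))"
proof -
  define l where "l = (M - S) / h"
  define P where "P z = F z * exp (\<i> * of_real l * z)" for z
  have nP: "cmod (P z) = cmod (F z) * exp (- l * Im z)" for z
    by (simp add: P_def norm_mult)
  have holP: "P holomorphic_on UNIV"
    unfolding P_def by (intro holomorphic_intros hol)
  have perP': "cmod (P (z + 1)) = cmod (P z)" for z
    by (simp add: nP per)
  have perP: "cmod (P (z + of_int k)) = cmod (P z)" for z k
    using perP' by (rule periodic_of_int)
  let ?K = "cbox 0 (Complex 1 h)"
  have "0 \<in> ?K" using \<open>h > 0\<close> by (auto simp: in_cbox_complex_iff)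
  then have "?K \<noteq> {}" by blast
  moreover have "continuous_on ?K (\<lambda>z. cmod (P z))"
    by (intro continuous_intros holomorphic_on_imp_continuous_on holomorphic_on_subset[OF holP]) auto
  ultimately obtain w where w: "w \<in> ?K" "\<And>z. z \<in> ?K \<Longrightarrow> cmod (P z) \<le> cmod (P w)"
    using continuous_attains_sup[of ?K "\<lambda>z. cmod (P z)"] compact_cbox by metis
  have wmax: "cmod (P z) \<le> cmod (P w)" if "0 \<le> Im z" "Im z \<le> h" for z
  proof -
    have "z + of_int (- \<lfloor>Re z\<rfloor>) \<in> ?K"
      using that by (auto simp: in_cbox_complex_iff) linarith
    from w(2)[OF this] perP[of z "- \<lfloor>Re z\<rfloor>"] show ?thesis by simp
  qed
  have b0: "cmod (P z) \<le> exp S" if "Im z = 0" for z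
  proof -
    have "z = of_real (Re z)" using that by (simp add: complex_eq_iff)
    then show ?thesis using that S[of "Re z"] by (simp add: nP)
  qed
  have bh: "cmod (P z) \<le> exp S" if "Im z = h" for z
  proof -
    have "cmod (P z) \<le> exp M * exp (- l * h)"
      unfolding nP using M[of z] that \<open>h > 0\<close> by (auto intro: mult_right_mono)
    also have "\<dots> = exp (M - l * h)" by (simp add: exp_diff exp_minus field_simps)
    also have "l * h = M - S" using \<open>h > 0\<close> by (simp add: l_def)
    also have "exp (M - (M - S)) = exp S" by simp
    finally show ?thesis .
  qed
  have "cmod (P w) \<le> exp S"
  proof (cases "0 < Im w \<and> Im w < h")
    case False
    with w(1) have "Im w = 0 \<or> Im w = h" by (auto simp: in_cbox_complex_iff)
    then show ?thesis using b0 bh by blast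
  next
    case True
    \<comment> \<open>A maximum inside the open strip makes \<open>P\<close> constant, so its value
      is again bounded by the one on the real axis.\<close>
    have "P constant_on UNIV"
    proof (rule maximum_modulus_principle[OF holP])
      show "open ({z. 0 < Im z} \<inter> {z. Im z < h})"
        by (intro open_Int open_halfspace_Im_gt open_halfspace_Im_lt)
      show "w \<in> {z. 0 < Im z} \<inter> {z. Im z < h}" using True by auto
    qed (use wmax in auto)
    then have "P w = P 0" by (auto simp: constant_on_def)
    then show ?thesis using b0[of 0] by simp
  qed
  then have "cmod (F z) * exp (- l * Im z) \<le> exp S"
    using wmax[of z] z unfolding nP[symmetric] by linarith
  then have "cmod (F z) \<le> exp S * exp (l * Im z)"
    by (simp add: exp_minus field_simps)
  then show ?thesis by (simp add: exp_add l_def algebra_simps)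
qed

text \<open>The reflection \<open>z \<mapsto> - z\<close> carries the lower half of the strip to the
  upper half and preserves periodicity.\<close>

lemma periodic_three_lines:
  assumes hol: "F holomorphic_on UNIV" and per: "\<And>z. F (z + 1) = F z" and "h > 0"
    and M: "\<And>z. \<bar>Im z\<bar> \<le> h \<Longrightarrow> cmod (F z) \<le> exp M"
    and S: "\<And>x. cmod (F (complex_of_real x)) \<le> exp S"
    and z: "\<bar>Im z\<bar> \<le> h"
  shows "cmod (F z) \<le> exp (S + \<bar>Im z\<bar> / h * (M - S))"
proof (cases "Im z \<ge> 0")
  case True
  then show ?thesis using periodic_three_lines_upper[OF hol per \<open>h > 0\<close> M S, of z] z by auto
next
  case False
  have "cmod (F (- (- z))) \<le> exp (S + Im (- z) / h * (M - S))"
  proof (rule periodic_three_lines_upper[of "\<lambda>z. F (- z)"])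
    show "(\<lambda>z. F (- z)) holomorphic_on UNIV"
      by (intro holomorphic_on_compose[OF _ holomorphic_on_subset[OF hol], unfolded o_def] holomorphic_intros) auto
    show "F (- (z + 1)) = F (- z)" for z using per[of "- (z + 1)"] by simp
    show "cmod (F (- z)) \<le> exp M" if "\<bar>Im z\<bar> \<le> h" for z using M[of "- z"] that by simp
    show "cmod (F (- complex_of_real x)) \<le> exp S" for x using S[of "- x"] by simp
  qed (use z False \<open>h > 0\<close> in auto)
  then show ?thesis using False by simp
qed

text \<open>The product of the denominators of the Blaschke factors of the disc of centre
  \<open>c\<close> and radius \<open>R\<close>. On the bounding circle it has the modulus of the
  polynomial with roots \<open>zs\<close>, but it has no zeros in the disc when the roots lie
  inside. Exchanging the polynomial for it is division by a Blaschke product without poles to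
  discuss.\<close>

definition blaschke_den :: "complex \<Rightarrow> real \<Rightarrow> complex list \<Rightarrow> complex \<Rightarrow> complex" where
  "blaschke_den c R zs z = (\<Prod>\<zeta>\<leftarrow>zs. (of_real (R\<^sup>2) - cnj (\<zeta> - c) * (z - c)) / of_real R)"

lemma blaschke_den_simps [simp]:
  "blaschke_den c R [] z = 1"
  "blaschke_den c R (\<zeta> # zs) z = (of_real (R\<^sup>2) - cnj (\<zeta> - c) * (z - c)) / of_real R * blaschke_den c R zs z"
  by (auto simp: blaschke_den_def)

lemma holomorphic_blaschke_den: "blaschke_den c R zs holomorphic_on A"
proof (induction zs)
  case Nil
  have "blaschke_den c R [] = (\<lambda>z. 1)" by auto
  then show ?case by simp
next
  case (Cons a zs)
  have "blaschke_den c R (a # zs) = (\<lambda>z. (of_real (R\<^sup>2) - cnj (a - c) * (z - c)) * (1 / of_real R) * blaschke_den c R zs z)"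
    by auto
  moreover have "\<dots> holomorphic_on A" using Cons by (intro holomorphic_intros)
  ultimately show ?case by metis
qed

lemma blaschke_den_center: "R \<noteq> 0 \<Longrightarrow> blaschke_den c R zs c = of_real R ^ length zs"
  by (induction zs) (auto simp: power2_eq_square)

lemma blaschke_den_boundary:
  assumes "cmod (z - c) = R" "R > 0"
  shows "cmod (blaschke_den c R zs z) = cmod (\<Prod>\<zeta>\<leftarrow>zs. z - \<zeta>)"
proof (induction zs)
  case (Cons a zs)
  have "of_real (R\<^sup>2) = (z - c) * cnj (z - c)"
    using assms(1) complex_norm_square by blast
  then have "of_real (R\<^sup>2) - cnj (a - c) * (z - c) = (z - c) * cnj (z - a)"
    by (simp add: algebra_simps)
  then have "cmod ((of_real (R\<^sup>2) - cnj (a - c) * (z - c)) / of_real R) = cmod (z - a)"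
    using assms by (simp add: norm_mult norm_divide del: complex_cnj_diff)
  then show ?case using Cons by (simp only: blaschke_den_simps norm_mult list.map prod_list.Cons)
qed auto

lemma blaschke_den_nonzero:
  assumes "cmod (z - c) < R" "\<And>\<zeta>. \<zeta> \<in> set zs \<Longrightarrow> cmod (\<zeta> - c) < R"
  shows "blaschke_den c R zs z \<noteq> 0"
  using assms(2)
proof (induction zs)
  case (Cons a zs)
  have "cmod (cnj (a - c) * (z - c)) < R * R"
    unfolding norm_mult complex_mod_cnj using Cons(2)[of a] assms(1)
    by (intro mult_strict_mono) (auto intro: le_less_trans[OF norm_ge_zero])
  moreover have "cmod (of_real (R\<^sup>2)) = R * R"
    by (simp only: norm_of_real) (simp add: power2_eq_square)
  ultimately have "cnj (a - c) * (z - c) \<noteq> of_real (R\<^sup>2)"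
    by (metis less_irrefl)
  moreover have "R > 0" using assms(1) by (meson le_less_trans norm_ge_zero)
  ultimately show ?case using Cons by auto
qed auto

lemma blaschke_den_upper:
  assumes "cmod (z - c) \<le> R" "\<And>\<zeta>. \<zeta> \<in> set zs \<Longrightarrow> cmod (\<zeta> - c) \<le> R" "R > 0"
  shows "cmod (blaschke_den c R zs z) \<le> (2 * R) ^ length zs"
  using assms(2)
proof (induction zs)
  case (Cons a zs)
  have "cmod (of_real (R\<^sup>2) - cnj (a - c) * (z - c)) \<le> R\<^sup>2 + cmod (a - c) * cmod (z - c)"
    by (metis (no_types, opaque_lifting) abs_power2 complex_mod_cnj norm_mult norm_of_real norm_triangle_ineq4)
  also have "\<dots> \<le> R\<^sup>2 + R * R" using Cons(2)[of a] assms by (intro add_left_mono mult_mono) auto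
  finally have "cmod ((of_real (R\<^sup>2) - cnj (a - c) * (z - c)) / of_real R) \<le> 2 * R"
    using assms by (simp add: norm_divide field_simps power2_eq_square del: of_real_power of_real_mult)
  then have "cmod ((of_real (R\<^sup>2) - cnj (a - c) * (z - c)) / of_real R) * cmod (blaschke_den c R zs z)
      \<le> 2 * R * (2 * R) ^ length zs"
    using Cons assms by (intro mult_mono) auto
  then show ?case by (simp only: blaschke_den_simps norm_mult length_Cons power_Suc)
qed auto

text \<open>On the circle the modulus is that of \<open>f\<close>, so the maximum principle applies
  even though the zeros of \<open>f\<close> have been removed.\<close>

lemma blaschke_quotient_bound:
  assumes hol: "g holomorphic_on UNIV" and "R > 0"
    and f: "\<And>z. f z = (\<Prod>\<zeta>\<leftarrow>zs. z - \<zeta>) * g z"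
    and B: "\<And>z. cmod (z - c) \<le> R \<Longrightarrow> cmod (f z) \<le> B"
    and z: "cmod (z - c) \<le> R"
  shows "cmod (g z * blaschke_den c R zs z) \<le> B"
proof (rule maximum_modulus_frontier[of "\<lambda>z. g z * blaschke_den c R zs z" "cball c R"])
  show "(\<lambda>z. g z * blaschke_den c R zs z) holomorphic_on interior (cball c R)"
    by (intro holomorphic_intros holomorphic_blaschke_den holomorphic_on_subset[OF hol]) auto
  show "continuous_on (closure (cball c R)) (\<lambda>z. g z * blaschke_den c R zs z)"
    by (intro continuous_intros holomorphic_on_imp_continuous_on holomorphic_blaschke_den holomorphic_on_subset[OF hol]) auto
  show "cmod (g z * blaschke_den c R zs z) \<le> B" if "z \<in> frontier (cball c R)" for z
  proof -
    have "cmod (z - c) = R" using that by (auto simp: frontier_cball dist_norm norm_minus_commute)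
    then show ?thesis using B[of z] blaschke_den_boundary[of z c R zs] \<open>R > 0\<close>
      by (simp add: f norm_mult mult.commute)
  qed
qed (use z in \<open>auto simp: dist_norm norm_minus_commute\<close>)

text \<open>Jensen's inequality in product form: at the centre the Blaschke denominator is
  \<open>R\<close> to the number of roots, while each \<open>c - \<zeta>\<close> has modulus at most
  \<open>R / 2\<close>, so every root costs a factor 2.\<close>

lemma zero_count_bound:
  assumes hol: "g holomorphic_on UNIV" and "R > 0"
    and f: "\<And>z. f z = (\<Prod>\<zeta>\<leftarrow>zs. z - \<zeta>) * g z"
    and M: "\<And>z. cmod (z - c) \<le> R \<Longrightarrow> cmod (f z) \<le> exp M"
    and one: "cmod (f c) \<ge> 1"
    and zs: "\<And>\<zeta>. \<zeta> \<in> set zs \<Longrightarrow> cmod (\<zeta> - c) \<le> R / 2"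
  shows "real (length zs) * ln 2 \<le> M"
proof -
  have b: "cmod (g c) * R ^ length zs \<le> exp M"
  proof -
    have "cmod (g c * blaschke_den c R zs c) \<le> exp M"
      by (rule blaschke_quotient_bound[OF hol \<open>R > 0\<close> f M]) (use \<open>R > 0\<close> in auto)
    then show ?thesis using \<open>R > 0\<close> by (simp add: blaschke_den_center norm_mult norm_power)
  qed
  have p: "cmod (\<Prod>\<zeta>\<leftarrow>zs. c - \<zeta>) \<le> (R / 2) ^ length zs"
    using zs
  proof (induction zs)
    case (Cons a zs)
    have "cmod (c - a) \<le> R / 2" using Cons(2)[of a] by (simp add: norm_minus_commute)
    moreover have "cmod (\<Prod>\<zeta>\<leftarrow>zs. c - \<zeta>) \<le> (R / 2) ^ length zs" using Cons by simp
    ultimately have "cmod (c - a) * cmod (\<Prod>\<zeta>\<leftarrow>zs. c - \<zeta>) \<le> R / 2 * (R / 2) ^ length zs"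
      using \<open>R > 0\<close> by (intro mult_mono) auto
    then show ?case by (simp only: norm_mult list.map prod_list.Cons length_Cons power_Suc)
  qed auto
  have "1 \<le> cmod (\<Prod>\<zeta>\<leftarrow>zs. c - \<zeta>) * cmod (g c)" using one by (simp add: f norm_mult)
  also have "\<dots> \<le> (R / 2) ^ length zs * cmod (g c)" using p by (intro mult_right_mono) auto
  finally have "2 ^ length zs \<le> cmod (g c) * R ^ length zs"
    by (simp add: power_divide field_simps)
  with b have "2 ^ length zs \<le> exp M" by linarith
  then have "ln (2 ^ length zs) \<le> ln (exp M)" by (subst ln_le_cancel_iff) auto
  then show ?thesis by (simp add: ln_realpow)
qed

lemma divide_out_zero:
  assumes "g holomorphic_on UNIV" "g (a::complex) = 0"
  obtains k where "k holomorphic_on UNIV" "\<And>z. g z = (z - a) * k z"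
proof
  let ?k = "\<lambda>z. if z = a then deriv g a else g z / (z - a)"
  show "?k holomorphic_on UNIV"
    by (rule pole_theorem_open_0[OF assms(1), of a]) (use assms in auto)
  show "g z = (z - a) * ?k z" for z using assms by auto
qed

text \<open>Lists record multiplicity. The counting bound limits the length of any list of zeros
  that can be divided out, so a longest one exists, and its quotient has no zeros left in the half
  disc.\<close>

lemma zero_factorization:
  assumes hol: "f holomorphic_on UNIV" and "R > 0"
    and M: "\<And>z. cmod (z - c) \<le> R \<Longrightarrow> cmod (f z) \<le> exp M"
    and one: "cmod (f c) \<ge> 1"
  obtains zs g where "g holomorphic_on UNIV" "\<And>z. f z = (\<Prod>\<zeta>\<leftarrow>zs. z - \<zeta>) * g z"
    "\<And>z. cmod (z - c) \<le> R / 2 \<Longrightarrow> g z \<noteq> 0" "real (length zs) * ln 2 \<le> M"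
proof -
  define Q where "Q zs \<longleftrightarrow> (\<forall>\<zeta>\<in>set zs. cmod (\<zeta> - c) \<le> R / 2) \<and>
      (\<exists>g. g holomorphic_on UNIV \<and> (\<forall>z. f z = (\<Prod>\<zeta>\<leftarrow>zs. z - \<zeta>) * g z))" for zs
  have bound: "real (length zs) * ln 2 \<le> M" if "Q zs" for zs
  proof -
    have "\<exists>g. g holomorphic_on UNIV \<and> (\<forall>z. f z = (\<Prod>\<zeta>\<leftarrow>zs. z - \<zeta>) * g z)"
      using that unfolding Q_def by (rule conjunct2)
    then obtain g where "g holomorphic_on UNIV \<and> (\<forall>z. f z = (\<Prod>\<zeta>\<leftarrow>zs. z - \<zeta>) * g z)" ..
    then have g: "g holomorphic_on UNIV" "\<And>z. f z = (\<Prod>\<zeta>\<leftarrow>zs. z - \<zeta>) * g z"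
      by blast+
    show ?thesis
      by (rule zero_count_bound[OF g(1) \<open>R > 0\<close> g(2) M one]) (use that in \<open>auto simp: Q_def\<close>)
  qed
  have "Q []" using hol by (auto simp: Q_def)
  moreover have "\<forall>y. Q y \<longrightarrow> length y < nat \<lceil>M / ln 2\<rceil> + 1"
  proof (intro allI impI)
    fix y assume "Q y"
    then have "real (length y) \<le> M / ln 2" using bound[of y] by (simp add: field_simps)
    then show "length y < nat \<lceil>M / ln 2\<rceil> + 1" by linarith
  qed
  ultimately obtain zs where zs: "Q zs" "\<And>y. Q y \<Longrightarrow> length y \<le> length zs"
    using ex_has_greatest_nat[of Q "[]" length] by blast
  have "\<exists>g. g holomorphic_on UNIV \<and> (\<forall>z. f z = (\<Prod>\<zeta>\<leftarrow>zs. z - \<zeta>) * g z)"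
    using zs(1) unfolding Q_def by (rule conjunct2)
  then obtain g where "g holomorphic_on UNIV \<and> (\<forall>z. f z = (\<Prod>\<zeta>\<leftarrow>zs. z - \<zeta>) * g z)" ..
  then have g: "g holomorphic_on UNIV" "\<And>z. f z = (\<Prod>\<zeta>\<leftarrow>zs. z - \<zeta>) * g z"
    by blast+
  show ?thesis
  proof (rule that[OF g])
    show "g z \<noteq> 0" if "cmod (z - c) \<le> R / 2" for z
    proof
      assume "g z = 0"
      then obtain k where k: "k holomorphic_on UNIV" "\<And>w. g w = (w - z) * k w"
        using divide_out_zero[OF g(1)] by blast
      have "f w = (\<Prod>\<zeta>\<leftarrow>z # zs. w - \<zeta>) * k w" for w
        unfolding g(2)[of w] k(2)[of w] by (simp add: mult_ac)
      then have "Q (z # zs)" using zs(1) that k(1) unfolding Q_def by auto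
      then show False using zs(2)[of "z # zs"] by simp
    qed
  qed (use bound[OF zs(1)] in auto)
qed

text \<open>Harnack's inequality for the nonnegative harmonic function
  \<open>A - ln \<bar>H\<bar>\<close>, deduced from the Schwarz lemma. At a quarter of the radius
  the constant is (1 + 1/4) / (1 - 1/4) = 5/3.\<close>

lemma harnack_zero_free:
  assumes hol: "H holomorphic_on ball c R" and "R > 0"
    and nz: "\<And>z. z \<in> ball c R \<Longrightarrow> H z \<noteq> 0"
    and A: "\<And>z. z \<in> ball c R \<Longrightarrow> cmod (H z) \<le> exp A"
    and L: "cmod (H c) \<ge> exp (A - \<Lambda>)"
    and z: "cmod (z - c) \<le> R / 4"
  shows "cmod (H z) \<ge> exp (A - 5/3 * \<Lambda>)"
proof -
  have cin: "c \<in> ball c R" using \<open>R > 0\<close> by simp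
  obtain g where g: "g holomorphic_on ball c R" "\<And>z. z \<in> ball c R \<Longrightarrow> exp (g z) = H z"
    using holomorphic_logarithm_exists[OF convex_ball open_ball hol nz cin] by auto
  have ReA: "Re (g w) \<le> A" if "w \<in> ball c R" for w
    using A[OF that] g(2)[OF that, symmetric] by simp
  have ReL: "Re (g c) \<ge> A - \<Lambda>" using L g(2)[OF cin, symmetric] by simp
  have zin: "z \<in> ball c R" using z \<open>R > 0\<close> by (simp add: dist_norm norm_minus_commute)
  have "A - 5/3 * \<Lambda> - Re (g z) \<le> 0 + e" if "e > 0" for e
  proof -
    \<comment> \<open>\<open>u\<close> maps the unit disc into an open right half-plane, where the
      \<open>e\<close> keeps it off the boundary, and the Cayley transform \<open>p\<close> sends
      that half-plane to the unit disc with \<open>u 0\<close> going to 0.\<close>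
    define u where "u w = of_real (A + e) - g (c + of_real R * w)" for w
    define p where "p w = (u w - u 0) / (u w + cnj (u 0))" for w
    have inb: "c + of_real R * w \<in> ball c R" if "cmod w < 1" for w
      using that \<open>R > 0\<close> by (simp add: dist_norm norm_mult)
    have Reu: "Re (u w) \<ge> e" if "cmod w < 1" for w
      using ReA[OF inb[OF that]] by (simp add: u_def)
    have den: "Re (u w + cnj (u 0)) > 0" if "cmod w < 1" for w
      using Reu[OF that] Reu[of 0] \<open>e > 0\<close> by simp
    have holu: "u holomorphic_on ball 0 1"
      unfolding u_def
      by (intro holomorphic_intros holomorphic_on_compose[OF _ holomorphic_on_subset[OF g(1)], unfolded o_def])
         (use inb in auto)
    have holp: "p holomorphic_on ball 0 1"
      unfolding p_def
      by (intro holomorphic_intros holu) (use den in \<open>force simp: complex_eq_iff\<close>)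
    have p1: "cmod (p w) < 1" if "cmod w < 1" for w
    proof -
      have "(cmod (u w - u 0))\<^sup>2 < (cmod (u w + cnj (u 0)))\<^sup>2"
        using Reu[OF that] Reu[of 0] \<open>e > 0\<close>
        unfolding cmod_power2 by (simp add: power2_eq_square algebra_simps)
      then have "cmod (u w - u 0) < cmod (u w + cnj (u 0))" by (meson norm_ge_zero power_less_imp_less_base)
      then show ?thesis unfolding p_def norm_divide
        by (metis divide_less_eq_1_pos le_less_trans norm_ge_zero)
    qed
    define w where "w = (z - c) / of_real R"
    have w: "cmod w \<le> 1/4" "cmod w < 1" "c + of_real R * w = z"
      using z \<open>R > 0\<close> by (auto simp: w_def norm_divide divide_simps)
    have "cmod (p w) \<le> cmod w"
      by (rule Schwarz_Lemma(1)[OF holp]) (use p1 w in \<open>auto simp: p_def\<close>)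
    then have "cmod (p w) \<le> 1/4" using w by simp
    then have "cmod (u w - u 0) \<le> 1/4 * cmod (u w + cnj (u 0))"
      using den[OF w(2)] unfolding p_def norm_divide
      by (metis divide_le_eq less_irrefl mult.commute norm_eq_zero norm_ge_zero zero_complex.sel(1) order_le_less mult.commute)
    then have "(cmod (u w - u 0))\<^sup>2 \<le> (1/4 * cmod (u w + cnj (u 0)))\<^sup>2"
      by (intro power_mono) auto
    then have "(Re (u w) - Re (u 0))\<^sup>2 + (Im (u w) - Im (u 0))\<^sup>2
        \<le> 1/16 * ((Re (u w) + Re (u 0))\<^sup>2 + (Im (u w) - Im (u 0))\<^sup>2)"
      by (simp add: cmod_power2 power_mult_distrib power_divide)
    moreover have "X + Y \<le> 1/16 * (Z + Y) \<Longrightarrow> 0 \<le> Y \<Longrightarrow> X \<le> 1/16 * Z" for X Y Z :: real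
      by simp
    ultimately have "(Re (u w) - Re (u 0))\<^sup>2 \<le> 1/16 * (Re (u w) + Re (u 0))\<^sup>2"
      using zero_le_power2[of "Im (u w) - Im (u 0)"] by blast
    then have "(Re (u w) - Re (u 0))\<^sup>2 \<le> ((Re (u w) + Re (u 0)) / 4)\<^sup>2"
      by (simp add: power_divide)
    moreover have "0 \<le> (Re (u w) + Re (u 0)) / 4" using Reu[OF w(2)] Reu[of 0] \<open>e > 0\<close> by simp
    ultimately have "Re (u w) - Re (u 0) \<le> (Re (u w) + Re (u 0)) / 4"
      by (rule power2_le_imp_le)
    then have "3 * Re (u w) \<le> 5 * Re (u 0)" by simp
    then have "3 * (A + e - Re (g z)) \<le> 5 * (A + e - Re (g c))"
      by (simp add: u_def w)
    then show ?thesis using ReL \<open>e > 0\<close> by (simp add: algebra_simps)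
  qed
  then have "A - 5/3 * \<Lambda> - Re (g z) \<le> 0" by (rule field_le_epsilon)
  then show ?thesis using g(2)[OF zin, symmetric] by simp
qed

text \<open>Harnack needs a zero-free function, so it is applied to \<open>G\<close> with its
  Blaschke product divided out. This keeps the bound on the disc and does not decrease the value at
  the centre; undoing the division costs \<open>cmod (z - \<zeta>) / (2 * R)\<close> for each
  zero.\<close>

lemma lower_bound_off_zeros:
  assumes hol: "K holomorphic_on UNIV" and "R > 0"
    and G: "\<And>z. G z = (\<Prod>\<zeta>\<leftarrow>ws. z - \<zeta>) * K z"
    and ws: "\<And>\<zeta>. \<zeta> \<in> set ws \<Longrightarrow> cmod (\<zeta> - c) < R"
    and K: "\<And>z. cmod (z - c) < R \<Longrightarrow> K z \<noteq> 0"
    and A: "\<And>z. cmod (z - c) \<le> R \<Longrightarrow> cmod (G z) \<le> exp A"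
    and L: "cmod (G c) \<ge> exp (A - \<Lambda>)"
    and z: "cmod (z - c) \<le> R / 4"
  shows "cmod (G z) \<ge> exp (A - 5/3 * \<Lambda>) * (\<Prod>\<zeta>\<leftarrow>ws. cmod (z - \<zeta>) / (2 * R))"
proof -
  define H where "H z = K z * blaschke_den c R ws z" for z
  have HA: "cmod (H z) \<le> exp A" if "cmod (z - c) \<le> R" for z
    unfolding H_def by (rule blaschke_quotient_bound[OF hol \<open>R > 0\<close> G A that])
  have p: "cmod (\<Prod>\<zeta>\<leftarrow>ws. c - \<zeta>) \<le> R ^ length ws"
    using ws
  proof (induction ws)
    case (Cons a zs)
    have "cmod (c - a) \<le> R" using Cons(2)[of a] by (simp add: norm_minus_commute)
    then show ?case using \<open>R > 0\<close> Cons by (auto simp: norm_mult intro!: mult_mono)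
  qed auto
  have "exp (A - \<Lambda>) \<le> cmod (\<Prod>\<zeta>\<leftarrow>ws. c - \<zeta>) * cmod (K c)" using L by (simp add: G norm_mult)
  also have "\<dots> \<le> R ^ length ws * cmod (K c)" using p by (intro mult_right_mono) auto
  also have "\<dots> = cmod (H c)" using \<open>R > 0\<close> by (simp add: H_def blaschke_den_center norm_mult norm_power)
  finally have HL: "cmod (H c) \<ge> exp (A - \<Lambda>)" .
  have Hz: "cmod (H z) \<ge> exp (A - 5/3 * \<Lambda>)"
  proof (rule harnack_zero_free[where H = H, OF _ \<open>R > 0\<close> _ _ HL z])
    show "H holomorphic_on ball c R" unfolding H_def
      by (intro holomorphic_intros holomorphic_blaschke_den holomorphic_on_subset[OF hol]) auto
    show "H z \<noteq> 0" if "z \<in> ball c R" for z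
      using that K[of z] blaschke_den_nonzero[of z c R ws] ws
      by (auto simp: H_def dist_norm norm_minus_commute)
    show "cmod (H z) \<le> exp A" if "z \<in> ball c R" for z
      using HA[of z] that by (auto simp: dist_norm norm_minus_commute)
  qed
  have bu: "cmod (blaschke_den c R ws z) \<le> (2 * R) ^ length ws"
    by (rule blaschke_den_upper) (use z \<open>R > 0\<close> ws in \<open>auto intro: less_imp_le\<close>)
  have pr: "(\<Prod>\<zeta>\<leftarrow>ws. cmod (z - \<zeta>) / (2 * R)) = cmod (\<Prod>\<zeta>\<leftarrow>ws. z - \<zeta>) / (2 * R) ^ length ws"
    by (induction ws) (auto simp: norm_mult)
  have "exp (A - 5/3 * \<Lambda>) * cmod (\<Prod>\<zeta>\<leftarrow>ws. z - \<zeta>)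
      \<le> cmod (K z) * (2 * R) ^ length ws * cmod (\<Prod>\<zeta>\<leftarrow>ws. z - \<zeta>)"
  proof (rule mult_right_mono)
    have "cmod (H z) \<le> cmod (K z) * (2 * R) ^ length ws"
      unfolding H_def norm_mult using bu by (intro mult_left_mono) auto
    then show "exp (A - 5/3 * \<Lambda>) \<le> cmod (K z) * (2 * R) ^ length ws" using Hz by linarith
  qed auto
  then show ?thesis unfolding pr G norm_mult using \<open>R > 0\<close>
    by (simp add: field_simps)
qed

text \<open>Pigeonhole on logarithms. It turns smallness of the orbit product into proximity to one
  of at most \<open>n\<close> points.\<close>

lemma small_product_imp_small_factor:
  assumes "(\<Prod>\<zeta>\<leftarrow>ws. cmod (z - \<zeta>) / (2 * R)) < exp (- t)" "real (length ws) \<le> n" "n > 0" "t \<ge> 0" "R > 0"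
  shows "\<exists>\<zeta>\<in>set ws. cmod (z - \<zeta>) < 2 * R * exp (- t / n)"
proof (rule ccontr)
  assume "\<not> ?thesis"
  then have "\<And>\<zeta>. \<zeta> \<in> set ws \<Longrightarrow> cmod (z - \<zeta>) / (2 * R) \<ge> exp (- t / n)"
    using \<open>R > 0\<close> by (auto simp: field_simps not_less)
  then have "(\<Prod>\<zeta>\<leftarrow>ws. cmod (z - \<zeta>) / (2 * R)) \<ge> exp (- t / n) ^ length ws"
  proof (induction ws)
    case (Cons a ws)
    then have "exp (- t / n) * exp (- t / n) ^ length ws
        \<le> cmod (z - a) / (2 * R) * (\<Prod>\<zeta>\<leftarrow>ws. cmod (z - \<zeta>) / (2 * R))"
      using \<open>R > 0\<close> by (intro mult_mono) auto
    then show ?case by (simp only: list.map prod_list.Cons length_Cons power_Suc)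
  qed auto
  moreover have "exp (- t / n) ^ length ws = exp (- (t * (real (length ws) / n)))"
    by (simp add: exp_of_nat_mult[symmetric])
  moreover have "t * (real (length ws) / n) \<le> t * 1"
    using assms by (intro mult_left_mono) auto
  ultimately show False using assms(1) by (smt (verit) exp_le_cancel_iff)
qed

section \<open>Large deviations along a rotation\<close>

lemma card_int_near_le:
  fixes a r :: real
  assumes "r \<ge> 0"
  shows "finite {i::int. \<bar>real_of_int i - a\<bar> < r}" "real (card {i::int. \<bar>real_of_int i - a\<bar> < r}) \<le> 2 * r + 1"
proof -
  have sub: "{i::int. \<bar>real_of_int i - a\<bar> < r} \<subseteq> {\<lceil>a - r\<rceil>..\<lfloor>a + r\<rfloor>}"
    by (auto simp: ceiling_le_iff le_floor_iff abs_less_iff)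
  then show "finite {i::int. \<bar>real_of_int i - a\<bar> < r}" by (rule finite_subset) auto
  have "card {i::int. \<bar>real_of_int i - a\<bar> < r} \<le> card {\<lceil>a - r\<rceil>..\<lfloor>a + r\<rfloor>}"
    by (rule card_mono[OF _ sub]) auto
  also have "real \<dots> \<le> 2 * r + 1" using assms by simp linarith
  finally show "real (card {i::int. \<bar>real_of_int i - a\<bar> < r}) \<le> 2 * r + 1" by linarith
qed

locale rational_approx =
  fixes \<alpha> :: real and p :: int and q :: nat
  assumes q_pos: "q > 0" and cop: "coprime p (int q)" and close: "\<bar>\<alpha> - p / q\<bar> \<le> 1 / q\<^sup>2"
begin

text \<open>Over the first \<open>q\<close> steps the orbit stays within \<open>1 / q\<close> of the
  orbit of the rational rotation, whose points are equally spaced.\<close>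

lemma drift: "k < q \<Longrightarrow> \<bar>real k * (\<alpha> - p / q)\<bar> < 1 / q"
proof -
  assume "k < q"
  have "\<bar>real k * (\<alpha> - p / q)\<bar> \<le> real k * (1 / q\<^sup>2)"
    using mult_left_mono[OF close, of "real k"] by (simp add: abs_mult)
  also have "\<dots> < real q * (1 / q\<^sup>2)"
    using \<open>k < q\<close> q_pos by (intro mult_strict_right_mono) auto
  also have "\<dots> = 1 / q" using q_pos by (simp add: power2_eq_square)
  finally show ?thesis .
qed

text \<open>The radius adds \<open>1 / q\<close> for the drift and \<open>1 / (2 * q)\<close> for
  rounding to the nearest multiple of \<open>1 / q\<close>.\<close>

lemma orbit_dense:
  fixes x y :: real
  obtains k l where "k < q" "\<bar>x + real k * \<alpha> + real_of_int l - y\<bar> \<le> 3 / (2 * real q)"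
proof -
  define n where "n = round (real q * (y - x))"
  obtain u v where uv: "u * p + v * int q = 1"
    using bezout_int[of p "int q"] cop by (auto simp: coprime_iff_gcd_eq_1)
  \<comment> \<open>\<open>u\<close> inverts \<open>p\<close> modulo \<open>q\<close>, so
    \<open>k * p\<close> is congruent to \<open>n\<close> and the rational orbit meets the desired
    multiple of \<open>1 / q\<close> at time \<open>k\<close>.\<close>
  define k where "k = nat ((u * n) mod int q)"
  have kq: "k < q" and ik: "int k = (u * n) mod int q"
    using q_pos by (auto simp: k_def nat_less_iff)
  define m where "m = - (v * n) - (u * n) div int q * p"
  have "int k = u * n - int q * ((u * n) div int q)" unfolding ik by (simp add: minus_mult_div_eq_mod)
  then have "int k * p = (u * p) * n - int q * ((u * n) div int q) * p" by algebra
  also have "u * p = 1 - v * int q" using uv by simp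
  finally have "int k * p - n = int q * m" by (simp add: m_def algebra_simps)
  then have km: "real k * p - n = real q * m"
    by (metis of_int_diff of_int_mult of_int_of_nat_eq)
  have "real k * (p / q) - m = n / q" using km q_pos by (simp add: field_simps)
  then have eq: "x + real k * \<alpha> + real_of_int (- m) - y = real k * (\<alpha> - p / q) + (n / q - (y - x))"
    by (simp add: algebra_simps)
  have "\<bar>real_of_int n - real q * (y - x)\<bar> \<le> 1 / 2" unfolding n_def by (rule of_int_round_abs_le)
  then have "\<bar>real_of_int n - real q * (y - x)\<bar> / q \<le> 1 / 2 / q" by (intro divide_right_mono) auto
  moreover have "n / q - (y - x) = (n - real q * (y - x)) / q" using q_pos by (simp add: field_simps)
  ultimately have "\<bar>n / q - (y - x)\<bar> \<le> 1 / (2 * q)" by (simp add: abs_divide)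
  moreover have "\<bar>real k * (\<alpha> - p / q)\<bar> \<le> 1 / q" using drift[OF kq] by simp
  ultimately have "\<bar>x + real k * \<alpha> + real_of_int (- m) - y\<bar> \<le> 1 / q + 1 / (2 * q)"
    unfolding eq by (meson abs_triangle_ineq add_mono order_trans)
  then show ?thesis using that[OF kq, of "- m"] q_pos by (simp add: field_simps)
qed

lemma orbit_overlap:
  fixes c x R :: real
  assumes "R > 0"
  shows "real (card {j. j < q \<and> \<bar>frac (c + real j * \<alpha>) - x\<bar> < R}) \<le> 2 * q * R + 3"
proof -
  let ?J = "{j. j < q \<and> \<bar>frac (c + real j * \<alpha>) - x\<bar> < R}"
  \<comment> \<open>Up to an error below 1, \<open>I j\<close> is \<open>q\<close> times the
    displacement of the orbit point from \<open>c\<close>. Modulo \<open>q\<close> it is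
    \<open>j * p\<close>, which distinguishes all \<open>j < q\<close>.\<close>
  define I where "I j = int j * p - int q * \<lfloor>c + real j * \<alpha>\<rfloor>" for j :: nat
  let ?T = "{i::int. \<bar>real_of_int i - q * (x - c)\<bar> < q * R + 1}"
  have "inj_on I ?J"
  proof (rule inj_onI)
    fix i j assume ij: "i \<in> ?J" "j \<in> ?J" "I i = I j"
    then have "(int i - int j) * p = int q * (\<lfloor>c + real i * \<alpha>\<rfloor> - \<lfloor>c + real j * \<alpha>\<rfloor>)"
      by (simp add: I_def algebra_simps)
    then have "int q dvd (int i - int j) * p" by simp
    then have "int q dvd int i - int j"
      using cop by (simp add: coprime_commute coprime_dvd_mult_left_iff)
    then have "int i mod int q = int j mod int q" by (simp add: mod_eq_dvd_iff)
    then show "i = j" using ij by simp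
  qed
  moreover have "I ` ?J \<subseteq> ?T"
  proof safe
    fix j assume j: "j < q" "\<bar>frac (c + real j * \<alpha>) - x\<bar> < R"
    have e: "I j - q * (x - c) = q * (frac (c + real j * \<alpha>) - x) - q * (real j * (\<alpha> - p / q))"
      using q_pos by (simp add: I_def frac_def algebra_simps)
    have "\<bar>q * (frac (c + real j * \<alpha>) - x)\<bar> < q * R" using j q_pos by (simp add: abs_mult)
    moreover have "\<bar>q * (real j * (\<alpha> - p / q))\<bar> < 1"
      using drift[OF j(1)] q_pos unfolding abs_mult[of "real q"] by (simp add: field_simps)
    ultimately show "\<bar>real_of_int (I j) - q * (x - c)\<bar> < q * R + 1" unfolding e by linarith
  qed
  moreover have "q * R + 1 \<ge> 0" using \<open>R > 0\<close> by (simp add: add_nonneg_nonneg)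
  then have T: "finite ?T" "real (card ?T) \<le> 2 * (q * R + 1) + 1"
    using card_int_near_le[of "q * R + 1" "q * (x - c)"] by auto
  ultimately have "card ?J \<le> card ?T"
    by (meson card_inj_on_le)
  then show ?thesis using T(2) by simp
qed

end

lemma prod_list_filter_split:
  fixes f :: "'a \<Rightarrow> 'b::comm_monoid_mult"
  shows "(\<Prod>x\<leftarrow>xs. f x) = (\<Prod>x\<leftarrow>filter P xs. f x) * (\<Prod>x\<leftarrow>filter (\<lambda>x. \<not> P x) xs. f x)"
  by (induction xs) (auto simp: mult_ac)

text \<open>Double counting: a zero is charged once for each of the discs that contain it.\<close>

lemma sum_length_filter_le:
  fixes q :: nat
  assumes "\<And>x. x \<in> set xs \<Longrightarrow> real (card {j. j < q \<and> P j x}) \<le> B"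
  shows "(\<Sum>j<q. real (length (filter (P j) xs))) \<le> B * real (length xs)"
  using assms
proof (induction xs)
  case (Cons x xs)
  have "(\<Sum>j<q. real (length (filter (P j) (x # xs))))
      = (\<Sum>j<q. (if P j x then 1 else 0) + real (length (filter (P j) xs)))"
    by (intro sum.cong) auto
  also have "\<dots> = real (card {j. j < q \<and> P j x}) + (\<Sum>j<q. real (length (filter (P j) xs)))"
  proof -
    have "{..<q} \<inter> {j. P j x} = {j. j < q \<and> P j x}" by auto
    then have "(\<Sum>j<q. if P j x then 1 else 0) = real (card {j. j < q \<and> P j x})"
      by (simp add: sum.If_cases)
    then show ?thesis by (simp add: sum.distrib)
  qed
  also have "\<dots> \<le> B + B * real (length xs)" using Cons by (intro add_mono) auto
  finally show ?case by (simp add: algebra_simps)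
qed auto

text \<open>\<open>f\<close> is the restriction of \<open>F\<close> to the real line and
  \<open>S\<close> the maximum of \<open>ln f\<close>, while \<open>D\<close> bounds the change of
  \<open>ln f\<close> under one rotation and \<open>M\<close> bounds the logarithm of
  \<open>F\<close> on the strip. The condition \<open>32 \<le> q * h\<close> keeps the working
  radius \<open>8 / q\<close> below \<open>h / 4\<close>.\<close>

locale rotation_analytic = rational_approx +
  fixes F :: "complex \<Rightarrow> complex" and f :: "real \<Rightarrow> real" and h M S D :: real
  assumes hol: "F holomorphic_on UNIV" and per: "\<And>z. F (z + 1) = F z"
    and h: "h > 0" "h \<le> 1" and qh: "32 \<le> real q * h"
    and M: "\<And>z. \<bar>Im z\<bar> \<le> h \<Longrightarrow> cmod (F z) \<le> exp M"
    and f: "\<And>x. F (complex_of_real x) = complex_of_real (f x)" and f1: "\<And>x. f x \<ge> 1"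
    and D: "\<And>x. \<bar>ln (f (x + \<alpha>)) - ln (f x)\<bar> \<le> D"
    and S: "\<And>x. ln (f x) \<le> S" and S_attained: "\<exists>x. ln (f x) = S"
begin

text \<open>
  A period is covered by \<open>4 / h + 1\<close> discs of radius \<open>h\<close>, each with at most \<open>M / ln 2\<close> zeros, and a point lies
  in at most 19 of the discs of radius \<open>8 / q\<close> about the first \<open>q\<close> points of an orbit.
\<close>
definition max_zeros :: real where "max_zeros = 19 * (4 / h + 1) * (M / ln 2)"

lemma D_nonneg: "D \<ge> 0" using D[of 0] by linarith

lemma S_nonneg: "S \<ge> 0" using S[of 0] f1[of 0] by (smt (verit) ln_ge_zero)

lemma M_ge_S: "S \<le> M"
proof -
  obtain x where x: "ln (f x) = S" using S_attained by blast
  have "f x \<le> exp M" using M[of "of_real x"] h f1[of x] by (simp add: f)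
  then have "ln (f x) \<le> M" using f1[of x] by (metis ln_exp ln_le_cancel_iff exp_gt_zero less_le_trans zero_less_one)
  then show ?thesis using x by simp
qed

lemma per_int: "F (z + of_int k) = F z"
  using per by (rule periodic_of_int)

lemma f_per_int: "f (x + of_int k) = f x"
  using per_int[of "of_real x" k] f[of x] f[of "x + of_int k"] by simp

lemma D_iter: "\<bar>ln (f (x + real j * \<alpha>)) - ln (f x)\<bar> \<le> real j * D"
proof (induction j)
  case (Suc j)
  show ?case using Suc D[of "x + real j * \<alpha>"] by (simp add: algebra_simps)
qed auto

text \<open>Counting zeros of the product directly would charge every factor with all the zeros of a
  disc of radius \<open>h\<close>. Instead each factor contributes only its zeros within
  \<open>8 / q\<close> of its orbit point. As the orbit is well spread, a given zero is near only
  boundedly many of the orbit points, and the total does not grow with the number of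
  factors.\<close>

lemma orbit_product_factorization:
  fixes c :: real
  defines "R \<equiv> 8 / real q"
  obtains ws K where "K holomorphic_on UNIV"
    "\<And>z. (\<Prod>j<q. F (z + of_real (real j * \<alpha>))) = (\<Prod>\<zeta>\<leftarrow>ws. z - \<zeta>) * K z"
    "\<And>\<zeta>. \<zeta> \<in> set ws \<Longrightarrow> cmod (\<zeta> - of_real c) < R"
    "\<And>z. cmod (z - of_real c) < R \<Longrightarrow> K z \<noteq> 0"
    "real (length ws) \<le> max_zeros"
proof -
  have R: "R > 0" "4 * R \<le> h" using q_pos qh h by (auto simp: R_def field_simps)
  define y where "y m = complex_of_real (real m * h / 4)" for m :: nat
  have "\<exists>Z g. g holomorphic_on UNIV \<and> (\<forall>z. F z = (\<Prod>\<zeta>\<leftarrow>Z. z - \<zeta>) * g z) \<and>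
      (\<forall>z. cmod (z - y m) \<le> h / 2 \<longrightarrow> g z \<noteq> 0) \<and> real (length Z) * ln 2 \<le> M" for m
  proof -
    have b: "cmod (F z) \<le> exp M" if "cmod (z - y m) \<le> h" for z
      using abs_Im_le_cmod[of "z - y m"] that by (intro M) (simp add: y_def)
    have o: "1 \<le> cmod (F (y m))" using f1[of "real m * h / 4"] by (simp only: y_def f norm_of_real)
    from zero_factorization[OF hol h(1) b o] show ?thesis by metis
  qed
  then obtain Z g where Zg: "\<And>m. g m holomorphic_on UNIV"
      "\<And>m z. F z = (\<Prod>\<zeta>\<leftarrow>Z m. z - \<zeta>) * g m z"
      "\<And>m z. cmod (z - y m) \<le> h / 2 \<Longrightarrow> g m z \<noteq> 0" "\<And>m. real (length (Z m)) * ln 2 \<le> M"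
    by metis
  \<comment> \<open>These shifts differ from \<open>j * \<alpha>\<close> by integers and bring the
    orbit point into the unit interval, where \<open>m j\<close> selects a disc centre at distance
    at most \<open>h / 4\<close>.\<close>
  define s where "s j = real j * \<alpha> - of_int \<lfloor>c + real j * \<alpha>\<rfloor>" for j :: nat
  have cs: "c + s j = frac (c + real j * \<alpha>)" for j by (simp add: s_def frac_def)
  define m where "m j = nat \<lfloor>(c + s j) * 4 / h\<rfloor>" for j
  have m1: "\<bar>(c + s j) - real (m j) * h / 4\<bar> \<le> h / 4" for j
  proof -
    have "0 \<le> (c + s j) * 4 / h" using h by (simp add: cs)
    then have "real (m j) \<le> (c + s j) * 4 / h" "(c + s j) * 4 / h \<le> real (m j) + 1"
      unfolding m_def by linarith+
    then show ?thesis using h by (simp add: field_simps abs_le_iff)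
  qed
  have m2: "m j \<le> nat \<lfloor>4 / h\<rfloor>" for j
    unfolding m_def using h frac_lt_1[of "c + real j * \<alpha>"]
    by (intro nat_mono floor_mono divide_right_mono) (auto simp: cs)
  define near where "near j \<zeta> \<longleftrightarrow> cmod (\<zeta> - of_real (c + s j)) < R" for j \<zeta>
  define W where "W j = map (\<lambda>\<zeta>. \<zeta> - of_real (s j)) (filter (near j) (Z (m j)))" for j
  \<comment> \<open>Zeros far from the orbit point stay in \<open>K\<close>, where they cannot
    produce zeros on the small disc about \<open>c\<close>.\<close>
  define K where "K j z = (\<Prod>\<zeta>\<leftarrow>filter (\<lambda>\<zeta>. \<not> near j \<zeta>) (Z (m j)). z + of_real (s j) - \<zeta>)
      * g (m j) (z + of_real (s j))" for j z
  have Fj: "F (z + of_real (real j * \<alpha>)) = (\<Prod>\<zeta>\<leftarrow>W j. z - \<zeta>) * K j z" for j z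
  proof -
    have "F (z + of_real (real j * \<alpha>)) = F (z + of_real (s j))"
      using per_int[of "z + of_real (s j)" "\<lfloor>c + real j * \<alpha>\<rfloor>"] by (simp add: s_def)
    also have "\<dots> = (\<Prod>\<zeta>\<leftarrow>Z (m j). z + of_real (s j) - \<zeta>) * g (m j) (z + of_real (s j))"
      by (rule Zg)
    also have "(\<Prod>\<zeta>\<leftarrow>Z (m j). z + of_real (s j) - \<zeta>) = (\<Prod>\<zeta>\<leftarrow>W j. z - \<zeta>)
        * (\<Prod>\<zeta>\<leftarrow>filter (\<lambda>\<zeta>. \<not> near j \<zeta>) (Z (m j)). z + of_real (s j) - \<zeta>)"
      unfolding prod_list_filter_split[of _ "Z (m j)" "near j"] W_def
      by (simp add: o_def algebra_simps)
    finally show ?thesis by (simp add: K_def mult.assoc)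
  qed
  define ws where "ws = concat (map W [0..<q])"
  have prod: "(\<Prod>j<n. F (z + of_real (real j * \<alpha>))) = (\<Prod>\<zeta>\<leftarrow>concat (map W [0..<n]). z - \<zeta>) * (\<Prod>j<n. K j z)"
    for n z
  proof (induction n)
    case (Suc n)
    have "concat (map W [0..<Suc n]) = concat (map W [0..<n]) @ W n" by simp
    then show ?case unfolding prod.lessThan_Suc Suc.IH unfolding Fj
      by (simp only: map_append prod_list.append mult_ac)
  qed auto
  have holl: "(\<lambda>z. \<Prod>\<zeta>\<leftarrow>xs. z + a - \<zeta>) holomorphic_on UNIV" for xs :: "complex list" and a
  proof (induction xs)
    case (Cons b xs)
    have "(\<lambda>z. (z + a - b) * (\<Prod>\<zeta>\<leftarrow>xs. z + a - \<zeta>)) holomorphic_on UNIV"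
      by (intro holomorphic_on_mult Cons holomorphic_intros)
    then show ?case by simp
  qed auto
  have holg: "(\<lambda>z. g i (z + a)) holomorphic_on UNIV" for i a
    by (rule holomorphic_shift[OF Zg(1)])
  have holK: "(\<lambda>z. \<Prod>j<q. K j z) holomorphic_on UNIV"
    unfolding K_def by (rule holomorphic_on_prod) (rule holomorphic_on_mult[OF holl holg])
  have nz: "K j z \<noteq> 0" if "cmod (z - of_real c) < R" for j z
  proof -
    have e: "z + of_real (s j) - y (m j) = (z - of_real c) + (of_real (c + s j) - y (m j))" by simp
    have "cmod (z + of_real (s j) - y (m j)) \<le> cmod (z - of_real c) + cmod (of_real (c + s j) - y (m j))"
      unfolding e by (rule norm_triangle_ineq)
    also have "cmod (of_real (c + s j) - y (m j)) \<le> h / 4"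
      using m1[of j] by (simp only: y_def of_real_diff[symmetric] norm_of_real)
    finally have "cmod (z + of_real (s j) - y (m j)) \<le> h / 2" using that R by linarith
    then have "g (m j) (z + of_real (s j)) \<noteq> 0" by (rule Zg)
    moreover have "z + of_real (s j) - \<zeta> \<noteq> 0" if "\<not> near j \<zeta>" for \<zeta>
    proof
      assume "z + of_real (s j) - \<zeta> = 0"
      then have "\<zeta> = z + of_real (s j)" by simp
      then show False using that \<open>cmod (z - of_real c) < R\<close> by (simp add: near_def)
    qed
    then have "(\<Prod>\<zeta>\<leftarrow>filter (\<lambda>\<zeta>. \<not> near j \<zeta>) (Z (m j)). z + of_real (s j) - \<zeta>) \<noteq> 0"
      by (auto simp: prod_list_zero_iff)
    ultimately show ?thesis by (simp add: K_def)
  qed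
  have "length ws = (\<Sum>j<q. length (W j))"
    by (simp add: ws_def length_concat o_def interv_sum_list_conv_sum_set_nat atLeast0LessThan)
  then have "real (length ws) = (\<Sum>j<q. real (length (filter (near j) (Z (m j)))))"
    by (simp add: W_def)
  \<comment> \<open>Summing over all discs instead of the selected one separates the zero lists from
    \<open>j\<close>, so the sums can be exchanged. For radius \<open>8 / q\<close>,
    \<open>orbit_overlap\<close> then gives 2 * 8 + 3 = 19 indices per zero.\<close>
  also have "\<dots> \<le> (\<Sum>j<q. \<Sum>i\<le>nat \<lfloor>4 / h\<rfloor>. real (length (filter (near j) (Z i))))"
    using m2 by (intro sum_mono member_le_sum) auto
  also have "\<dots> = (\<Sum>i\<le>nat \<lfloor>4 / h\<rfloor>. \<Sum>j<q. real (length (filter (near j) (Z i))))"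
    by (rule sum.swap)
  also have "\<dots> \<le> (\<Sum>i\<le>nat \<lfloor>4 / h\<rfloor>. 19 * (M / ln 2))"
  proof (rule sum_mono)
    fix i
    have "(\<Sum>j<q. real (length (filter (near j) (Z i)))) \<le> 19 * real (length (Z i))"
    proof (rule sum_length_filter_le)
      fix \<zeta> :: complex
      have "card {j. j < q \<and> near j \<zeta>} \<le> card {j. j < q \<and> \<bar>frac (c + real j * \<alpha>) - Re \<zeta>\<bar> < R}"
      proof (rule card_mono)
        show "{j. j < q \<and> near j \<zeta>} \<subseteq> {j. j < q \<and> \<bar>frac (c + real j * \<alpha>) - Re \<zeta>\<bar> < R}"
        proof safe
          fix j assume "near j \<zeta>"
          then have "\<bar>Re \<zeta> - frac (c + real j * \<alpha>)\<bar> < R"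
            using abs_Re_le_cmod[of "\<zeta> - of_real (frac (c + real j * \<alpha>))"] unfolding near_def cs by simp
          then show "\<bar>frac (c + real j * \<alpha>) - Re \<zeta>\<bar> < R" by (simp add: abs_minus_commute)
        qed
      qed auto
      then show "real (card {j. j < q \<and> near j \<zeta>}) \<le> 19"
        using orbit_overlap[OF R(1), of c "Re \<zeta>"] q_pos by (simp add: R_def)
    qed
    also have "real (length (Z i)) \<le> M / ln 2" using Zg(4)[of i] by (simp add: field_simps)
    finally show "(\<Sum>j<q. real (length (filter (near j) (Z i)))) \<le> 19 * (M / ln 2)" by simp
  qed
  also have "\<dots> = (real (nat \<lfloor>4 / h\<rfloor>) + 1) * (19 * (M / ln 2))" by simp
  also have "\<dots> \<le> (4 / h + 1) * (19 * (M / ln 2))"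
  proof (intro mult_right_mono)
    show "0 \<le> 19 * (M / ln 2)" using M_ge_S S_nonneg by simp
    have "0 \<le> 4 / h" using h by simp
    then show "real (nat \<lfloor>4 / h\<rfloor>) + 1 \<le> 4 / h + 1" by linarith
  qed
  finally have len: "real (length ws) \<le> max_zeros" by (simp add: max_zeros_def mult_ac)
  show ?thesis
  proof (rule that[OF holK _ _ _ len])
    show "(\<Prod>j<q. F (z + of_real (real j * \<alpha>))) = (\<Prod>\<zeta>\<leftarrow>ws. z - \<zeta>) * (\<Prod>j<q. K j z)" for z
      unfolding ws_def by (rule prod)
    show "cmod (\<zeta> - of_real c) < R" if "\<zeta> \<in> set ws" for \<zeta>
      using that by (auto simp: ws_def W_def near_def algebra_simps)
    show "(\<Prod>j<q. K j z) \<noteq> 0" if "cmod (z - of_real c) < R" for z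
      using nz[OF that] by simp
  qed
qed

end

section \<open>Measure of the set where a single factor is small\<close>

context rotation_analytic begin

text \<open>All losses divided by \<open>q\<close>. Harnack costs 5/3 of
  \<open>8 * M / h + 2 * q\<^sup>2 * D\<close>, which is at most
  \<open>14 * M / h + 4 * q\<^sup>2 * D\<close>; comparing the orbit sum with
  \<open>q * ln (f x)\<close> costs another \<open>q\<^sup>2 * D\<close>; and \<open>t\<close> is
  the allowance for proximity to zeros.\<close>

definition defect :: "real \<Rightarrow> real" where
  "defect t = 14 * M / (real q * h) + 5 * real q * D + t / real q"

text \<open>The centre of the disc is taken on the orbit of a maximum point of \<open>f\<close>.
  There all \<open>q\<close> factors lie within \<open>2 * q * D\<close> of their maximal logarithm,
  because at most \<open>2 * q\<close> rotations separate them from that point, so the orbit product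
  is almost maximal at the centre.\<close>

lemma exceptional_set_local:
  assumes t: "t \<ge> 0" and n: "n > 0" "max_zeros \<le> n"
  obtains ws :: "complex list" where "real (length ws) \<le> n"
    "\<And>x. \<bar>x - y\<bar> \<le> 1 / (2 * real q) \<Longrightarrow> ln (f x) < S - defect t \<Longrightarrow>
        \<exists>\<zeta>\<in>set ws. \<bar>x - Re \<zeta>\<bar> < 16 / real q * exp (- t / n)"
proof -
  define R where "R = 8 / real q"
  have R: "R > 0" "4 * R \<le> h" using q_pos qh h by (auto simp: R_def field_simps)
  obtain x0 where x0: "ln (f x0) = S" using S_attained by blast
  obtain k l where kl: "k < q" "\<bar>x0 + real k * \<alpha> + real_of_int l - y\<bar> \<le> 3 / (2 * real q)"
    using orbit_dense[of x0 y] by blast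
  define c where "c = x0 + real k * \<alpha> + real_of_int l"
  obtain ws K where K: "K holomorphic_on UNIV"
    "\<And>z. (\<Prod>j<q. F (z + of_real (real j * \<alpha>))) = (\<Prod>\<zeta>\<leftarrow>ws. z - \<zeta>) * K z"
    "\<And>\<zeta>. \<zeta> \<in> set ws \<Longrightarrow> cmod (\<zeta> - of_real c) < R"
    "\<And>z. cmod (z - of_real c) < R \<Longrightarrow> K z \<noteq> 0"
    and len: "real (length ws) \<le> max_zeros"
    using orbit_product_factorization[of c] unfolding R_def by metis
  define G where "G z = (\<Prod>j<q. F (z + of_real (real j * \<alpha>)))" for z
  have G: "G z = (\<Prod>\<zeta>\<leftarrow>ws. z - \<zeta>) * K z" for z unfolding G_def by (rule K)
  define A where "A = real q * S + 8 * M / h"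
  define L where "L = 8 * M / h + 2 * real q ^ 2 * D"
  have cF: "cmod (F (complex_of_real x)) \<le> exp S" for x
    using S[of x] f1[of x] unfolding f norm_of_real
    by (metis abs_of_pos exp_le_cancel_iff exp_ln less_le_trans zero_less_one)
  have A: "cmod (G z) \<le> exp A" if z: "cmod (z - of_real c) \<le> R" for z
  proof -
    have Im: "\<bar>Im z\<bar> \<le> R" using abs_Im_le_cmod[of "z - of_real c"] z by simp
    have "cmod (F (z + of_real (real j * \<alpha>))) \<le> exp (S + R / h * M)" for j
    proof -
      have "cmod (F (z + of_real (real j * \<alpha>))) \<le> exp (S + \<bar>Im (z + of_real (real j * \<alpha>))\<bar> / h * (M - S))"
        by (rule periodic_three_lines[OF hol per h(1) M cF]) (use Im R in auto)
      also have "\<bar>Im (z + of_real (real j * \<alpha>))\<bar> / h * (M - S) \<le> R / h * M"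
        using Im h M_ge_S S_nonneg R by (intro mult_mono divide_right_mono) auto
      finally show ?thesis by simp
    qed
    then have "(\<Prod>j<q. cmod (F (z + of_real (real j * \<alpha>)))) \<le> (\<Prod>j<q. exp (S + R / h * M))"
      by (intro prod_mono) auto
    then have "cmod (G z) \<le> exp (S + R / h * M) ^ q"
      by (simp only: G_def prod_norm prod_constant card_lessThan)
    also have "\<dots> = exp A"
      using q_pos h by (simp add: exp_of_nat_mult[symmetric] A_def R_def field_simps)
    finally show ?thesis .
  qed
  have Gx: "cmod (G (of_real x)) = exp (\<Sum>j<q. ln (f (x + real j * \<alpha>)))" for x
  proof -
    have "G (of_real x) = of_real (\<Prod>j<q. f (x + real j * \<alpha>))"
      unfolding G_def of_real_add[symmetric] f by simp
    moreover have "(\<Prod>j<q. f (x + real j * \<alpha>)) = exp (\<Sum>j<q. ln (f (x + real j * \<alpha>)))"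
      unfolding exp_sum[OF finite_lessThan] using f1 by (intro prod.cong) (auto simp: less_le_trans[OF zero_less_one])
    ultimately show ?thesis by simp
  qed
  have L: "cmod (G (of_real c)) \<ge> exp (A - L)"
  proof -
    have "S - 2 * real q * D \<le> ln (f (c + real j * \<alpha>))" if "j < q" for j
    proof -
      have "f (c + real j * \<alpha>) = f (x0 + real (k + j) * \<alpha>)"
        using f_per_int[of "x0 + real (k + j) * \<alpha>" l] by (simp add: c_def algebra_simps)
      moreover have "real (k + j) * D \<le> 2 * real q * D"
        using kl that D_nonneg by (intro mult_right_mono) auto
      moreover have "ln (f x0) - r \<le> ln (f (x0 + real (k + j) * \<alpha>))" if "real (k + j) * D \<le> r" for r
        using D_iter[of x0 "k + j"] that unfolding abs_le_iff by simp
      ultimately show ?thesis using x0 by metis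
    qed
    then have "(\<Sum>j<q. S - 2 * real q * D) \<le> (\<Sum>j<q. ln (f (c + real j * \<alpha>)))"
      by (intro sum_mono) auto
    then show ?thesis unfolding Gx exp_le_cancel_iff A_def L_def
      by (simp add: power2_eq_square algebra_simps)
  qed
  show ?thesis
  proof (rule that)
    show "real (length ws) \<le> n" using len n by linarith
    fix x assume x: "\<bar>x - y\<bar> \<le> 1 / (2 * real q)" "ln (f x) < S - defect t"
    \<comment> \<open>This fixes the radius: half a cell plus the distance to the orbit point is
      \<open>2 / q\<close>, and the lower bound reaches a quarter of the radius.\<close>
    have "\<bar>x - c\<bar> \<le> 1 / (2 * real q) + 3 / (2 * real q)" using x(1) kl(2) unfolding c_def by linarith
    also have "\<dots> = R / 4" by (simp add: R_def field_simps)
    finally have xc: "cmod (of_real x - of_real c) \<le> R / 4"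
      by (metis norm_of_real of_real_diff)
    have low: "cmod (G (of_real x)) \<ge> exp (A - 5/3 * L) * (\<Prod>\<zeta>\<leftarrow>ws. cmod (of_real x - \<zeta>) / (2 * R))"
      by (rule lower_bound_off_zeros[OF K(1) R(1) G K(3) K(4) A L xc])
    have "(\<Sum>j<q. ln (f (x + real j * \<alpha>))) \<le> (\<Sum>j<q. ln (f x) + real q * D)"
    proof (rule sum_mono)
      fix j assume "j \<in> {..<q}"
      then have "real j * D \<le> real q * D" using D_nonneg by (intro mult_right_mono) auto
      then show "ln (f (x + real j * \<alpha>)) \<le> ln (f x) + real q * D" using D_iter[of x j] by linarith
    qed
    also have "\<dots> = real q * ln (f x) + real q ^ 2 * D" by (simp add: power2_eq_square algebra_simps)
    also have "\<dots> < real q * (S - defect t) + real q ^ 2 * D"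
      using x(2) q_pos by simp
    also have "real q * (S - defect t) = real q * S - 14 * M / h - 5 * real q ^ 2 * D - t"
      using q_pos h by (simp add: defect_def field_simps power2_eq_square)
    also have "real q * S - 14 * M / h - 5 * real q ^ 2 * D - t + real q ^ 2 * D \<le> A - 5/3 * L - t"
    proof -
      define u v where "u = M / h" and "v = real q ^ 2 * D"
      have uv: "u \<ge> 0" "v \<ge> 0" using M_ge_S S_nonneg h D_nonneg by (auto simp: u_def v_def)
      have e: "14 * M / h = 14 * u" "8 * M / h = 8 * u" "5 * real q ^ 2 * D = 5 * v" "2 * real q ^ 2 * D = 2 * v"
        by (auto simp: u_def v_def)
      show ?thesis unfolding A_def L_def v_def[symmetric] e using uv by (simp add: field_simps)
    qed
    finally have up: "cmod (G (of_real x)) < exp (A - 5/3 * L) * exp (- t)"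
      unfolding Gx by (simp add: exp_add[symmetric])
    then have "(\<Prod>\<zeta>\<leftarrow>ws. cmod (of_real x - \<zeta>) / (2 * R)) < exp (- t)"
      using le_less_trans[OF low up] by simp
    then obtain \<zeta> where \<zeta>: "\<zeta> \<in> set ws" "cmod (of_real x - \<zeta>) < 2 * R * exp (- t / n)"
      using small_product_imp_small_factor[of "of_real x" R ws t n] len n t R by auto
    then show "\<exists>\<zeta>\<in>set ws. \<bar>x - Re \<zeta>\<bar> < 16 / real q * exp (- t / n)"
      using abs_Re_le_cmod[of "of_real x - \<zeta>"] by (intro bexI[of _ \<zeta>]) (auto simp: R_def)
  qed
qed

lemma f_continuous: "continuous_on UNIV f"
proof -
  have "continuous_on UNIV (\<lambda>x. Re (F (complex_of_real x)))"
    by (intro continuous_intros continuous_on_compose2[OF holomorphic_on_imp_continuous_on[OF hol]]) auto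
  then show ?thesis by (simp add: f)
qed

text \<open>Each of the \<open>q\<close> cells of length \<open>1 / q\<close> contributes at most
  \<open>n\<close> intervals of length \<open>32 / q * exp (- t / n)\<close>, so the number of cells
  cancels.\<close>

lemma exceptional_set_measure:
  assumes t: "t \<ge> 0" and n: "n > 0" "max_zeros \<le> n"
  shows "measure lborel {x\<in>{0..1}. ln (f x) < S - defect t} \<le> 32 * n * exp (- t / n)"
proof -
  define r where "r = 16 / real q * exp (- t / n)"
  have r: "r > 0" using q_pos by (simp add: r_def)
  have "\<exists>ws::complex list. real (length ws) \<le> n \<and> (\<forall>x. \<bar>x - (real i + 1/2) / q\<bar> \<le> 1 / (2 * real q) \<longrightarrow>
      ln (f x) < S - defect t \<longrightarrow> (\<exists>\<zeta>\<in>set ws. \<bar>x - Re \<zeta>\<bar> < r))" for i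
    using exceptional_set_local[OF assms, of "(real i + 1/2) / q"] unfolding r_def by metis
  then obtain ws :: "nat \<Rightarrow> complex list" where ws: "\<And>i. real (length (ws i)) \<le> n"
     "\<And>i x. \<bar>x - (real i + 1/2) / q\<bar> \<le> 1 / (2 * real q) \<Longrightarrow>
      ln (f x) < S - defect t \<Longrightarrow> (\<exists>\<zeta>\<in>set (ws i). \<bar>x - Re \<zeta>\<bar> < r)"
    by metis
  define P where "P = (SIGMA i:{..<q}. set (ws i))"
  have finP: "finite P" by (auto simp: P_def)
  have cardP: "real (card P) \<le> real q * n"
  proof -
    have "real (card P) = (\<Sum>i<q. real (card (set (ws i))))" by (simp add: P_def card_SigmaI)
    also have "\<dots> \<le> (\<Sum>i<q. n)"
    proof (rule sum_mono)
      fix i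
      show "real (card (set (ws i))) \<le> n" using ws(1)[of i] card_length[of "ws i"] by linarith
    qed
    finally show ?thesis by simp
  qed
  let ?U = "\<Union>x\<in>P. {Re (snd x) - r..Re (snd x) + r}"
  \<comment> \<open>The point 1 would get the cell index \<open>q\<close>, outside the range, and is
    added separately as a null set.\<close>
  have sub: "{x\<in>{0..1}. ln (f x) < S - defect t} \<subseteq> ?U \<union> {1}"
  proof
    fix x assume x: "x \<in> {x\<in>{0..1}. ln (f x) < S - defect t}"
    show "x \<in> ?U \<union> {1}"
    proof (cases "x = 1")
      case False
      define i where "i = nat \<lfloor>x * q\<rfloor>"
      have x01: "0 \<le> x" "x < 1" using x False by auto
      then have xq: "0 \<le> x * q" "x * q < q" using q_pos by auto
      have i: "real i \<le> x * q" "x * q \<le> real i + 1" unfolding i_def using xq by linarith+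
      then have iq: "i < q" using xq by linarith
      have "\<bar>x * q - (real i + 1/2)\<bar> \<le> 1/2" using i unfolding abs_le_iff by linarith
      then have "\<bar>x * q - (real i + 1/2)\<bar> / q \<le> 1/2 / q" by (intro divide_right_mono) auto
      moreover have "x - (real i + 1/2) / q = (x * q - (real i + 1/2)) / q" using q_pos by (simp add: field_simps)
      ultimately have "\<bar>x - (real i + 1/2) / q\<bar> \<le> 1 / (2 * real q)" by (simp add: abs_divide)
      from ws(2)[OF this] x obtain \<zeta> where "\<zeta> \<in> set (ws i)" "\<bar>x - Re \<zeta>\<bar> < r" by auto
      then have "x \<in> ?U" using iq by (intro UN_I[of "(i, \<zeta>)"]) (auto simp: P_def abs_less_iff)
      then show ?thesis by blast
    qed auto
  qed
  have meas: "?U \<union> {1} \<in> fmeasurable lborel"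
    using finP by (intro fmeasurable.Un fmeasurable.finite_UN) (auto intro: fmeasurable_compact)
  have "measure lborel {x\<in>{0..1}. ln (f x) < S - defect t} \<le> measure lborel (?U \<union> {1})"
  proof (rule measure_mono_fmeasurable[OF sub _ meas])
    have "f \<in> borel_measurable borel" using f_continuous by (simp add: borel_measurable_continuous_onI)
    then show "{x\<in>{0..1}. ln (f x) < S - defect t} \<in> sets lborel" by measurable
  qed
  also have "\<dots> \<le> measure lborel ?U + measure lborel {1::real}"
    using finP by (intro measure_Un_le) auto
  also have "\<dots> = measure lborel ?U" by simp
  also have "\<dots> \<le> (\<Sum>x\<in>P. measure lborel {Re (snd x) - r..Re (snd x) + r})"
    using finP by (intro measure_UNION_le) auto
  also have "\<dots> = real (card P) * (2 * r)" using r by simp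
  also have "\<dots> \<le> real q * n * (2 * r)" using cardP r by (intro mult_right_mono) auto
  also have "\<dots> = 32 * n * exp (- t / n)" using q_pos by (simp add: r_def)
  finally show ?thesis .
qed

end

section \<open>Convergents\<close>

text \<open>Only the denominator is recorded; the numerator matters solely for the combinatorics of
  the orbit.\<close>

definition admissible :: "real \<Rightarrow> nat \<Rightarrow> bool" where
  "admissible \<alpha> q \<longleftrightarrow> (\<exists>p. rational_approx \<alpha> p q)"

context
  fixes \<alpha> :: real
  assumes irr: "\<alpha> \<notin> \<rat>"
begin

lemma cf_complete_quotient_irrational: "cf_complete_quotient \<alpha> n \<notin> \<rat>"
proof (induction n)
  case (Suc n)
  have "cf_complete_quotient \<alpha> n = of_int \<lfloor>cf_complete_quotient \<alpha> n\<rfloor> + 1 / cf_complete_quotient \<alpha> (Suc n)"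
    by (simp add: frac_def)
  then show ?case using Suc by (metis Rats_1 Rats_add Rats_divide Rats_of_int)
qed (use irr in auto)

lemma cf_quotient_step:
  "cf_complete_quotient \<alpha> n = of_int (cf_quotient \<alpha> n) + 1 / cf_complete_quotient \<alpha> (Suc n)"
  by (simp add: frac_def cf_quotient_def)

lemma cf_complete_quotient_gt_1: "cf_complete_quotient \<alpha> (Suc n) > 1"
proof -
  have "frac (cf_complete_quotient \<alpha> n) \<noteq> 0"
    using cf_complete_quotient_irrational[of n] by (metis frac_eq_0_iff Ints_subset_Rats subsetD)
  then have "frac (cf_complete_quotient \<alpha> n) > 0" using frac_ge_0[of "cf_complete_quotient \<alpha> n"] by linarith
  then show ?thesis using frac_lt_1[of "cf_complete_quotient \<alpha> n"] by simp
qed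

lemma cf_quotient_ge_1: "cf_quotient \<alpha> (Suc n) \<ge> 1"
  unfolding cf_quotient_def using cf_complete_quotient_gt_1[of n] by linarith

lemma cf_den_pos_mono: "cf_den \<alpha> n \<ge> 1 \<and> cf_den \<alpha> (Suc n) \<ge> cf_den \<alpha> n"
proof (induction n)
  case 0
  show ?case using cf_quotient_ge_1[of 0] by simp
next
  case (Suc n)
  have "1 * cf_den \<alpha> (Suc n) \<le> cf_quotient \<alpha> (Suc (Suc n)) * cf_den \<alpha> (Suc n)"
    using cf_quotient_ge_1[of "Suc n"] Suc by (intro mult_right_mono) auto
  then show ?case using Suc unfolding cf_den.simps by linarith
qed

lemma cf_den_growth: "cf_den \<alpha> (Suc n) \<ge> int n"
proof (induction n)
  case 0
  show ?case using cf_den_pos_mono[of "Suc 0"] by simp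
next
  case (Suc n)
  have "1 * cf_den \<alpha> (Suc n) \<le> cf_quotient \<alpha> (Suc (Suc n)) * cf_den \<alpha> (Suc n)"
    using cf_quotient_ge_1[of "Suc n"] cf_den_pos_mono[of "Suc n"] by (intro mult_right_mono) auto
  then show ?case using Suc cf_den_pos_mono[of n] unfolding cf_den.simps by linarith
qed

lemma cf_det: "cf_num \<alpha> (Suc n) * cf_den \<alpha> n - cf_num \<alpha> n * cf_den \<alpha> (Suc n) = (- 1) ^ n"
  by (induction n) (simp_all add: algebra_simps)

text \<open>\<open>\<alpha>\<close> is the image of a complete quotient under the Moebius map built
  from two consecutive convergents. Each step substitutes \<open>x = b + 1 / y\<close> and clears
  the denominator \<open>y\<close>.\<close>

lemma cf_expansion:
  "\<alpha> * (cf_complete_quotient \<alpha> (Suc (Suc n)) * cf_den \<alpha> (Suc n) + cf_den \<alpha> n)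
    = cf_complete_quotient \<alpha> (Suc (Suc n)) * cf_num \<alpha> (Suc n) + cf_num \<alpha> n"
proof (induction n)
  case 0
  define x y a b where "x = cf_complete_quotient \<alpha> 1" and "y = cf_complete_quotient \<alpha> (Suc 1)"
    and "a = real_of_int (cf_quotient \<alpha> 0)" and "b = real_of_int (cf_quotient \<alpha> 1)"
  have "y > 1" using cf_complete_quotient_gt_1[of 1] by (simp add: y_def)
  have "x > 1" using cf_complete_quotient_gt_1[of 0] by (simp add: x_def)
  have e1: "x = b + 1 / y" using cf_quotient_step[of 1] by (simp add: x_def y_def b_def del: cf_complete_quotient.simps)
  have e0: "\<alpha> = a + 1 / x" using cf_quotient_step[of 0] by (simp add: x_def a_def)
  have xy: "x * y = b * y + 1" using e1 \<open>y > 1\<close> by (simp add: field_simps)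
  have "\<alpha> * x = a * x + 1" using e0 \<open>x > 1\<close> by (simp add: field_simps)
  then have "\<alpha> * (x * y) = a * (x * y) + y" by algebra
  then have "\<alpha> * (b * y + 1) = a * (b * y + 1) + y" unfolding xy .
  then show ?case by (simp add: y_def a_def b_def algebra_simps del: cf_complete_quotient.simps)
next
  case (Suc n)
  define x y where "x = cf_complete_quotient \<alpha> (Suc (Suc n))" and "y = cf_complete_quotient \<alpha> (Suc (Suc (Suc n)))"
  define b where "b = real_of_int (cf_quotient \<alpha> (Suc (Suc n)))"
  have "y > 1" using cf_complete_quotient_gt_1[of "Suc (Suc n)"] by (simp add: y_def)
  have "x = b + 1 / y" using cf_quotient_step[of "Suc (Suc n)"] by (simp add: x_def y_def b_def del: cf_complete_quotient.simps)
  then have xy: "x * y = b * y + 1" using \<open>y > 1\<close> by (simp add: field_simps)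
  have "\<alpha> * (x * cf_den \<alpha> (Suc n) + cf_den \<alpha> n) = x * cf_num \<alpha> (Suc n) + cf_num \<alpha> n"
    using Suc by (simp add: x_def)
  then have "\<alpha> * ((x * y) * cf_den \<alpha> (Suc n) + y * cf_den \<alpha> n) = (x * y) * cf_num \<alpha> (Suc n) + y * cf_num \<alpha> n"
    by algebra
  then show ?case unfolding xy by (simp add: y_def b_def algebra_simps del: cf_complete_quotient.simps)
qed

lemma convergent_coprime: "coprime (cf_num \<alpha> n) (cf_den \<alpha> n)"
proof (rule coprimeI)
  fix c assume "c dvd cf_num \<alpha> n" "c dvd cf_den \<alpha> n"
  then have "c dvd cf_num \<alpha> (Suc n) * cf_den \<alpha> n - cf_num \<alpha> n * cf_den \<alpha> (Suc n)" by simp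
  then show "is_unit c" unfolding cf_det by (metis dvd_trans minus_one_power_iff dvd_minus_iff dvd_refl)
qed

text \<open>\<open>cf_expansion\<close> and \<open>cf_det\<close> give
  \<open>\<bar>\<alpha> * q' - p'\<bar> * (q' * X + q) = 1\<close>, and the second factor is at
  least \<open>q'\<close>.\<close>

lemma convergent_close: "\<bar>\<alpha> - cf_num \<alpha> n / cf_den \<alpha> n\<bar> \<le> 1 / (real_of_int (cf_den \<alpha> n))\<^sup>2"
proof (cases n)
  case 0
  then show ?thesis by (simp add: cf_quotient_def) linarith
next
  case (Suc m)
  define q q' where "q = real_of_int (cf_den \<alpha> m)" and "q' = real_of_int (cf_den \<alpha> (Suc m))"
  define p p' where "p = real_of_int (cf_num \<alpha> m)" and "p' = real_of_int (cf_num \<alpha> (Suc m))"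
  define X where "X = cf_complete_quotient \<alpha> (Suc (Suc m))"
  have q: "q \<ge> 1" "q' \<ge> 1" using cf_den_pos_mono[of m] by (auto simp: q_def q'_def)
  have X: "X > 1" using cf_complete_quotient_gt_1[of "Suc m"] by (simp add: X_def)
  have "\<alpha> * (X * q' + q) = X * p' + p" unfolding X_def q_def q'_def p_def p'_def by (rule cf_expansion)
  then have "(\<alpha> * q' - p') * (q' * X + q) = q * p' * (-1) + q' * p" by algebra
  moreover have "p' * q - p * q' = (- 1) ^ m"
    using cf_det[of m] unfolding q_def q'_def p_def p'_def by (metis of_int_diff of_int_mult of_int_power of_int_minus of_int_1)
  ultimately have "(\<alpha> * q' - p') * (q' * X + q) = - ((- 1) ^ m)" by (simp add: algebra_simps)
  then have "\<bar>(\<alpha> * q' - p') * (q' * X + q)\<bar> = 1" by (simp add: power_abs)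
  then have e: "\<bar>\<alpha> * q' - p'\<bar> * (q' * X + q) = 1" using q X by (simp add: abs_mult)
  have "\<bar>\<alpha> * q' - p'\<bar> * q' \<le> \<bar>\<alpha> * q' - p'\<bar> * (q' * X + q)"
  proof (rule mult_left_mono)
    have "q' * 1 \<le> q' * X" using q X by (intro mult_left_mono) auto
    then show "q' \<le> q' * X + q" using q by linarith
  qed auto
  then have "\<bar>\<alpha> * q' - p'\<bar> * q' \<le> 1" using e by simp
  moreover have "\<alpha> - p' / q' = (\<alpha> * q' - p') / q'" using q by (simp add: field_simps)
  ultimately have "\<bar>\<alpha> - p' / q'\<bar> \<le> 1 / q'\<^sup>2"
    using q by (simp add: abs_divide power2_eq_square field_simps)
  then show ?thesis by (simp add: Suc p'_def q'_def del: cf_num.simps cf_den.simps)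
qed

end

text \<open>The first denominator that reaches \<open>X\<close> has a predecessor below
  \<open>X\<close>, whose size controls it through the arithmetic condition. In this form the
  condition says how long one may have to wait for a usable denominator.\<close>

lemma Omega_approximants:
  assumes "\<alpha> \<in> Omega \<eta>" and "\<eta> \<ge> 0"
  obtains C where "C > 0"
    "\<And>X. X > 1 \<Longrightarrow> \<exists>q. admissible \<alpha> q \<and> X \<le> real q \<and> real q \<le> exp (C * X powr \<eta>)"
proof -
  obtain C where irr: "\<alpha> \<notin> \<rat>" and C: "C > 0"
      "\<And>n. ln (real_of_int (cf_den \<alpha> (Suc n))) \<le> C * real_of_int (cf_den \<alpha> n) powr \<eta>"
    using assms unfolding Omega_def by blast
  show ?thesis
    proof (rule that[OF C(1)])
      fix X :: real assume X: "X > 1"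
      define n where "n = (LEAST n. X \<le> real_of_int (cf_den \<alpha> n))"
      have "X \<le> real_of_int (cf_den \<alpha> (Suc (nat \<lceil>X\<rceil>)))"
        using cf_den_growth[OF irr, of "nat \<lceil>X\<rceil>"] by linarith
      then have n: "X \<le> real_of_int (cf_den \<alpha> n)" unfolding n_def by (rule LeastI)
      have "n \<noteq> 0" using n X by (cases n) auto
      then obtain m where m: "n = Suc m" by (cases n) auto
      then have "m < n" by simp
      then have mX: "real_of_int (cf_den \<alpha> m) < X" unfolding n_def using not_less_Least by (metis not_le)
      have pos: "cf_den \<alpha> m \<ge> 1" "cf_den \<alpha> n \<ge> 1" using cf_den_pos_mono[OF irr] by auto
      have "ln (real_of_int (cf_den \<alpha> n)) \<le> C * real_of_int (cf_den \<alpha> m) powr \<eta>"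
        using C(2)[of m] m by simp
      also have "\<dots> \<le> C * X powr \<eta>" using mX pos C(1) \<open>\<eta> \<ge> 0\<close> by (intro mult_left_mono powr_mono2) auto
      finally have "real_of_int (cf_den \<alpha> n) \<le> exp (C * X powr \<eta>)"
        using pos by (metis exp_le_cancel_iff exp_ln of_int_0_less_iff less_le_trans zero_less_one)
      moreover have "rational_approx \<alpha> (cf_num \<alpha> n) (nat (cf_den \<alpha> n))"
        using convergent_coprime[OF irr, of n] convergent_close[OF irr, of n] pos
        by (simp add: rational_approx_def)
      ultimately show "\<exists>q. admissible \<alpha> q \<and> X \<le> real q \<and> real q \<le> exp (C * X powr \<eta>)"
        using n pos unfolding admissible_def by (intro exI[of _ "nat (cf_den \<alpha> n)"]) auto
    qed
qed

section \<open>Large deviations for Gevrey potentials\<close>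

lemma schrodinger_entries:
  "schrodinger_cocycle V E x $ 1 $ 1 = E - V x" "schrodinger_cocycle V E x $ 1 $ 2 = -1"
  "schrodinger_cocycle V E x $ 2 $ 1 = 1" "schrodinger_cocycle V E x $ 2 $ 2 = 0"
  by (simp_all add: schrodinger_cocycle_def)

lemma norm_transfer_matrix_le:
  fixes w :: "'a::real_normed_field"
  assumes "norm w \<le> b"
  shows "norm (vector [vector [w, -1], vector [1, 0]] :: 'a^2^2) \<le> b + 2"
proof -
  have b: "b \<ge> 0" using assms norm_ge_zero order_trans by blast
  have "(norm (vector [vector [w, -1], vector [1, 0]] :: 'a^2^2))\<^sup>2 = (norm w)\<^sup>2 + 2"
    by (simp add: norm_matrix_2_sq)
  also have "\<dots> \<le> b\<^sup>2 + 2" using power_mono[OF assms] by simp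
  also have "\<dots> \<le> (b + 2)\<^sup>2" using b by (simp add: power2_eq_square algebra_simps)
  finally show ?thesis by (rule power2_le_imp_le) (use b in simp)
qed

lemma norm_schrodinger_diff:
  "norm (schrodinger_cocycle V E x - schrodinger_cocycle W F y) = \<bar>(E - V x) - (F - W y)\<bar>"
proof -
  have "(norm (schrodinger_cocycle V E x - schrodinger_cocycle W F y))\<^sup>2 = \<bar>(E - V x) - (F - W y)\<bar>\<^sup>2"
    by (simp add: norm_matrix_2_sq schrodinger_entries)
  then show ?thesis by (rule power2_eq_imp_eq) auto
qed

lemma continuous_schrodinger:
  assumes "continuous_on UNIV V"
  shows "continuous_on UNIV (schrodinger_cocycle V E)"
  unfolding continuous_on_iff dist_norm norm_schrodinger_diff
proof (intro ballI allI impI)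
  fix x e :: real assume "e > 0"
  then obtain d where "d > 0" "\<And>y. dist y x < d \<Longrightarrow> dist (V y) (V x) < e"
    using assms unfolding continuous_on_iff by (metis UNIV_I)
  then show "\<exists>d>0. \<forall>y\<in>UNIV. norm (y - x) < d \<longrightarrow> \<bar>E - V y - (E - V x)\<bar> < e"
    by (intro exI[of _ d]) (auto simp: dist_norm abs_minus_commute)
qed

lemma sl2_schrodinger:
  assumes "continuous_on UNIV V" "\<And>x. V (x + 1) = V x" "\<And>x. \<bar>E - V x\<bar> + 2 \<le> exp \<Gamma>"
  shows "sl2_cocycle (schrodinger_cocycle V E) \<Gamma>"
proof
  show "continuous_on UNIV (schrodinger_cocycle V E)" by (rule continuous_schrodinger[OF assms(1)])
  show "schrodinger_cocycle V E (x + 1) = schrodinger_cocycle V E x" for x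
    using assms(2) by (simp add: schrodinger_cocycle_def)
  show "norm (schrodinger_cocycle V E x) \<le> exp \<Gamma>" for x
    using order_trans[OF norm_transfer_matrix_le[OF order_refl, of "E - V x"]] assms(3)[of x]
    by (simp add: schrodinger_cocycle_def)
qed (rule det_schrodinger_cocycle)

section \<open>Complexification of the Schrodinger cocycle\<close>

fun complex_iterate :: "real \<Rightarrow> (complex \<Rightarrow> complex^2^2) \<Rightarrow> nat \<Rightarrow> complex \<Rightarrow> complex^2^2" where
  "complex_iterate \<alpha> A 0 z = mat 1"
| "complex_iterate \<alpha> A (Suc N) z = A (z + of_real (real N * \<alpha>)) ** complex_iterate \<alpha> A N z"

definition complex_schrodinger :: "(complex \<Rightarrow> complex) \<Rightarrow> real \<Rightarrow> complex \<Rightarrow> complex^2^2" where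
  "complex_schrodinger T E z = vector [vector [of_real E - T z, -1], vector [1, 0]]"

lemma complex_schrodinger_entries:
  "complex_schrodinger V E x $ 1 $ 1 = of_real E - V x" "complex_schrodinger V E x $ 1 $ 2 = -1"
  "complex_schrodinger V E x $ 2 $ 1 = 1" "complex_schrodinger V E x $ 2 $ 2 = 0"
  by (simp_all add: complex_schrodinger_def)

text \<open>Squares without absolute values: holomorphic in the entries, equal to the squared
  Hilbert--Schmidt norm on real matrices, and dominated by it on complex ones.\<close>

definition sum_sq_entries :: "complex^2^2 \<Rightarrow> complex" where
  "sum_sq_entries A = (A$1$1)\<^sup>2 + (A$1$2)\<^sup>2 + (A$2$1)\<^sup>2 + (A$2$2)\<^sup>2"

lemma norm_sum_sq_entries_le: "cmod (sum_sq_entries A) \<le> (norm A)\<^sup>2"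
proof -
  have "cmod (a + b + c + d) \<le> cmod a + cmod b + cmod c + cmod d" for a b c d
    using norm_triangle_ineq[of "a + b + c" d] norm_triangle_ineq[of "a + b" c] norm_triangle_ineq[of a b]
    by linarith
  then show ?thesis unfolding sum_sq_entries_def norm_matrix_2_sq norm_power[symmetric] .
qed

lemma complex_iterate_of_real:
  assumes T: "\<And>x. T (of_real x) = of_real (t x)"
  shows "complex_iterate \<alpha> (complex_schrodinger T E) N (of_real x) $ i $ j
    = of_real (cocycle_iterate \<alpha> (schrodinger_cocycle t E) N x $ i $ j)"
proof (induction N arbitrary: i j)
  case 0
  show ?case by (simp add: mat_def)
next
  case (Suc N)
  have e: "complex_schrodinger T E (of_real y) $ i $ j = of_real (schrodinger_cocycle t E y $ i $ j)" for y i j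
    using exhaust_2[of i] exhaust_2[of j]
    by (auto simp: complex_schrodinger_entries schrodinger_entries T)
  show ?case
    unfolding complex_iterate.simps cocycle_iterate.simps of_real_add[symmetric] matrix_matrix_mult_def
    by (simp only: vec_lambda_beta e Suc of_real_sum of_real_mult)
qed

lemma sum_sq_entries_of_real:
  assumes T: "\<And>x. T (of_real x) = of_real (t x)"
  shows "sum_sq_entries (complex_iterate \<alpha> (complex_schrodinger T E) N (of_real x))
    = of_real ((norm (cocycle_iterate \<alpha> (schrodinger_cocycle t E) N x))\<^sup>2)"
  unfolding sum_sq_entries_def complex_iterate_of_real[where T = T and t = t, OF T] norm_matrix_2_sq by simp

lemma holomorphic_complex_iterate:
  assumes T: "T holomorphic_on UNIV"
  shows "(\<lambda>z. complex_iterate \<alpha> (complex_schrodinger T E) N z $ i $ j) holomorphic_on UNIV"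
proof (induction N arbitrary: i j)
  case 0
  show ?case by (simp add: mat_def)
next
  case (Suc N)
  have e: "(\<lambda>z. complex_schrodinger T E (z + a) $ i $ k) holomorphic_on UNIV" for i k a
    using exhaust_2[of i] exhaust_2[of k]
    by (auto simp: complex_schrodinger_entries intro!: holomorphic_on_diff holomorphic_shift[OF T])
  have "(\<lambda>z. \<Sum>k\<in>UNIV. complex_schrodinger T E (z + of_real (real N * \<alpha>)) $ i $ k
      * complex_iterate \<alpha> (complex_schrodinger T E) N z $ k $ j) holomorphic_on UNIV"
    by (intro holomorphic_on_sum holomorphic_on_mult e Suc)
  then show ?case by (simp add: matrix_matrix_mult_def)
qed

lemma norm_complex_iterate_le:
  assumes "\<And>k. norm (A (z + of_real (real k * \<alpha>))) \<le> exp \<Gamma>"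
  shows "norm (complex_iterate \<alpha> A N z) \<le> sqrt 2 * exp (real N * \<Gamma>)"
proof (induction N)
  case 0
  show ?case by (simp add: norm_mat_1_2)
next
  case (Suc N)
  have "norm (complex_iterate \<alpha> A (Suc N) z)
      \<le> norm (A (z + of_real (real N * \<alpha>))) * norm (complex_iterate \<alpha> A N z)"
    unfolding complex_iterate.simps by (rule norm_matrix_mult_le)
  also have "\<dots> \<le> exp \<Gamma> * (sqrt 2 * exp (real N * \<Gamma>))"
    using assms Suc by (intro mult_mono) auto
  also have "\<dots> = sqrt 2 * exp (real (Suc N) * \<Gamma>)" by (simp add: exp_add algebra_simps)
  finally show ?case .
qed

text \<open>The exceptional set bound is applied to the squared norm, whose logarithm is
  \<open>2 * ell N\<close>. All quantities of the defect are therefore halved in the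
  statement.\<close>

lemma large_deviation_entire:
  assumes sl2: "sl2_cocycle (schrodinger_cocycle t E) \<Gamma>" and ra: "rational_approx \<alpha> p q"
    and hol: "T holomorphic_on UNIV" and per: "\<And>z. T (z + 1) = T z"
    and T: "\<And>x. T (of_real x) = of_real (t x)"
    and h: "h > 0" "h \<le> 1" "32 \<le> real q * h"
    and bound: "\<And>z. \<bar>Im z\<bar> \<le> h \<Longrightarrow> cmod (of_real E - T z) + 2 \<le> exp \<Gamma>"
    and t: "\<delta> \<ge> 0" and n: "n > 0" "19 * (4 / h + 1) * ((2 * real N * \<Gamma> + 1) / ln 2) \<le> n"
  shows "measure lborel {x\<in>{0..1}. sl2_cocycle.ell \<alpha> (schrodinger_cocycle t E) N x
      < sl2_cocycle.ell_max \<alpha> (schrodinger_cocycle t E) N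
        - (7 * (2 * real N * \<Gamma> + 1) / (real q * h) + 10 * real q * \<Gamma> + \<delta> / (2 * real q))} \<le> 32 * n * exp (- \<delta> / n)"
proof -
  interpret A: sl2_cocycle \<alpha> "schrodinger_cocycle t E" \<Gamma> by fact
  interpret ra: rational_approx \<alpha> p q by fact
  define F where "F z = sum_sq_entries (complex_iterate \<alpha> (complex_schrodinger T E) N z)" for z
  define f where "f x = (norm (A.It N x))\<^sup>2" for x
  have lnf: "ln (f x) = 2 * A.ell N x" for x
    using A.norm_It_pos[of N x] by (simp add: f_def A.ell_def ln_realpow)
  \<comment> \<open>On the strip the squared norm is at most
    \<open>2 * exp (2 * N * \<Gamma>)\<close>, and 2 is at most \<open>exp 1\<close>. The
    oscillation \<open>4 * \<Gamma>\<close> is twice the bound of \<open>ell_shift\<close>.\<close>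
  interpret R: rotation_analytic \<alpha> p q F f h "2 * real N * \<Gamma> + 1" "2 * A.ell_max N" "4 * \<Gamma>"
  proof
    show "F holomorphic_on UNIV" unfolding F_def sum_sq_entries_def
      by (intro holomorphic_on_add holomorphic_on_power holomorphic_complex_iterate hol)
    have per': "complex_schrodinger T E (z + 1) = complex_schrodinger T E z" for z
      by (simp add: complex_schrodinger_def per)
    have "complex_iterate \<alpha> (complex_schrodinger T E) N (z + 1) = complex_iterate \<alpha> (complex_schrodinger T E) N z" for z
    proof (induction N)
      case (Suc N)
      then show ?case using per'[of "z + of_real (real N * \<alpha>)"] by (simp add: algebra_simps)
    qed auto
    then show "F (z + 1) = F z" for z by (simp add: F_def)
    show "0 < h" "h \<le> 1" "32 \<le> real q * h" by (fact h)+
    show "cmod (F z) \<le> exp (2 * real N * \<Gamma> + 1)" if "\<bar>Im z\<bar> \<le> h" for z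
    proof -
      have "norm (complex_schrodinger T E (z + of_real (real k * \<alpha>))) \<le> exp \<Gamma>" for k
        unfolding complex_schrodinger_def
        by (rule order_trans[OF norm_transfer_matrix_le[OF order_refl]]) (rule bound, use that in simp)
      then have "norm (complex_iterate \<alpha> (complex_schrodinger T E) N z) \<le> sqrt 2 * exp (real N * \<Gamma>)"
        by (rule norm_complex_iterate_le)
      then have "(norm (complex_iterate \<alpha> (complex_schrodinger T E) N z))\<^sup>2 \<le> (sqrt 2 * exp (real N * \<Gamma>))\<^sup>2"
        by (rule power_mono) simp
      also have "\<dots> = 2 * exp (2 * real N * \<Gamma>)"
        by (simp add: power_mult_distrib exp_double[symmetric] mult.assoc)
      also have "\<dots> \<le> exp 1 * exp (2 * real N * \<Gamma>)"
        using exp_ge_add_one_self[of "1::real"] by (intro mult_right_mono) auto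
      finally show ?thesis unfolding F_def using norm_sum_sq_entries_le order_trans
        by (metis (no_types, lifting) exp_add mult.commute)
    qed
    show "F (complex_of_real x) = complex_of_real (f x)" for x
      unfolding F_def f_def by (rule sum_sq_entries_of_real[where T = T and t = t, OF T])
    show "1 \<le> f x" for x using A.norm_It_ge_1[of N x] by (simp add: f_def)
    show "\<bar>ln (f (x + \<alpha>)) - ln (f x)\<bar> \<le> 4 * \<Gamma>" for x
      using A.ell_shift[of N x] unfolding lnf by linarith
    show "ln (f x) \<le> 2 * A.ell_max N" for x using A.ell_le_max[of N x] by (simp add: lnf)
    show "\<exists>x. ln (f x) = 2 * A.ell_max N" using A.ell_max_attained[of N] by (auto simp: lnf)
  qed
  have "measure lborel {x\<in>{0..1}. ln (f x) < 2 * A.ell_max N - R.defect \<delta>} \<le> 32 * n * exp (- \<delta> / n)"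
    by (rule R.exceptional_set_measure) (use t n in \<open>auto simp: R.max_zeros_def\<close>)
  moreover have "ln (f x) < 2 * A.ell_max N - R.defect \<delta> \<longleftrightarrow> A.ell N x < A.ell_max N
        - (7 * (2 * real N * \<Gamma> + 1) / (real q * h) + 10 * real q * \<Gamma> + \<delta> / (2 * real q))" for x
  proof -
    have "R.defect \<delta> = 2 * (7 * (2 * real N * \<Gamma> + 1) / (real q * h) + 10 * real q * \<Gamma> + \<delta> / (2 * real q))"
      by (simp add: R.defect_def)
    moreover have "2 * a < 2 * m - 2 * d \<longleftrightarrow> a < m - d" for a m d :: real by auto
    ultimately show ?thesis unfolding lnf by (simp only:)
  qed
  ultimately show ?thesis by simp
qed

section \<open>Entire truncations of a Gevrey series\<close>

locale gevrey_series =
  fixes c :: "int \<Rightarrow> complex" and V :: "real \<Rightarrow> real" and s \<rho> :: real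
  assumes \<rho>: "\<rho> > 0" and s: "s > 1"
    and summable: "(\<lambda>k. cmod (c k) * exp (\<rho> * \<bar>2 * pi * real_of_int k\<bar> powr (1 / s))) summable_on UNIV"
    and V: "\<And>x. ((\<lambda>k. c k * cis (2 * pi * real_of_int k * x)) has_sum complex_of_real (V x)) UNIV"
begin

abbreviation "lell \<alpha> E \<equiv> sl2_cocycle.ell \<alpha> (schrodinger_cocycle V E)"
abbreviation "lmax \<alpha> E \<equiv> sl2_cocycle.ell_max \<alpha> (schrodinger_cocycle V E)"

definition wt :: "int \<Rightarrow> real" where
  "wt k = cmod (c k) * exp (\<rho> * \<bar>2 * pi * real_of_int k\<bar> powr (1 / s))"

definition B :: real where "B = infsum wt UNIV"

text \<open>\<open>X\<close> limits the quantity in the exponent of the weight rather than the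
  frequency itself, so every discarded mode has weight factor above
  \<open>exp (\<rho> * X)\<close>.\<close>

definition cutoff :: "real \<Rightarrow> int set" where
  "cutoff X = {k. \<bar>2 * pi * real_of_int k\<bar> powr (1 / s) \<le> X}"

text \<open>Averaging with the conjugate makes the function real on the real axis without any
  symmetry of the coefficients. There it is the real part of the truncated series, which
  approximates \<open>V\<close> because \<open>V\<close> is real.\<close>

definition trunc :: "real \<Rightarrow> complex \<Rightarrow> complex" where
  "trunc X z = (\<Sum>k\<in>cutoff X. (c k * exp (\<i> * of_real (2 * pi * real_of_int k) * z)
      + cnj (c k) * exp (- (\<i> * of_real (2 * pi * real_of_int k) * z))) / 2)"

definition trunc_real :: "real \<Rightarrow> real \<Rightarrow> real" where
  "trunc_real X x = (\<Sum>k\<in>cutoff X. Re (c k * cis (2 * pi * real_of_int k * x)))"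

lemma wt_nonneg: "wt k \<ge> 0" by (simp add: wt_def)

lemma sum_wt_le: "finite K \<Longrightarrow> sum wt K \<le> B"
  unfolding B_def using summable wt_nonneg
  by (intro finite_sum_le_infsum) (auto simp: wt_def[abs_def])

lemma B_nonneg: "B \<ge> 0" using sum_wt_le[of "{}"] by simp

lemma coeff_le_wt: "cmod (c k) \<le> wt k"
proof -
  have "cmod (c k) * 1 \<le> cmod (c k) * exp (\<rho> * \<bar>2 * pi * real_of_int k\<bar> powr (1 / s))"
    using \<rho> by (intro mult_left_mono) auto
  then show ?thesis by (simp add: wt_def)
qed

lemma finite_cutoff: "finite (cutoff X)"
proof -
  have "cutoff X \<subseteq> {- \<lceil>X powr s\<rceil>..\<lceil>X powr s\<rceil>}"
  proof
    fix k assume k: "k \<in> cutoff X"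
    let ?a = "\<bar>2 * pi * real_of_int k\<bar>"
    have "\<bar>real_of_int k\<bar> \<le> ?a" using pi_gt3 by (simp add: abs_mult mult_left_le_one_le mult_ge1_I mult_right_le_one_le mult_le_cancel_right1)
    also have "?a = (?a powr (1 / s)) powr s" using s by (simp add: powr_powr)
    also have "\<dots> \<le> X powr s" using k s by (intro powr_mono2) (auto simp: cutoff_def)
    finally show "k \<in> {- \<lceil>X powr s\<rceil>..\<lceil>X powr s\<rceil>}" by (simp add: abs_le_iff) linarith
  qed
  then show ?thesis by (rule finite_subset) auto
qed

lemma trunc_of_real: "trunc X (of_real x) = of_real (trunc_real X x)"
proof -
  have "(c k * exp (\<i> * of_real (2 * pi * real_of_int k) * of_real x)
      + cnj (c k) * exp (- (\<i> * of_real (2 * pi * real_of_int k) * of_real x))) / 2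
    = of_real (Re (c k * cis (2 * pi * real_of_int k * x)))" for k
  proof -
    have "exp (\<i> * of_real (2 * pi * real_of_int k) * of_real x) = cis (2 * pi * real_of_int k * x)"
      by (simp add: cis_conv_exp mult_ac)
    moreover have "exp (- (\<i> * of_real (2 * pi * real_of_int k) * of_real x)) = cis (- (2 * pi * real_of_int k * x))"
      by (simp add: cis_conv_exp mult_ac)
    moreover have "cis (- (2 * pi * real_of_int k * x)) = cnj (cis (2 * pi * real_of_int k * x))"
      by (simp only: cis_cnj)
    moreover have "(z + cnj z) / 2 = of_real (Re z)" for z by (simp add: complex_add_cnj)
    ultimately show ?thesis by (metis complex_cnj_mult)
  qed
  then show ?thesis by (simp only: trunc_def trunc_real_def of_real_sum)
qed

lemma trunc_per: "trunc X (z + 1) = trunc X z"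
proof -
  have e: "exp (\<i> * of_real (2 * pi * real_of_int k)) = 1" for k
    using cis_multiple_2pi[of "real_of_int k"] by (simp add: cis_conv_exp mult_ac)
  have e': "exp (- (\<i> * of_real (2 * pi * real_of_int k))) = 1" for k
    using e[of k] by (simp only: exp_minus inverse_1)
  have "exp (\<i> * of_real (2 * pi * real_of_int k) * (z + 1)) = exp (\<i> * of_real (2 * pi * real_of_int k) * z)"
    "exp (- (\<i> * of_real (2 * pi * real_of_int k) * (z + 1))) = exp (- (\<i> * of_real (2 * pi * real_of_int k) * z))" for k
  proof -
    have "\<i> * of_real (2 * pi * real_of_int k) * (z + 1)
        = \<i> * of_real (2 * pi * real_of_int k) * z + \<i> * of_real (2 * pi * real_of_int k)"
      by (simp only: distrib_left mult_1_right)
    then show "exp (\<i> * of_real (2 * pi * real_of_int k) * (z + 1)) = exp (\<i> * of_real (2 * pi * real_of_int k) * z)"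
      "exp (- (\<i> * of_real (2 * pi * real_of_int k) * (z + 1))) = exp (- (\<i> * of_real (2 * pi * real_of_int k) * z))"
      by (simp_all only: exp_add minus_add_distrib e e' mult_1_right)
  qed
  then show ?thesis by (simp only: trunc_def)
qed

lemma trunc_holomorphic: "trunc X holomorphic_on UNIV"
  unfolding trunc_def by (intro holomorphic_intros) auto

text \<open>In this strip the growth of a retained mode is compensated by its Gevrey weight.\<close>
lemma trunc_bound:
  assumes "X > 0" "\<bar>Im z\<bar> \<le> \<rho> * X powr (1 - s)"
  shows "cmod (trunc X z) \<le> B"
proof -
  have "cmod ((c k * exp (\<i> * of_real (2 * pi * real_of_int k) * z)
      + cnj (c k) * exp (- (\<i> * of_real (2 * pi * real_of_int k) * z))) / 2) \<le> wt k"
    if k: "k \<in> cutoff X" for k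
  proof -
    define a where "a = \<bar>2 * pi * real_of_int k\<bar>"
    define y where "y = \<i> * of_real (2 * pi * real_of_int k) * z"
    have a0: "a \<ge> 0" by (simp add: a_def)
    have "\<bar>Re y\<bar> = a * \<bar>Im z\<bar>" by (simp add: y_def a_def abs_mult)
    also have "\<dots> \<le> a * (\<rho> * X powr (1 - s))" using assms a0 by (intro mult_left_mono)
    also have "a = a powr (1 / s) * (a powr (1 / s)) powr (s - 1)"
    proof (cases "a = 0")
      case False
      then have "a powr (1 / s) * (a powr (1 / s)) powr (s - 1) = a powr (1 / s + 1 / s * (s - 1))"
        by (simp add: powr_powr powr_add)
      also have "1 / s + 1 / s * (s - 1) = 1" using s by (simp add: field_simps)
      finally show ?thesis using a0 by simp
    qed auto
    also have "a powr (1 / s) * (a powr (1 / s)) powr (s - 1) * (\<rho> * X powr (1 - s))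
        \<le> a powr (1 / s) * X powr (s - 1) * (\<rho> * X powr (1 - s))"
      using k s \<rho> by (intro mult_right_mono mult_left_mono powr_mono2) (auto simp: cutoff_def a_def)
    also have "\<dots> = \<rho> * a powr (1 / s) * (X powr (s - 1) * X powr (1 - s))" by simp
    also have "X powr (s - 1) * X powr (1 - s) = 1" using assms by (simp add: powr_add[symmetric])
    finally have Re: "\<bar>Re y\<bar> \<le> \<rho> * a powr (1 / s)" by simp
    have "cmod (c k * exp y) \<le> wt k" "cmod (cnj (c k) * exp (- y)) \<le> wt k"
      using Re by (auto simp: norm_mult wt_def a_def intro!: mult_left_mono)
    then have "cmod (c k * exp y + cnj (c k) * exp (- y)) \<le> wt k + wt k"
      using norm_triangle_mono by blast
    then show ?thesis unfolding y_def[symmetric] by (simp add: norm_divide)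
  qed
  then have "cmod (trunc X z) \<le> sum wt (cutoff X)"
    unfolding trunc_def by (rule sum_norm_le)
  then show ?thesis using sum_wt_le[OF finite_cutoff, of X] by linarith
qed

lemma abs_term_le: "\<bar>Re (c k * cis t)\<bar> \<le> wt k"
  using abs_Re_le_cmod[of "c k * cis t"] coeff_le_wt[of k] by (simp add: norm_mult)

lemma trunc_real_bound: "\<bar>trunc_real X x\<bar> \<le> B"
proof -
  have "\<bar>trunc_real X x\<bar> \<le> sum wt (cutoff X)"
    unfolding trunc_real_def real_norm_def[symmetric]
    by (rule sum_norm_le, unfold real_norm_def, rule abs_term_le)
  then show ?thesis using sum_wt_le[OF finite_cutoff, of X] by linarith
qed

lemma V_Re: "((\<lambda>k. Re (c k * cis (2 * pi * real_of_int k * x))) has_sum V x) UNIV"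
  using has_sum_Re[OF V[of x]] by simp

text \<open>The estimate holds for all finite partial sums containing the cutoff, hence for their
  limit; the tail is a weighted tail times \<open>exp (- \<rho> * X)\<close>.\<close>

lemma V_trunc: "\<bar>V x - trunc_real X x\<bar> \<le> exp (- \<rho> * X) * B"
proof -
  define u where "u k = Re (c k * cis (2 * pi * real_of_int k * x))" for k
  have "(sum u \<longlongrightarrow> V x) (finite_subsets_at_top UNIV)"
    using V_Re[of x] unfolding has_sum_def u_def[abs_def] .
  then have lim: "((\<lambda>F. sum u F - trunc_real X x) \<longlongrightarrow> V x - trunc_real X x) (finite_subsets_at_top UNIV)"
    by (intro tendsto_intros)
  have "\<forall>\<^sub>F F in finite_subsets_at_top UNIV. norm (sum u F - trunc_real X x) \<le> exp (- \<rho> * X) * B"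
    unfolding eventually_finite_subsets_at_top
  proof (intro exI[of _ "cutoff X"] conjI allI impI)
    fix F assume F: "finite F \<and> cutoff X \<subseteq> F \<and> F \<subseteq> UNIV"
    have "sum u F - trunc_real X x = sum u (F - cutoff X)"
      using F finite_cutoff by (simp add: trunc_real_def u_def sum_diff)
    also have "norm \<dots> \<le> (\<Sum>k\<in>F - cutoff X. exp (- \<rho> * X) * wt k)"
    proof (rule sum_norm_le)
      fix k assume k: "k \<in> F - cutoff X"
      then have "X < \<bar>2 * pi * real_of_int k\<bar> powr (1 / s)" by (simp add: cutoff_def)
      then have "\<rho> * X \<le> \<rho> * \<bar>2 * pi * real_of_int k\<bar> powr (1 / s)" using \<rho> by simp
      then have "1 \<le> exp (- \<rho> * X) * exp (\<rho> * \<bar>2 * pi * real_of_int k\<bar> powr (1 / s))"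
        unfolding exp_add[symmetric] by simp
      then have "cmod (c k) * 1 \<le> cmod (c k) * (exp (- \<rho> * X) * exp (\<rho> * \<bar>2 * pi * real_of_int k\<bar> powr (1 / s)))"
        by (intro mult_left_mono) auto
      moreover have "\<bar>u k\<bar> \<le> cmod (c k)"
        unfolding u_def using abs_Re_le_cmod[of "c k * cis (2 * pi * real_of_int k * x)"] by (simp add: norm_mult)
      ultimately show "norm (u k) \<le> exp (- \<rho> * X) * wt k" by (simp add: wt_def mult_ac)
    qed
    also have "\<dots> = exp (- \<rho> * X) * sum wt (F - cutoff X)" by (simp add: sum_distrib_left)
    also have "\<dots> \<le> exp (- \<rho> * X) * B" using F by (intro mult_left_mono sum_wt_le) auto
    finally show "norm (sum u F - trunc_real X x) \<le> exp (- \<rho> * X) * B" .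
  qed (use finite_cutoff in auto)
  then have "norm (V x - trunc_real X x) \<le> exp (- \<rho> * X) * B"
    by (rule tendsto_upperbound[OF tendsto_norm[OF lim]]) auto
  then show ?thesis by simp
qed

lemma V_per: "V (x + 1) = V x"
proof -
  have "cis (2 * pi * real_of_int k * (x + 1)) = cis (2 * pi * real_of_int k * x)" for k
    using cis_multiple_2pi[of "real_of_int k"] by (simp add: distrib_left cis_mult[symmetric])
  then have "((\<lambda>k. c k * cis (2 * pi * real_of_int k * x)) has_sum complex_of_real (V (x + 1))) UNIV"
    using V[of "x + 1"] by simp
  from has_sum_unique[OF this V[of x]] show ?thesis by (simp only: of_real_eq_iff)
qed

lemma trunc_real_per: "trunc_real X (x + 1) = trunc_real X x"
proof -
  have "complex_of_real x + 1 = complex_of_real (x + 1)" by simp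
  then have "complex_of_real (trunc_real X (x + 1)) = complex_of_real (trunc_real X x)"
    using trunc_per[of X "of_real x"] trunc_of_real by metis
  then show ?thesis by (simp only: of_real_eq_iff)
qed

lemma trunc_real_continuous: "continuous_on S (trunc_real X)"
  unfolding trunc_real_def by (intro continuous_intros)

lemma V_continuous: "continuous_on UNIV V"
proof (rule uniform_limit_theorem)
  show "\<forall>\<^sub>F n in sequentially. continuous_on UNIV (trunc_real (real n))"
    by (simp add: trunc_real_continuous)
  show "uniform_limit UNIV (\<lambda>n. trunc_real (real n)) V sequentially"
    unfolding uniform_limit_iff
  proof (intro allI impI)
    fix e :: real assume "e > 0"
    have "(\<lambda>n. exp (- \<rho> * real n) * B) \<longlonglongrightarrow> 0 * B"
    proof (intro tendsto_mult tendsto_const)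
      have "filterlim (\<lambda>n. \<rho> * real n) at_top sequentially"
        using \<rho> by (intro filterlim_tendsto_pos_mult_at_top[OF tendsto_const] filterlim_real_sequentially)
      then have "filterlim (\<lambda>n. - (\<rho> * real n)) at_bot sequentially" by (simp add: filterlim_uminus_at_top)
      then have "((\<lambda>n. exp (- (\<rho> * real n))) \<longlongrightarrow> 0) sequentially"
        by (rule filterlim_compose[OF exp_at_bot])
      then show "(\<lambda>n. exp (- \<rho> * real n)) \<longlonglongrightarrow> 0" by simp
    qed
    then have "(\<lambda>n. exp (- \<rho> * real n) * B) \<longlonglongrightarrow> 0" by simp
    from order_tendstoD(2)[OF this \<open>e > 0\<close>]
    show "\<forall>\<^sub>F n in sequentially. \<forall>x\<in>UNIV. dist (trunc_real (real n) x) (V x) < e"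
    proof eventually_elim
      case (elim n)
      show ?case
      proof
        fix x show "dist (trunc_real (real n) x) (V x) < e"
          using V_trunc[of x "real n"] elim by (simp add: dist_real_def abs_minus_commute)
      qed
    qed
  qed
qed auto

lemma V_bound: "\<bar>V x\<bar> \<le> B"
proof -
  have "norm (V x) \<le> B"
  proof (rule tendsto_upperbound[OF tendsto_norm])
    show "(sum (\<lambda>k. Re (c k * cis (2 * pi * real_of_int k * x))) \<longlongrightarrow> V x) (finite_subsets_at_top UNIV)"
      using V_Re[of x] unfolding has_sum_def .
    have "norm (\<Sum>k\<in>F. Re (c k * cis (2 * pi * real_of_int k * x))) \<le> B" if "finite F" for F
    proof -
      have "norm (\<Sum>k\<in>F. Re (c k * cis (2 * pi * real_of_int k * x))) \<le> sum wt F"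
        by (rule sum_norm_le, unfold real_norm_def, rule abs_term_le)
      then show ?thesis using sum_wt_le[OF that] by linarith
    qed
    then show "\<forall>\<^sub>F F in finite_subsets_at_top UNIV. norm (\<Sum>k\<in>F. Re (c k * cis (2 * pi * real_of_int k * x))) \<le> B"
      by (rule eventually_finite_subsets_at_top_weakI)
  qed auto
  then show ?thesis by simp
qed

lemma sl2_cocycle_V:
  assumes "\<bar>E\<bar> + B + 2 \<le> exp \<Gamma>"
  shows "sl2_cocycle (schrodinger_cocycle V E) \<Gamma>"
proof (rule sl2_schrodinger[OF V_continuous V_per])
  show "\<bar>E - V x\<bar> + 2 \<le> exp \<Gamma>" for x using assms V_bound[of x] by linarith
qed

text \<open>Truncation changes each \<open>ell N x\<close> by at most 1, hence the maximum by at
  most 1 as well; this is the extra 2 in the deviation.\<close>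

lemma large_deviation_gevrey:
  assumes \<Gamma>: "\<bar>E\<bar> + B + 2 \<le> exp \<Gamma>" and ra: "rational_approx \<alpha> p q" and N: "N \<ge> 1"
    and h_def: "h = \<rho> * ((\<Gamma> + 2 + B) * real N / \<rho>) powr (1 - s)"
    and h: "h \<le> 1" "32 \<le> real q * h"
    and t: "\<delta> \<ge> 0" and n: "n > 0" "19 * (4 / h + 1) * ((2 * real N * \<Gamma> + 1) / ln 2) \<le> n"
  shows "measure lborel {x\<in>{0..1}. lell \<alpha> E N x
      < lmax \<alpha> E N
        - (7 * (2 * real N * \<Gamma> + 1) / (real q * h) + 10 * real q * \<Gamma> + \<delta> / (2 * real q)) - 2} \<le> 32 * n * exp (- \<delta> / n)"
proof -
  \<comment> \<open>With this choice \<open>\<rho> * X\<close> is the sum of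
    \<open>N * \<Gamma>\<close>, \<open>2 * N\<close> and \<open>N * B\<close>. The three parts
    cancel the growth of the products, the factor \<open>2 * N\<close> of the telescoping sum and
    the factor \<open>B\<close> of the tail.\<close>
  define X where "X = (\<Gamma> + 2 + B) * real N / \<rho>"
  have slV: "sl2_cocycle (schrodinger_cocycle V E) \<Gamma>" by (rule sl2_cocycle_V[OF \<Gamma>])
  interpret A: sl2_cocycle \<alpha> "schrodinger_cocycle V E" \<Gamma> by fact
  have X: "X > 0" using A.Gamma_nonneg B_nonneg N \<rho> by (simp add: X_def add_pos_nonneg)
  have slT: "sl2_cocycle (schrodinger_cocycle (trunc_real X) E) \<Gamma>"
  proof (rule sl2_schrodinger[OF trunc_real_continuous trunc_real_per])
    show "\<bar>E - trunc_real X x\<bar> + 2 \<le> exp \<Gamma>" for x using \<Gamma> trunc_real_bound[of X x] by linarith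
  qed
  interpret T: sl2_cocycle \<alpha> "schrodinger_cocycle (trunc_real X) E" \<Gamma> by fact
  have close: "\<bar>A.ell N x - T.ell N x\<bar> \<le> 1" for x
  proof -
    have "\<bar>A.ell N x - T.ell N x\<bar> \<le> 2 * real N * exp (real N * \<Gamma>) * (exp (- \<rho> * X) * B)"
      by (rule ell_perturb[OF slV slT]) (use V_trunc[of _ X] in \<open>simp add: norm_schrodinger_diff abs_minus_commute\<close>)
    also have "exp (- \<rho> * X) = exp (- (real N * \<Gamma>)) * exp (- (2 * real N)) * exp (- (real N * B))"
    proof -
      have "- \<rho> * X = - (real N * \<Gamma>) + - (2 * real N) + - (real N * B)"
        using \<rho> by (simp add: X_def field_simps)
      then show ?thesis by (simp only: exp_add)
    qed
    also have "2 * real N * exp (real N * \<Gamma>) * (exp (- (real N * \<Gamma>)) * exp (- (2 * real N)) * exp (- (real N * B)) * B)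
        = (2 * real N * exp (- (2 * real N))) * (B * exp (- (real N * B)))"
    proof -
      have "exp (real N * \<Gamma>) * exp (- (real N * \<Gamma>)) = 1" by (simp add: exp_minus)
      moreover have "u * v = 1 \<Longrightarrow> a * u * (v * w * z * b) = (a * w) * (b * z)" for u v a w z b :: real
        by algebra
      ultimately show ?thesis by blast
    qed
    also have "\<dots> \<le> 1 * 1"
    proof (intro mult_mono)
      have le1: "x * exp (- x) \<le> 1" for x :: real
      proof -
        have "x \<le> exp x" using exp_ge_add_one_self[of x] by linarith
        then show ?thesis by (simp add: exp_minus field_simps)
      qed
      show "2 * real N * exp (- (2 * real N)) \<le> 1" by (rule le1)
      have "B * 1 \<le> B * real N" using N B_nonneg by (intro mult_left_mono) auto
      then have "B * exp (- (real N * B)) \<le> (real N * B) * exp (- (real N * B))"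
        by (intro mult_right_mono) (auto simp: mult.commute)
      also have "\<dots> \<le> 1" by (rule le1)
      finally show "B * exp (- (real N * B)) \<le> 1" .
    qed (use B_nonneg in auto)
    finally show ?thesis by simp
  qed
  define d where "d = 7 * (2 * real N * \<Gamma> + 1) / (real q * h) + 10 * real q * \<Gamma> + \<delta> / (2 * real q)"
  have hX: "h = \<rho> * X powr (1 - s)" by (simp add: h_def X_def)
  have h0: "h > 0" using X \<rho> by (simp add: hX)
  have m: "measure lborel {x\<in>{0..1}. T.ell N x < T.ell_max N - d} \<le> 32 * n * exp (- \<delta> / n)"
    unfolding d_def
  proof (rule large_deviation_entire[OF slT ra trunc_holomorphic trunc_per trunc_of_real h0 h _ t n])
    fix z assume "\<bar>Im z\<bar> \<le> h"
    then have "cmod (trunc X z) \<le> B" by (intro trunc_bound X) (simp add: hX)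
    then have "cmod (of_real E - trunc X z) \<le> \<bar>E\<bar> + B"
      using norm_triangle_ineq4[of "of_real E" "trunc X z"] by simp
    then show "cmod (of_real E - trunc X z) + 2 \<le> exp \<Gamma>" using \<Gamma> by linarith
  qed
  have sub: "{x\<in>{0..1}. A.ell N x < A.ell_max N - d - 2} \<subseteq> {x\<in>{0..1}. T.ell N x < T.ell_max N - d}"
  proof safe
    fix x assume x: "A.ell N x < A.ell_max N - d - 2"
    obtain y where "A.ell N y = A.ell_max N" using A.ell_max_attained by blast
    then have "A.ell_max N \<le> T.ell_max N + 1" using close[of y] T.ell_le_max[of N y] by linarith
    then show "T.ell N x < T.ell_max N - d" using x close[of x] by linarith
  qed
  show ?thesis unfolding d_def[symmetric]
    by (rule order_trans[OF measure_mono_fmeasurable[OF sub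
          fmeasurableD[OF sublevel_fmeasurable[OF A.ell_continuous]] sublevel_fmeasurable[OF T.ell_continuous]] m])
qed

end

section \<open>Choice of the exponents\<close>

context gevrey_series
begin

text \<open>\<open>e\<close> is an eighth of the gap \<open>2 - s - \<eta>\<close>, which leaves
  room for several small losses: \<open>q * h\<close> is at least of order q^(\<eta>+7e), the
  allowance \<open>\<delta>\<close> lowers the exponent to \<eta>+6e, and polynomial prefactors
  lower it to \<eta>+5e. The window up to \<open>4 * q powr (1 + e)\<close> admits both a length and
  its double. The constants depend on \<open>\<Gamma>\<close> but not on the energy or on
  \<open>\<alpha>\<close>.\<close>

lemma large_deviation_asymptotic:
  assumes s2: "s < 2" and \<eta>: "0 < \<eta>" "\<eta> < 2 - s" and e: "e = (2 - s - \<eta>) / 8" and \<Gamma>: "\<Gamma> \<ge> 1"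
  obtains C Q where "C > 0" "\<And>\<alpha> E q N. \<bar>E\<bar> + B + 2 \<le> exp \<Gamma> \<Longrightarrow> admissible \<alpha> q \<Longrightarrow> Q \<le> real q \<Longrightarrow>
      real q powr (1 + e) \<le> real N \<Longrightarrow> real N \<le> 4 * real q powr (1 + e) \<Longrightarrow>
      measure lborel (sl2_cocycle.deviation_set \<alpha> (schrodinger_cocycle V E) N (C * real q powr (- e)))
      \<le> exp (- (real q powr (\<eta> + 5 * e)))"
proof -
  have e0: "e > 0" using \<eta> by (simp add: e)
  have se: "2 - s = \<eta> + 8 * e" by (simp add: e field_simps)
  define \<kappa> where "\<kappa> = \<rho> * ((\<Gamma> + 2 + B) / \<rho>) powr (1 - s)"
  have \<kappa>: "\<kappa> > 0" using \<rho> \<Gamma> B_nonneg by (auto simp: \<kappa>_def)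
  define K1 where "K1 = 32 * (9120 * \<Gamma> / \<kappa>)"
  define K2 where "K2 = \<kappa> / (2280 * \<Gamma>)"
  have K: "K1 > 0" "K2 > 0" using \<Gamma> \<kappa> by (auto simp: K1_def K2_def)
  \<comment> \<open>The first summand pays for \<open>M / (q * h)\<close>, the second for the drift
    along the orbit; the 3 covers the zero allowance and the additive 2 from truncation.\<close>
  define C where "C = 84 * \<Gamma> / \<kappa> + 10 * \<Gamma> + 3"
  have C: "C > 0" using \<Gamma> \<kappa> by (simp add: C_def add_pos_nonneg)
  have "\<forall>\<^sub>F y in at_top. \<kappa> * y powr (1 - s) \<le> 1"
    using s by real_asymp
  moreover have "\<forall>\<^sub>F y in at_top. 32 \<le> (\<kappa> / 4) * y powr (\<eta> + 7 * e)"
  proof -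
    have "\<eta> + 7 * e > 0" using e0 \<eta> by simp
    then show ?thesis using \<kappa> by real_asymp
  qed
  moreover have "\<forall>\<^sub>F y in at_top. K1 * y powr (s + 2 * e) * exp (- K2 * y powr (\<eta> + 6 * e)) \<le> exp (- (y powr (\<eta> + 5 * e)))"
  proof -
    have "0 < \<eta> + 5 * e" "\<eta> + 5 * e < \<eta> + 6 * e" using e0 \<eta> by auto
    then show ?thesis using K by real_asymp
  qed
  ultimately have "\<forall>\<^sub>F y in at_top. \<kappa> * y powr (1 - s) \<le> 1 \<and> 32 \<le> (\<kappa> / 4) * y powr (\<eta> + 7 * e)
      \<and> K1 * y powr (s + 2 * e) * exp (- K2 * y powr (\<eta> + 6 * e)) \<le> exp (- (y powr (\<eta> + 5 * e)))"
    (is "eventually ?P at_top") by (intro eventually_conj)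
  then obtain Q0 where Q0: "\<And>y. y \<ge> Q0 \<Longrightarrow> ?P y"
    unfolding eventually_at_top_linorder by blast
  show ?thesis
  proof (rule that[OF C, of "max 1 Q0"])
    fix \<alpha> E q N
    assume E: "\<bar>E\<bar> + B + 2 \<le> exp \<Gamma>" and adm: "admissible \<alpha> q" and Q: "max 1 Q0 \<le> real q"
      and N1: "real q powr (1 + e) \<le> real N" and N2: "real N \<le> 4 * real q powr (1 + e)"
    obtain p where ra: "rational_approx \<alpha> p q" using adm by (auto simp: admissible_def)
    interpret A: sl2_cocycle \<alpha> "schrodinger_cocycle V E" \<Gamma> by (rule sl2_cocycle_V[OF E])
    define y where "y = real q"
    define n0 where "n0 = real N"
    have y: "y \<ge> 1" "y \<ge> Q0" using Q by (auto simp: y_def)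
    have N1: "y powr (1 + e) \<le> n0" and N2: "n0 \<le> 4 * y powr (1 + e)" using N1 N2 by (auto simp: y_def n0_def)
    have yy: "y \<le> y powr (1 + e)" using powr_mono[of 1 "1 + e" y] e0 y by simp
    then have n0: "n0 \<ge> 1" "n0 \<ge> y" using N1 y by linarith+
    have ybig: "\<kappa> * y powr (1 - s) \<le> 1" "32 \<le> (\<kappa> / 4) * y powr (\<eta> + 7 * e)"
        "K1 * y powr (s + 2 * e) * exp (- K2 * y powr (\<eta> + 6 * e)) \<le> exp (- (y powr (\<eta> + 5 * e)))"
      using Q0[OF y(2)] by auto
    define h where "h = \<rho> * ((\<Gamma> + 2 + B) * n0 / \<rho>) powr (1 - s)"
    have hk: "h = \<kappa> * n0 powr (1 - s)"
    proof -
      have "(\<Gamma> + 2 + B) * n0 / \<rho> = ((\<Gamma> + 2 + B) / \<rho>) * n0" by simp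
      then show ?thesis using \<Gamma> B_nonneg \<rho> n0 unfolding h_def \<kappa>_def by (simp only: powr_mult mult.assoc)
    qed
    have h0: "h > 0" using \<kappa> n0 by (simp add: hk)
    have "n0 powr (1 - s) \<le> y powr (1 - s)"
      using n0 y s by (intro powr_mono2') auto
    then have h1: "h \<le> 1" using ybig(1) \<kappa> unfolding hk by (meson mult_left_mono less_imp_le order_trans)
    have h2: "(\<kappa> / 4) * y powr (1 - s - e) \<le> h"
    proof -
      have "4 powr (- 1) \<le> (4::real) powr (1 - s)" using s2 by (intro powr_mono) auto
      then have a: "1 / 4 \<le> (4::real) powr (1 - s)" by (simp add: powr_minus)
      have "e * (s - 1) \<le> e * 1" using e0 s2 by (intro mult_left_mono) auto
      then have "y powr (1 - s - e) \<le> y powr ((1 + e) * (1 - s))" using y by (intro powr_mono) (auto simp: algebra_simps)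
      then have "1 / 4 * y powr (1 - s - e) \<le> 4 powr (1 - s) * y powr ((1 + e) * (1 - s))"
        using a by (intro mult_mono) auto
      also have "\<dots> = (4 * y powr (1 + e)) powr (1 - s)" using y by (simp add: powr_mult powr_powr)
      also have "\<dots> \<le> n0 powr (1 - s)" using n0 N2 s by (intro powr_mono2') auto
      finally show ?thesis using \<kappa> unfolding hk by (simp add: field_simps)
    qed
    have yh: "(\<kappa> / 4) * y powr (\<eta> + 7 * e) \<le> y * h"
    proof -
      have "y powr (\<eta> + 7 * e) = y powr 1 * y powr (1 - s - e)"
      proof -
        have "\<eta> + 7 * e = 1 + (1 - s - e)" using se by linarith
        then show ?thesis by (simp only: powr_add)
      qed
      then have "(\<kappa> / 4) * y powr (\<eta> + 7 * e) = y * ((\<kappa> / 4) * y powr (1 - s - e))" using y by simp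
      also have "\<dots> \<le> y * h" using h2 y by (intro mult_left_mono) auto
      finally show ?thesis .
    qed
    have h32: "32 \<le> y * h" using yh ybig(2) by linarith
    \<comment> \<open>An upper bound for the number of zeros: 19 * (4/h + 1) is at most 95/h, and
      the remaining factor at most \<open>6 * n0 * \<Gamma>\<close>.\<close>
    define n where "n = 570 * \<Gamma> * n0 / h"
    have npos: "n > 0" using \<Gamma> n0 h0 by (simp add: n_def)
    \<comment> \<open>As large as a deviation of order \<open>n0 * y powr (- e)\<close> permits
      after division by \<open>y\<close>. Then \<open>\<delta> / n\<close> is proportional to
      \<open>y * h * y powr (- e)\<close>.\<close>
    define \<delta> where "\<delta> = y * n0 * y powr (- e)"
    have \<delta>: "\<delta> \<ge> 0" using y n0 by (simp add: \<delta>_def)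
    have ln2: "1 / ln (2::real) \<le> 2" using ln2_ge_two_thirds by (simp add: field_simps)
    have g1: "2 * n0 * \<Gamma> + 1 \<le> 3 * (n0 * \<Gamma>)" 
    proof -
      have "1 * 1 \<le> n0 * \<Gamma>" using n0 \<Gamma> by (intro mult_mono) auto
      moreover have "2 * n0 * \<Gamma> = 2 * (n0 * \<Gamma>)" by simp
      ultimately show ?thesis by linarith
    qed
    have nn: "19 * (4 / h + 1) * ((2 * n0 * \<Gamma> + 1) / ln 2) \<le> n"
    proof -
      have "19 * (4 / h + 1) \<le> 95 / h" using h0 h1 by (simp add: field_simps)
      moreover have "(2 * n0 * \<Gamma> + 1) / ln 2 \<le> 3 * (n0 * \<Gamma>) * 2"
        using mult_mono[OF g1 ln2] n0 \<Gamma> by simp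
      ultimately have "19 * (4 / h + 1) * ((2 * n0 * \<Gamma> + 1) / ln 2) \<le> 95 / h * (3 * (n0 * \<Gamma>) * 2)"
        using h0 n0 \<Gamma> by (intro mult_mono) auto
      also have "\<dots> = n" by (simp add: n_def)
      finally show ?thesis .
    qed
    define d where "d = 7 * (2 * n0 * \<Gamma> + 1) / (y * h) + 10 * y * \<Gamma> + \<delta> / (2 * y)"
    have ny: "y \<le> n0 * y powr (- e)"
    proof -
      have "y = y powr (1 + e) * y powr (- e)" using y by (simp add: powr_add[symmetric])
      also have "\<dots> \<le> n0 * y powr (- e)" using N1 by (intro mult_right_mono) auto
      finally show ?thesis .
    qed
    have d: "d + 2 \<le> C * n0 * y powr (- e)"
    proof -
      have "7 * (2 * n0 * \<Gamma> + 1) / (y * h) \<le> 21 * (n0 * \<Gamma>) / ((\<kappa> / 4) * y powr (\<eta> + 7 * e))"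
        using g1 yh \<kappa> y n0 \<Gamma> by (intro frac_le) auto
      also have "\<dots> = (84 * \<Gamma> / \<kappa>) * n0 * y powr (- (\<eta> + 7 * e))"
        unfolding powr_minus using \<kappa> by (simp add: field_simps)
      also have "\<dots> \<le> (84 * \<Gamma> / \<kappa>) * n0 * y powr (- e)"
        using \<Gamma> \<kappa> n0 y e0 \<eta> by (intro mult_left_mono powr_mono) auto
      finally have 1: "7 * (2 * n0 * \<Gamma> + 1) / (y * h) \<le> (84 * \<Gamma> / \<kappa>) * n0 * y powr (- e)" .
      have 2: "10 * y * \<Gamma> \<le> 10 * \<Gamma> * n0 * y powr (- e)"
        using mult_left_mono[OF ny, of "10 * \<Gamma>"] \<Gamma> by (simp add: mult_ac)
      have 3: "\<delta> / (2 * y) \<le> n0 * y powr (- e)" using y n0 by (simp add: \<delta>_def)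
      have 4: "2 \<le> 2 * (n0 * y powr (- e))" using ny y by linarith
      have "C * n0 * y powr (- e) = (84 * \<Gamma> / \<kappa>) * n0 * y powr (- e) + 10 * \<Gamma> * n0 * y powr (- e) + n0 * y powr (- e) + 2 * (n0 * y powr (- e))"
        by (simp add: C_def algebra_simps)
      then show ?thesis unfolding d_def using 1 2 3 4 by linarith
    qed
    have "measure lborel {x\<in>{0..1}. A.ell N x < A.ell_max N - C * n0 * y powr (- e)}
        \<le> measure lborel {x\<in>{0..1}. A.ell N x < A.ell_max N - d - 2}"
    proof (rule measure_mono_fmeasurable)
      show "{x\<in>{0..1}. A.ell N x < A.ell_max N - C * n0 * y powr (- e)} \<subseteq> {x\<in>{0..1}. A.ell N x < A.ell_max N - d - 2}"
        using d by auto
    qed (rule fmeasurableD[OF sublevel_fmeasurable[OF A.ell_continuous]], rule sublevel_fmeasurable[OF A.ell_continuous])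
    also have "\<dots> \<le> 32 * n * exp (- \<delta> / n)"
      unfolding d_def y_def n0_def
      by (rule large_deviation_gevrey[OF E ra])
         (use n0 h1 h32 \<delta> npos nn in \<open>auto simp: n0_def y_def h_def\<close>)
    also have "\<dots> \<le> K1 * y powr (s + 2 * e) * exp (- K2 * y powr (\<eta> + 6 * e))"
    proof (rule mult_mono)
      have "n \<le> 570 * \<Gamma> * (4 * y powr (1 + e)) / ((\<kappa> / 4) * y powr (1 - s - e))"
        unfolding n_def using N2 h2 \<kappa> \<Gamma> y n0 by (intro frac_le mult_left_mono) auto
      also have "\<dots> = 9120 * \<Gamma> / \<kappa> * (y powr (1 + e) / y powr (1 - s - e))"
        using \<kappa> by (simp add: field_simps)
      also have "y powr (1 + e) / y powr (1 - s - e) = y powr (s + 2 * e)"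
        unfolding powr_diff[symmetric] by (simp add: algebra_simps)
      finally show "32 * n \<le> K1 * y powr (s + 2 * e)" by (simp add: K1_def)
      have "K2 * y powr (\<eta> + 6 * e) = ((\<kappa> / 4) * y powr (\<eta> + 7 * e)) * y powr (- e) / (570 * \<Gamma>)"
      proof -
        have "y powr (\<eta> + 6 * e) = y powr (\<eta> + 7 * e) * y powr (- e)"
          unfolding powr_add[symmetric] by (simp add: algebra_simps)
        then show ?thesis using \<Gamma> by (simp add: K2_def)
      qed
      also have "\<dots> \<le> (y * h) * y powr (- e) / (570 * \<Gamma>)"
        using yh \<Gamma> by (intro divide_right_mono mult_right_mono) auto
      also have "\<dots> = \<delta> / n" using \<Gamma> n0 h0 by (simp add: \<delta>_def n_def field_simps)
      finally show "exp (- \<delta> / n) \<le> exp (- K2 * y powr (\<eta> + 6 * e))" by simp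
    qed (use npos K in auto)
    also have "\<dots> \<le> exp (- (y powr (\<eta> + 5 * e)))" by (rule ybig)
    finally show "measure lborel (A.deviation_set N (C * real q powr (- e))) \<le> exp (- (real q powr (\<eta> + 5 * e)))"
      by (simp add: y_def n0_def A.deviation_set_def mult_ac)
  qed
qed

end

section \<open>Change of scale\<close>

text \<open>For \<open>x\<close> in the unit interval, \<open>frac (x + c i)\<close> wraps around at
  most once beyond the shift by \<open>frac (c i)\<close>. Two translates of \<open>S i\<close> thus
  contain all bad \<open>x\<close>, which explains the factor 2 in the union bound.\<close>

lemma avoid_shifted_sets:
  fixes S :: "'i \<Rightarrow> real set" and c :: "'i \<Rightarrow> real"
  assumes fin: "finite I" and S: "\<And>i. i \<in> I \<Longrightarrow> S i \<in> fmeasurable lborel"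
    and small: "(\<Sum>i\<in>I. 2 * measure lborel (S i)) < 1"
  obtains x where "\<And>i. i \<in> I \<Longrightarrow> frac (x + c i) \<notin> S i"
proof -
  define T where "T i = (+) (- frac (c i)) ` S i \<union> (+) (1 - frac (c i)) ` S i" for i
  have SL: "S i \<in> lmeasurable" and mS: "measure lebesgue (S i) = measure lborel (S i)" if "i \<in> I" for i
    using S[OF that] by (auto simp: fmeasurable_def)
  have TL: "T i \<in> lmeasurable" if "i \<in> I" for i
    unfolding T_def by (intro fmeasurable.Un measurable_translation SL[OF that])
  have mT: "measure lebesgue (T i) \<le> 2 * measure lborel (S i)" if "i \<in> I" for i
  proof -
    have "measure lebesgue (T i) \<le> measure lebesgue ((+) (- frac (c i)) ` S i) + measure lebesgue ((+) (1 - frac (c i)) ` S i)"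
      unfolding T_def by (intro measure_Un_le fmeasurableD measurable_translation SL[OF that])
    then show ?thesis unfolding measure_translation mS[OF that] by simp
  qed
  have "\<exists>x\<in>{0..1}. \<forall>i\<in>I. x \<notin> T i"
  proof (rule ccontr)
    assume "\<not> ?thesis"
    then have sub: "{0..1} \<subseteq> (\<Union>i\<in>I. T i)" by auto
    have "measure lebesgue {0..1::real} \<le> measure lebesgue (\<Union>i\<in>I. T i)"
      using fin TL by (intro measure_mono_fmeasurable[OF sub] fmeasurable.finite_UN) auto
    also have "\<dots> \<le> (\<Sum>i\<in>I. measure lebesgue (T i))"
      using fin TL by (intro measure_UNION_le) auto
    also have "\<dots> \<le> (\<Sum>i\<in>I. 2 * measure lborel (S i))" by (intro sum_mono mT)
    finally show False using small by simp
  qed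
  then obtain x where x: "0 \<le> x" "x \<le> 1" "\<And>i. i \<in> I \<Longrightarrow> x \<notin> T i" by auto
  show ?thesis
  proof (rule that)
    fix i assume i: "i \<in> I"
    define y where "y = frac (x + c i)"
    have "y = x + frac (c i) \<or> y = x + frac (c i) - 1"
    proof -
      have "0 \<le> x + frac (c i)" "x + frac (c i) < 2" using x frac_ge_0[of "c i"] frac_lt_1[of "c i"] by linarith+
      then have f: "\<lfloor>x + frac (c i)\<rfloor> = 0 \<or> \<lfloor>x + frac (c i)\<rfloor> = 1" by linarith
      have e: "x + c i = (x + frac (c i)) + of_int \<lfloor>c i\<rfloor>" by (simp add: frac_def)
      have "\<lfloor>x + c i\<rfloor> = \<lfloor>x + frac (c i)\<rfloor> + \<lfloor>c i\<rfloor>"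
        using floor_add_int[of "x + frac (c i)" "\<lfloor>c i\<rfloor>"] e by metis
      moreover have "y = (x + c i) - of_int \<lfloor>x + c i\<rfloor>" by (simp add: y_def frac_def)
      ultimately have "y = x + frac (c i) - of_int \<lfloor>x + frac (c i)\<rfloor>"
        using e by simp
      then show ?thesis using f by auto
    qed
    then have "y \<in> S i \<Longrightarrow> x \<in> T i"
      unfolding T_def by (auto intro: rev_image_eqI)
    then show "frac (x + c i) \<notin> S i" using x(3)[OF i] by (auto simp: y_def)
  qed
qed

section \<open>Passing from one length to a much larger one\<close>

context sl2_cocycle
begin

lemma block_prod_It: "block_prod (\<lambda>j. It N (x + real j * real N * \<alpha>)) n = It (Suc n * N) x"
proof (induction n)
  case (Suc n)
  have "It (N + Suc n * N) x = It N (x + real (Suc n * N) * \<alpha>) ** It (Suc n * N) x" by (rule It_add)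
  then show ?case using Suc by (simp add: algebra_simps)
qed simp

text \<open>Each pair of neighbouring blocks contributes about \<open>2 * N * b\<close> and each
  block shared by two pairs is subtracted once, about \<open>N * a\<close>; the resulting rate is
  \<open>2 * b - a\<close>. Upper bounds hold everywhere by maximality, and lower bounds are
  required only along one orbit.\<close>

lemma ell_blocks:
  assumes N: "N \<ge> 1" and up: "\<And>x. ell N x \<le> real N * a" "\<And>x. ell (2 * N) x \<le> 2 * real N * b"
    and ba: "b \<le> a" and g: "g > 0" "g \<le> a" "a - b \<le> g / 16" "\<tau> \<le> g / 16" "2 * ln 2 \<le> real N * g"
    and \<tau>: "\<tau> \<ge> 0"
    and low: "\<And>j. j \<le> n \<Longrightarrow> real N * (a - \<tau>) \<le> ell N (x + real j * real N * \<alpha>)"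
      "\<And>j. j < n \<Longrightarrow> 2 * real N * (b - \<tau>) \<le> ell (2 * N) (x + real j * real N * \<alpha>)"
  shows "\<bar>ell (Suc n * N) x - real (Suc n) * real N * (2 * b - a)\<bar>
      \<le> 2 * real (Suc n) * real N * \<tau> + real n * ln 2 + 2 * real N * a"
proof -
  define Bl where "Bl j = It N (x + real j * real N * \<alpha>)" for j
  have two: "Bl (Suc j) ** Bl j = It (2 * N) (x + real j * real N * \<alpha>)" for j
  proof -
    have t: "2 * N = N + N" by simp
    show ?thesis unfolding t
      using It_add[of N N "x + real j * real N * \<alpha>"] by (simp add: Bl_def algebra_simps)
  qed
  have ln1: "ln (norm (Bl j)) = ell N (x + real j * real N * \<alpha>)" for j by (simp add: Bl_def ell_def)
  have ln2': "ln (norm (Bl (Suc j) ** Bl j)) = ell (2 * N) (x + real j * real N * \<alpha>)" for j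
    by (simp only: two ell_def)
  have nexp: "norm (It m z) = exp (ell m z)" for m z
    unfolding ell_def by (rule exp_ln[symmetric]) (rule norm_It_pos)
  define \<mu> where "\<mu> = exp (real N * (a - \<tau>))"
  define \<nu> where "\<nu> = exp (2 * real N * a - 2 * real N * (b - \<tau>))"
  have AP: "\<bar>ln (norm (block_prod Bl n)) - ln (norm (Bl 0))
           - (\<Sum>j<n. ln (norm (Bl (Suc j) ** Bl j)) - ln (norm (Bl j)))\<bar> \<le> real n * ln 2"
  proof (rule avalanche_principle)
    show "det (Bl j) = 1" for j by (simp add: Bl_def det_It)
    show "\<mu> \<le> norm (Bl j)" if "j \<le> n" for j using low(1)[OF that] by (simp add: Bl_def nexp \<mu>_def)
    show "norm (Bl (Suc j)) * norm (Bl j) \<le> \<nu> * norm (Bl (Suc j) ** Bl j)" if "j < n" for j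
    proof -
      have "norm (Bl (Suc j)) * norm (Bl j) \<le> exp (2 * real N * a)"
        using up(1)[of "x + real (Suc j) * real N * \<alpha>"] up(1)[of "x + real j * real N * \<alpha>"]
        unfolding Bl_def nexp exp_add[symmetric] by simp
      also have "\<dots> \<le> \<nu> * norm (Bl (Suc j) ** Bl j)"
        using low(2)[OF that] unfolding two nexp \<nu>_def exp_add[symmetric] by simp
      finally show ?thesis .
    qed
    show "4 * \<nu>\<^sup>2 \<le> \<mu>\<^sup>2"
    proof -
      \<comment> \<open>The condition \<open>4 * \<nu>\<^sup>2 \<le> \<mu>\<^sup>2\<close> in
        logarithmic form; the assumptions make the right side at least 11/8 of
        \<open>g\<close>.\<close>
      have "g \<le> 2 * a - 4 * (a - b) - 6 * \<tau>" using g(1-4) by (simp add: field_simps)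
      then have "real N * g \<le> real N * (2 * a - 4 * (a - b) - 6 * \<tau>)" by (intro mult_left_mono) auto
      then have "2 * ln 2 + 2 * (2 * real N * a - 2 * real N * (b - \<tau>)) \<le> 2 * (real N * (a - \<tau>))"
        using g(5) by (simp add: algebra_simps)
      then have "exp (2 * ln 2 + 2 * (2 * real N * a - 2 * real N * (b - \<tau>))) \<le> exp (2 * (real N * (a - \<tau>)))"
        by simp
      moreover have "exp (2 * ln 2 + 2 * (2 * real N * a - 2 * real N * (b - \<tau>))) = 4 * \<nu>\<^sup>2"
        unfolding exp_add exp_double \<nu>_def by simp
      ultimately show ?thesis unfolding \<mu>_def exp_double by simp
    qed
  qed (auto simp: \<mu>_def \<nu>_def)
  have bp: "ln (norm (block_prod Bl n)) = ell (Suc n * N) x"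
    using block_prod_It[of N x n] by (simp only: Bl_def[abs_def] ell_def)
  define D where "D = (\<Sum>j<n. ell (2 * N) (x + real j * real N * \<alpha>) - ell N (x + real j * real N * \<alpha>))"
  have AP': "\<bar>ell (Suc n * N) x - ell N x - D\<bar> \<le> real n * ln 2"
    using AP unfolding bp ln1 ln2' D_def by simp
  have "D \<le> (\<Sum>j<n. 2 * real N * b - real N * (a - \<tau>))"
    unfolding D_def using up low by (intro sum_mono diff_mono) auto
  then have D1: "D \<le> real n * (2 * real N * b - real N * (a - \<tau>))" by simp
  have "(\<Sum>j<n. 2 * real N * (b - \<tau>) - real N * a) \<le> D"
    unfolding D_def using up low by (intro sum_mono diff_mono) auto
  then have D2: "real n * (2 * real N * (b - \<tau>) - real N * a) \<le> D" by simp
  have x0: "real N * (a - \<tau>) \<le> ell N x" "ell N x \<le> real N * a" using low(1)[of 0] up(1)[of x] by auto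
  have ab: "0 \<le> b" "0 \<le> a" using g ba by auto
  define P Q R T where "P = real N * a" and "Q = real N * b" and "R = real N * \<tau>" and "T = real n * R"
  have pos: "0 \<le> Q" "Q \<le> P" "0 \<le> R" "0 \<le> T" using ab ba \<tau> by (auto simp: P_def Q_def R_def T_def mult_left_mono)
  define u v where "u = real n * P" and "v = real n * Q"
  have e1: "real n * (2 * real N * b - real N * (a - \<tau>)) = 2 * v - u + T"
    by (simp add: u_def v_def P_def Q_def R_def T_def algebra_simps)
  have e2: "real n * (2 * real N * (b - \<tau>) - real N * a) = 2 * v - 2 * T - u"
    by (simp add: u_def v_def P_def Q_def R_def T_def algebra_simps)
  have e3: "real (Suc n) * real N * (2 * b - a) = 2 * v - u + 2 * Q - P"
    by (simp add: u_def v_def P_def Q_def algebra_simps)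
  have e4: "2 * real (Suc n) * real N * \<tau> = 2 * T + 2 * R" "2 * real N * a = 2 * P" "real N * (a - \<tau>) = P - R" "real N * a = P"
    by (simp_all add: T_def R_def P_def algebra_simps)
  have "D \<le> 2 * v - u + T" "2 * v - 2 * T - u \<le> D" using D1 D2 unfolding e1 e2 by auto
  moreover have "P - R \<le> ell N x" "ell N x \<le> P" using x0 unfolding e4 by auto
  ultimately show ?thesis using AP' pos unfolding e3 e4 by linarith
qed

text \<open>\<open>M\<close> need not be a multiple of \<open>N\<close>; the fewer than
  \<open>N\<close> remaining factors change the logarithm by at most \<open>N * \<Gamma>\<close> and
  the expected value by at most \<open>N * a\<close>.\<close>

lemma ell_blocks_remainder:
  assumes N: "N \<ge> 1" and up: "\<And>x. ell N x \<le> real N * a" "\<And>x. ell (2 * N) x \<le> 2 * real N * b"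
    and ba: "b \<le> a" and g: "g > 0" "g \<le> a" "a - b \<le> g / 16" "\<tau> \<le> g / 16" "2 * ln 2 \<le> real N * g"
    and \<tau>: "\<tau> \<ge> 0" and M: "N \<le> M"
    and low: "\<And>j. j < M div N \<Longrightarrow> real N * (a - \<tau>) \<le> ell N (x + real j * real N * \<alpha>)"
      "\<And>j. j < M div N \<Longrightarrow> 2 * real N * (b - \<tau>) \<le> ell (2 * N) (x + real j * real N * \<alpha>)"
  shows "\<bar>ell M x / real M - (2 * b - a)\<bar> \<le> 2 * \<tau> + 1 / real N + (3 * a + \<Gamma>) * real N / real M"
proof -
  define n r where "n = M div N - 1" and "r = M mod N"
  have dn: "M div N = Suc n" using M N by (simp add: n_def div_greater_zero_iff)
  have Meq: "M = Suc n * N + r" using dn by (metis r_def div_mult_mod_eq)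
  have r: "real r \<le> real N" using N by (simp add: r_def less_imp_le)
  have main: "\<bar>ell (Suc n * N) x - real (Suc n) * real N * (2 * b - a)\<bar>
      \<le> 2 * real (Suc n) * real N * \<tau> + real n * ln 2 + 2 * real N * a"
    by (rule ell_blocks[OF N up ba g \<tau>]) (use low dn in auto)
  have rem: "\<bar>ell M x - ell (Suc n * N) x\<bar> \<le> real r * \<Gamma>"
    using ell_remainder[of "Suc n * N" r x] Meq by simp
  have MR: "real M = real (Suc n) * real N + real r" using Meq by (metis of_nat_add of_nat_mult)
  have Mpos: "real M > 0" using M N by simp
  have abs2: "\<bar>2 * b - a\<bar> \<le> a" using g ba by linarith
  have "\<bar>real r * (2 * b - a)\<bar> \<le> real N * a"
    unfolding abs_mult using r abs2 by (intro mult_mono) auto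
  moreover have "real r * \<Gamma> \<le> real N * \<Gamma>" using r Gamma_nonneg by (intro mult_right_mono)
  moreover have "real n * ln 2 \<le> real M / real N"
  proof -
    have "real n * ln 2 \<le> real n * 1" using ln_le_minus_one[of 2] by (intro mult_left_mono) auto
    also have "\<dots> \<le> real M / real N" using N MR by (simp add: field_simps)
    finally show ?thesis .
  qed
  moreover have "2 * real (Suc n) * real N * \<tau> \<le> 2 * real M * \<tau>"
  proof -
    have "real (Suc n) * real N * \<tau> \<le> real M * \<tau>" using MR \<tau> by (intro mult_right_mono) auto
    then show ?thesis by (simp add: mult.assoc del: of_nat_Suc)
  qed
  moreover have "real M * (2 * b - a) = real (Suc n) * real N * (2 * b - a) + real r * (2 * b - a)"
    unfolding MR by (simp add: algebra_simps)
  ultimately have "\<bar>ell M x - real M * (2 * b - a)\<bar>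
      \<le> 2 * real M * \<tau> + real M / real N + 2 * real N * a + real N * \<Gamma> + real N * a"
    using main rem by linarith
  then have "\<bar>ell M x - real M * (2 * b - a)\<bar> / real M
      \<le> (2 * real M * \<tau> + real M / real N + 2 * real N * a + real N * \<Gamma> + real N * a) / real M"
    by (intro divide_right_mono) auto
  moreover have "\<bar>ell M x - real M * (2 * b - a)\<bar> / real M = \<bar>ell M x / real M - (2 * b - a)\<bar>"
  proof -
    have "ell M x / real M - (2 * b - a) = (ell M x - real M * (2 * b - a)) / real M"
      using Mpos by (simp add: field_simps)
    then show ?thesis using Mpos by (simp add: abs_divide)
  qed
  moreover have "(2 * real M * \<tau> + real M / real N + 2 * real N * a + real N * \<Gamma> + real N * a) / real M
      = 2 * \<tau> + 1 / real N + (3 * a + \<Gamma>) * real N / real M"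
    using Mpos N by (simp add: field_simps)
  ultimately show ?thesis by simp
qed

lemma not_deviation:
  assumes "frac y \<notin> deviation_set N \<tau>"
  shows "ell_max N - real N * \<tau> \<le> ell N y"
proof -
  have "frac y \<in> {0..1}" using frac_lt_1[of y] by (simp add: less_imp_le)
  with assms have "\<not> ell N (frac y) < ell_max N - real N * \<tau>" unfolding deviation_set_def by blast
  moreover have "frac y + of_int \<lfloor>y\<rfloor> = y" by (simp add: frac_def)
  then have "ell N (frac y) = ell N y" using ell_per_int[of N "frac y" "\<lfloor>y\<rfloor>"] by metis
  ultimately show ?thesis by linarith
qed

text \<open>A single point is found whose orbit avoids the exceptional sets of lengths
  \<open>N\<close> and \<open>2 * N\<close> at every block and which is also typical for
  \<open>M\<close>, so its growth rate nearly equals that of the maximum at \<open>M\<close>. Each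
  block costs \<open>4 * \<epsilon>\<close> and the final condition \<open>2 * \<epsilon>\<close>,
  so \<open>M\<close> may be of order \<open>1 / \<epsilon>\<close>.\<close>

lemma scale_step:
  assumes N: "N \<ge> 1" and a: "a = ell_max N / real N" and b: "b = ell_max (2 * N) / (2 * real N)"
    and g: "g > 0" "g \<le> a" "a - b \<le> g / 16" "\<tau> \<le> g / 16" "2 * ln 2 \<le> real N * g"
    and \<tau>: "\<tau> \<ge> 0" "\<tau>' \<ge> 0" and M: "N \<le> M"
    and m: "measure lborel (deviation_set N \<tau>) \<le> \<epsilon>" "measure lborel (deviation_set (2 * N) \<tau>) \<le> \<epsilon>"
      "measure lborel (deviation_set M \<tau>') \<le> \<epsilon>"
    and small: "(4 * real M + 2) * \<epsilon> < 1"
  shows "\<bar>ell_max M / real M - (2 * b - a)\<bar> \<le> 2 * \<tau> + \<tau>' + 1 / real N + (4 * \<Gamma> + 3) * real N / real M"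
proof -
  have Mpos: "real M > 0" using M N by simp
  have aN: "real N * a = ell_max N" and bN: "2 * real N * b = ell_max (2 * N)" using N by (auto simp: a b)
  have ba: "b \<le> a"
  proof -
    have "ell_max (2 * N) \<le> 2 * ell_max N" using ell_max_add[of N N] unfolding mult_2 by simp
    then have "2 * real N * b \<le> 2 * real N * a" using aN bN by linarith
    then show ?thesis using N by simp
  qed
  obtain x where "\<And>j. j < M div N \<Longrightarrow> frac (x + real j * real N * \<alpha>) \<notin> deviation_set N \<tau>"
    "\<And>j. j < M div N \<Longrightarrow> frac (x + real j * real N * \<alpha>) \<notin> deviation_set (2 * N) \<tau>"
    "frac x \<notin> deviation_set M \<tau>'"
  proof -
    \<comment> \<open>The tags 0 and 1 stand for the conditions at lengths \<open>N\<close> and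
      \<open>2 * N\<close>. Tag 2 stands for length \<open>M\<close>, imposed at block 0 only and
      filled with the empty set elsewhere.\<close>
    define I where "I = {..<M div N} \<times> {0, 1, 2::nat}"
    define c where "c i = (if snd i = 2 then 0 else real (fst i) * real N * \<alpha>)" for i :: "nat \<times> nat"
    define S where "S i = (if snd i = 0 then deviation_set N \<tau> else if snd i = 1 then deviation_set (2 * N) \<tau>
        else if fst i = 0 then deviation_set M \<tau>' else {})" for i :: "nat \<times> nat"
    have ms: "measure lborel (S (j, 0)) \<le> \<epsilon>" "measure lborel (S (j, 1)) \<le> \<epsilon>" for j
      using m by (auto simp: S_def)
    have e0: "\<epsilon> \<ge> 0" using m(1) measure_nonneg order_trans by blast
    have dpos: "M div N > 0" using M N by (simp add: div_greater_zero_iff)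
    have "(\<Sum>i\<in>I. 2 * measure lborel (S i)) = (\<Sum>j<M div N. \<Sum>k\<in>{0,1,2}. 2 * measure lborel (S (j, k)))"
      unfolding I_def sum.cartesian_product by (rule sum.cong) auto
    also have "\<dots> \<le> (\<Sum>j<M div N. 4 * \<epsilon> + (if j = 0 then 2 * \<epsilon> else 0))"
    proof (rule sum_mono)
      fix j
      have "measure lborel (S (j, 2)) \<le> (if j = 0 then \<epsilon> else 0)" using m by (simp add: S_def)
      then show "(\<Sum>k\<in>{0,1,2}. 2 * measure lborel (S (j, k))) \<le> 4 * \<epsilon> + (if j = 0 then 2 * \<epsilon> else 0)"
        using ms[of j] by (auto split: if_splits)
    qed
    also have "\<dots> = real (M div N) * (4 * \<epsilon>) + 2 * \<epsilon>" using dpos by (simp add: sum.distrib)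
    also have "real (M div N) * (4 * \<epsilon>) \<le> real M * (4 * \<epsilon>)" using e0 by (intro mult_right_mono) auto
    finally have sm: "(\<Sum>i\<in>I. 2 * measure lborel (S i)) < 1" using small by (simp add: algebra_simps)
    have "finite I" by (simp add: I_def)
    moreover have "S i \<in> fmeasurable lborel" for i by (simp add: S_def deviation_set_measurable)
    ultimately obtain x where x: "\<And>i. i \<in> I \<Longrightarrow> frac (x + c i) \<notin> S i"
      using avoid_shifted_sets[of I S c] sm by blast
    show ?thesis
    proof (rule that)
      show "frac (x + real j * real N * \<alpha>) \<notin> deviation_set N \<tau>" if "j < M div N" for j
        using x[of "(j, 0)"] that by (simp add: I_def c_def S_def)
      show "frac (x + real j * real N * \<alpha>) \<notin> deviation_set (2 * N) \<tau>" if "j < M div N" for j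
        using x[of "(j, 1)"] that by (simp add: I_def c_def S_def)
      show "frac x \<notin> deviation_set M \<tau>'"
        using x[of "(0, 2)"] dpos by (simp add: I_def c_def S_def)
    qed
  qed
  note x = not_deviation[OF this(1)] not_deviation[OF this(2)] not_deviation[OF this(3)]
  have up: "ell N z \<le> real N * a" "ell (2 * N) z \<le> 2 * real N * b" for z
    unfolding aN bN by (rule ell_le_max)+
  have "\<bar>ell M x / real M - (2 * b - a)\<bar> \<le> 2 * \<tau> + 1 / real N + (3 * a + \<Gamma>) * real N / real M"
  proof (rule ell_blocks_remainder[OF N up ba g \<tau>(1) M])
    show "real N * (a - \<tau>) \<le> ell N (x + real j * real N * \<alpha>)" if "j < M div N" for j
      using x(1)[OF that] by (simp add: aN right_diff_distrib)
    show "2 * real N * (b - \<tau>) \<le> ell (2 * N) (x + real j * real N * \<alpha>)" if "j < M div N" for j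
      using x(2)[OF that] by (simp add: bN right_diff_distrib)
  qed
  moreover have "a \<le> \<Gamma> + 1"
  proof -
    obtain z where "ell N z = ell_max N" using ell_max_attained by blast
    then have "real N * a \<le> real N * \<Gamma> + 1" using ell_upper[of N z] aN by simp
    also have "\<dots> \<le> real N * (\<Gamma> + 1)" using N by (simp add: algebra_simps)
    finally show ?thesis using N by simp
  qed
  then have "(3 * a + \<Gamma>) * real N / real M \<le> (4 * \<Gamma> + 3) * real N / real M"
    by (intro divide_right_mono mult_right_mono) auto
  moreover have "ell M x / real M \<le> ell_max M / real M" using ell_le_max by (intro divide_right_mono) auto
  moreover have "ell_max M / real M - \<tau>' \<le> ell M x / real M"
  proof -
    have "(ell_max M - real M * \<tau>') / real M \<le> ell M x / real M" using x(3) by (intro divide_right_mono) auto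
    then show ?thesis using Mpos by (simp add: diff_divide_distrib)
  qed
  ultimately show ?thesis using \<tau> by linarith
qed

text \<open>Off the exceptional set the rate is at least \<open>g\<close>, and on it
  \<open>ell\<close> is still nonnegative.\<close>

lemma mean_ge_of_deviation:
  assumes N: "N \<ge> 1" and m: "measure lborel (deviation_set N \<tau>) \<le> \<epsilon>"
    and g: "0 \<le> g" "g \<le> ell_max N / real N - \<tau>"
  shows "ell_mean N / real N \<ge> (1 - \<epsilon>) * g"
proof -
  let ?S = "deviation_set N \<tau>"
  have SL: "?S \<in> lmeasurable" "measure lebesgue ?S = measure lborel ?S"
    using deviation_set_measurable[of N \<tau>] by (auto simp: fmeasurable_def)
  have ind: "(indicat_real ?S has_integral measure lborel ?S) {0..1}"
  proof -
    have "(indicat_real ?S has_integral measure lebesgue ?S) UNIV"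
      using SL(1) by (simp only: lmeasurable_iff_has_integral)
    moreover have "indicat_real ?S = (\<lambda>x. if x \<in> {0..1} then indicat_real ?S x else 0)"
      by (auto simp: deviation_set_def indicator_def fun_eq_iff)
    then have "(indicat_real ?S has_integral c) {0..1} \<longleftrightarrow> (indicat_real ?S has_integral c) UNIV" for c
      by (metis has_integral_restrict_UNIV)
    ultimately show ?thesis using SL by simp
  qed
  have Ng: "real N * g \<le> ell_max N - real N * \<tau>"
  proof -
    have "real N * g \<le> real N * (ell_max N / real N - \<tau>)" using g by (intro mult_left_mono) auto
    then show ?thesis using N by (simp add: right_diff_distrib)
  qed
  have low: "real N * g * (1 - indicat_real ?S x) \<le> ell N x" if "x \<in> {0..1}" for x
    using ell_nonneg[of N x] that Ng by (auto simp: deviation_set_def indicator_def)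
  have hi: "((\<lambda>x. real N * g * (1 - indicat_real ?S x)) has_integral real N * g * (1 - measure lborel ?S)) {0..1}"
    by (intro has_integral_mult_right has_integral_diff ind) (use has_integral_const_real[of "1::real" 0 1] in simp)
  have "real N * g * (1 - measure lborel ?S) \<le> ell_mean N"
    unfolding ell_mean_def by (rule has_integral_le[OF hi integrable_integral[OF ell_integrable] low])
  moreover have "real N * g * (1 - \<epsilon>) \<le> real N * g * (1 - measure lborel ?S)"
    using m g by (intro mult_left_mono) auto
  ultimately have "real N * ((1 - \<epsilon>) * g) \<le> ell_mean N" by (simp add: mult_ac)
  then show ?thesis using N by (simp add: field_simps)
qed

end

definition scale :: "real \<Rightarrow> nat \<Rightarrow> nat" where
  "scale e q = nat \<lceil>real q powr (1 + e)\<rceil>"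

lemma scale_bounds:
  assumes "q \<ge> 1" "e > 0"
  shows "real q powr (1 + e) \<le> real (scale e q)" "real (scale e q) \<le> 2 * real q powr (1 + e)"
    "scale e q \<ge> q" "scale e q \<ge> 1"
proof -
  have 1: "1 \<le> real q powr (1 + e)" using assms by (intro ge_one_powr_ge_zero) auto
  have q: "real q \<le> real q powr (1 + e)" using powr_mono[of 1 "1 + e" "real q"] assms by simp
  show a: "real q powr (1 + e) \<le> real (scale e q)" unfolding scale_def by linarith
  show "real (scale e q) \<le> 2 * real q powr (1 + e)" using 1 unfolding scale_def by linarith
  have "real q \<le> real (scale e q)" using a q by linarith
  then show "scale e q \<ge> q" by simp
  then show "scale e q \<ge> 1" using assms by simp
qed

lemma scale_mono: "q \<le> q' \<Longrightarrow> e > 0 \<Longrightarrow> scale e q \<le> scale e q'"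
  unfolding scale_def by (intro nat_mono ceiling_mono powr_mono2) auto

section \<open>Induction over the scales\<close>

context gevrey_series
begin

text \<open>A finite-scale criterion for a lower bound on the exponent. The condition involves only
  two maxima at one fixed scale, hence is stable under small changes of \<open>E\<close>, and
  \<open>Q\<close> is uniform in \<open>E\<close>. It reproduces itself at a larger denominator, so
  it holds at arbitrarily large scales, where means approach the exponent.\<close>

lemma lyapunov_ge_of_initial_scale:
  assumes s2: "s < 2" and \<eta>: "0 < \<eta>" "\<eta> < 2 - s" and e: "e = (2 - s - \<eta>) / 8" and \<Gamma>: "\<Gamma> \<ge> 1"
    and \<alpha>: "\<alpha> \<in> Omega \<eta>" and g: "g > 0"
  obtains C Q where "C > 0" "\<And>E q a b. \<bar>E\<bar> + B + 2 \<le> exp \<Gamma> \<Longrightarrow> admissible \<alpha> q \<Longrightarrow> Q \<le> real q \<Longrightarrow>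
      a = lmax \<alpha> E (scale e q) / real (scale e q) \<Longrightarrow>
      b = lmax \<alpha> E (2 * scale e q) / (2 * real (scale e q)) \<Longrightarrow>
      a - b \<le> g / 16 \<Longrightarrow> g \<le> a - 2 * (a - b) - C * real q powr (- e) \<Longrightarrow>
      g \<le> lyapunov \<alpha> (schrodinger_cocycle V E)"
proof -
  have e0: "e > 0" and e1: "e \<le> 1" using \<eta> s by (auto simp: e)
  obtain C0 Q0 where C0: "C0 > 0" and LD: "\<And>\<alpha> E q N. \<bar>E\<bar> + B + 2 \<le> exp \<Gamma> \<Longrightarrow> admissible \<alpha> q \<Longrightarrow> Q0 \<le> real q \<Longrightarrow>
      real q powr (1 + e) \<le> real N \<Longrightarrow> real N \<le> 4 * real q powr (1 + e) \<Longrightarrow>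
      measure lborel (sl2_cocycle.deviation_set \<alpha> (schrodinger_cocycle V E) N (C0 * real q powr (- e)))
      \<le> exp (- (real q powr (\<eta> + 5 * e)))"
    using large_deviation_asymptotic[OF s2 \<eta> e \<Gamma>] by blast
  obtain C1 where C1: "C1 > 0" and approximants: "\<And>X. X > 1 \<Longrightarrow>
      \<exists>q. admissible \<alpha> q \<and> X \<le> real q \<and> real q \<le> exp (C1 * X powr \<eta>)"
    using Omega_approximants[OF \<alpha> less_imp_le[OF \<eta>(1)]] by blast
  \<comment> \<open>Collects the errors of \<open>scale_step\<close> in units of
    \<open>y powr (- e)\<close>: three deviations, one for \<open>1 / N\<close>, and
    \<open>2 * (4 * \<Gamma> + 3)\<close> for the ratio of the lengths.\<close>
  define C3 where "C3 = 3 * C0 + 8 * \<Gamma> + 7"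
  have C3: "C3 > 0" "C0 \<le> C3" using C0 \<Gamma> by (auto simp: C3_def)
  \<comment> \<open>The next denominator is at most exponential in \<open>y powr \<omega>\<close>.
    Since \<open>\<eta> \<le> 1\<close>, \<open>\<omega>\<close> stays below the exponent
    \<open>\<eta> + 5 * e\<close> of the exceptional sets.\<close>
  define \<omega> where "\<omega> = (1 + 2 * e) * \<eta>"
  have \<omega>: "\<omega> < \<eta> + 5 * e" "\<omega> > 0"
  proof -
    have "2 * e * \<eta> \<le> 2 * e * 1" using e0 \<eta> s by (intro mult_left_mono) auto
    then show "\<omega> < \<eta> + 5 * e" using e0 by (simp add: \<omega>_def algebra_simps)
    show "\<omega> > 0" using e0 \<eta> by (simp add: \<omega>_def)
  qed
  have "\<forall>\<^sub>F y in at_top. 2 * C3 * y powr (- e) \<le> g / 16"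
    using e0 g by real_asymp
  moreover have "\<forall>\<^sub>F y in at_top. 2 * ln 2 \<le> y * g"
    using g by real_asymp
  moreover have "\<forall>\<^sub>F y in at_top. 18 * exp (2 * (C1 * y powr \<omega>)) * exp (- (y powr (\<eta> + 5 * e))) < 1"
  proof -
    define c where "c = \<eta> + 5 * e"
    have "0 < \<omega>" "\<omega> < c" using \<omega> by (auto simp: c_def)
    then show ?thesis using C1 unfolding c_def[symmetric] by real_asymp
  qed
  moreover have "\<forall>\<^sub>F y in at_top. y powr (- (2 * e * e)) \<le> 1 / 2"
  proof -
    define c where "c = 2 * e * e"
    have "c > 0" using e0 by (simp add: c_def)
    then show ?thesis unfolding c_def[symmetric] by real_asymp
  qed
  moreover have "\<forall>\<^sub>F y in at_top. max 2 Q0 \<le> y" by (rule eventually_ge_at_top)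
  ultimately have "\<forall>\<^sub>F y in at_top. 2 * C3 * y powr (- e) \<le> g / 16 \<and> 2 * ln 2 \<le> y * g
      \<and> 18 * exp (2 * (C1 * y powr \<omega>)) * exp (- (y powr (\<eta> + 5 * e))) < 1
      \<and> y powr (- (2 * e * e)) \<le> 1 / 2 \<and> max 2 Q0 \<le> y"
    (is "eventually ?P at_top") by (intro eventually_conj)
  then obtain Q1 where Q1: "\<And>y. y \<ge> Q1 \<Longrightarrow> ?P y"
    unfolding eventually_at_top_linorder by blast
  show ?thesis
  proof (rule that[of "10 * C3" Q1])
    show "10 * C3 > 0" using C3 by simp
    fix E q0 a0 b0
    assume E: "\<bar>E\<bar> + B + 2 \<le> exp \<Gamma>" and q0: "admissible \<alpha> q0" "Q1 \<le> real q0"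
      and a0: "a0 = lmax \<alpha> E (scale e q0) / real (scale e q0)"
      and b0: "b0 = lmax \<alpha> E (2 * scale e q0) / (2 * real (scale e q0))"
      and gap0: "a0 - b0 \<le> g / 16" "g \<le> a0 - 2 * (a0 - b0) - 10 * C3 * real q0 powr (- e)"
    interpret A: sl2_cocycle \<alpha> "schrodinger_cocycle V E" \<Gamma> by (rule sl2_cocycle_V[OF E])
    define a where "a q = A.ell_max (scale e q) / real (scale e q)" for q
    define b where "b q = A.ell_max (2 * scale e q) / (2 * real (scale e q))" for q
    \<comment> \<open>The slack \<open>10 * C3 * q powr (- e)\<close> at least halves from one scale to the next,
      which pays for the error made in the step.\<close>
    define good where "good q \<longleftrightarrow> admissible \<alpha> q \<and> Q1 \<le> real q \<and> a q - b q \<le> g / 16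
        \<and> g \<le> a q - 2 * (a q - b q) - 10 * C3 * real q powr (- e)" for q
    have good0: "good q0" using q0 gap0 by (simp add: good_def a_def b_def a0 b0)
    have dev: "measure lborel (A.deviation_set N (C0 * real q powr (- e))) \<le> exp (- (real q powr (\<eta> + 5 * e)))"
      if "admissible \<alpha> q" "Q1 \<le> real q" "real q powr (1 + e) \<le> real N" "real N \<le> 4 * real q powr (1 + e)" for q N
    proof -
      have "Q0 \<le> real q" using Q1[OF that(2)] by simp
      from LD[OF E that(1) this that(3,4)] show ?thesis .
    qed
    have ba: "b q \<le> a q" if "q \<ge> 1" for q
    proof -
      have N: "scale e q \<ge> 1" using scale_bounds(4)[OF that e0] .
      have "A.ell_max (2 * scale e q) \<le> 2 * A.ell_max (scale e q)"
        using A.ell_max_add[of "scale e q" "scale e q"] unfolding mult_2 by simp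
      then have "b q \<le> 2 * A.ell_max (scale e q) / (2 * real (scale e q))"
        unfolding b_def by (intro divide_right_mono) auto
      then show ?thesis by (simp add: a_def)
    qed
    have step: "\<exists>q'. good q' \<and> q' > q" if good: "good q" for q
    proof -
      define y where "y = real q"
      have yQ: "y \<ge> Q1" using good by (simp add: good_def y_def)
      note big = Q1[OF yQ]
      have y2: "y \<ge> 2" using big by simp
      then have q1: "q \<ge> 1" by (simp add: y_def)
      have "y powr 1 < y powr (1 + 2 * e)" using y2 e0 by (intro powr_less_mono) auto
      then have yX: "y < y powr (1 + 2 * e)" using y2 by simp
      then have "y powr (1 + 2 * e) > 1" using y2 by linarith
      \<comment> \<open>Asking for at least \<open>y powr (1 + 2 * e)\<close> makes
        \<open>N / M\<close> at most of order \<open>y powr (- e)\<close> and lets the slack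
        halve.\<close>
      then obtain q' where adm': "admissible \<alpha> q'"
          and q': "y powr (1 + 2 * e) \<le> real q'" "real q' \<le> exp (C1 * (y powr (1 + 2 * e)) powr \<eta>)"
        using approximants by blast
      define z where "z = real q'"
      have zy: "z > y" using yX q'(1) by (simp add: z_def)
      then have qq: "q' > q" by (simp add: z_def y_def)
      then have q1': "q' \<ge> 1" by simp
      have zQ: "z \<ge> Q1" using zy yQ by simp
      define N M where "N = scale e q" and "M = scale e q'"
      note Nb = scale_bounds[OF q1 e0, folded N_def y_def]
      note Mb = scale_bounds[OF q1' e0, folded M_def z_def]
      have NM: "N \<le> M" unfolding N_def M_def using qq e0 by (intro scale_mono) auto
      define \<epsilon> where "\<epsilon> = exp (- (y powr (\<eta> + 5 * e)))"
      define \<tau> where "\<tau> = C0 * y powr (- e)"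
      define \<tau>' where "\<tau>' = C0 * z powr (- e)"
      have ze: "z powr (- e) \<le> 1 / 2 * y powr (- e)"
      proof -
        have "z powr (- e) \<le> (y powr (1 + 2 * e)) powr (- e)"
          using q'(1) e0 y2 by (intro powr_mono2') (auto simp: z_def)
        also have "\<dots> = y powr (- (2 * e * e)) * y powr (- e)"
          by (simp add: powr_powr powr_add[symmetric] algebra_simps)
        also have "\<dots> \<le> 1 / 2 * y powr (- e)" using big by (intro mult_right_mono) auto
        finally show ?thesis .
      qed
      have yep: "y powr (- e) > 0" using y2 by simp
      have \<tau>: "\<tau> \<ge> 0" "\<tau>' \<ge> 0" "\<tau>' \<le> \<tau>" "\<tau> \<le> g / 16"
      proof -
        show "\<tau> \<ge> 0" "\<tau>' \<ge> 0" using C0 by (auto simp: \<tau>_def \<tau>'_def)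
        have "z powr (- e) \<le> y powr (- e)" using ze yep by linarith
        then show "\<tau>' \<le> \<tau>" unfolding \<tau>_def \<tau>'_def using C0 by (intro mult_left_mono) auto
        have "C0 * y powr (- e) \<le> 2 * C3 * y powr (- e)" using C3 yep C0 by (intro mult_right_mono) auto
        then show "\<tau> \<le> g / 16" unfolding \<tau>_def using big by linarith
      qed
      have m1: "measure lborel (A.deviation_set N \<tau>) \<le> \<epsilon>"
        unfolding \<tau>_def \<epsilon>_def y_def by (rule dev) (use good Nb y2 in \<open>auto simp: good_def y_def\<close>)
      have m2: "measure lborel (A.deviation_set (2 * N) \<tau>) \<le> \<epsilon>"
        unfolding \<tau>_def \<epsilon>_def y_def by (rule dev) (use good Nb y2 in \<open>auto simp: good_def y_def\<close>)
      have \<epsilon>': "exp (- (z powr (\<eta> + 5 * e))) \<le> \<epsilon>"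
        unfolding \<epsilon>_def using zy y2 e0 \<eta> by (simp add: powr_mono2)
      have m3: "measure lborel (A.deviation_set M \<tau>') \<le> \<epsilon>"
      proof -
        have "measure lborel (A.deviation_set M \<tau>') \<le> exp (- (z powr (\<eta> + 5 * e)))"
          unfolding \<tau>'_def z_def by (rule dev) (use adm' zQ Mb in \<open>auto simp: z_def\<close>)
        then show ?thesis using \<epsilon>' by linarith
      qed
      have m4: "measure lborel (A.deviation_set (2 * M) \<tau>') \<le> \<epsilon>"
      proof -
        have "measure lborel (A.deviation_set (2 * M) \<tau>') \<le> exp (- (z powr (\<eta> + 5 * e)))"
          unfolding \<tau>'_def z_def by (rule dev) (use adm' zQ Mb in \<open>auto simp: z_def\<close>)
        then show ?thesis using \<epsilon>' by linarith
      qed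
      have small2: "(4 * real (2 * M) + 2) * \<epsilon> < 1"
      proof -
        have z1: "z \<ge> 1" using zy y2 by simp
        have "z powr (1 + e) \<le> z powr 2" using z1 e1 by (intro powr_mono) auto
        also have "z powr 2 = z\<^sup>2" using z1 powr_realpow[of z 2] by simp
        finally have "real M \<le> 2 * z\<^sup>2" using Mb by linarith
        moreover have "1 \<le> z\<^sup>2" using z1 by simp
        \<comment> \<open>The length \<open>2 * M\<close> is treated too, because the next scale
          needs both its maxima.\<close>
        ultimately have "4 * real (2 * M) + 2 \<le> 18 * z\<^sup>2" by simp
        also have "z\<^sup>2 \<le> (exp (C1 * (y powr (1 + 2 * e)) powr \<eta>))\<^sup>2"
          using q'(2) by (intro power_mono) (auto simp: z_def)
        also have "\<dots> = exp (2 * (C1 * y powr \<omega>))"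
          by (simp add: exp_double[symmetric] powr_powr \<omega>_def)
        finally have "4 * real (2 * M) + 2 \<le> 18 * exp (2 * (C1 * y powr \<omega>))" by simp
        then have "(4 * real (2 * M) + 2) * \<epsilon> \<le> 18 * exp (2 * (C1 * y powr \<omega>)) * \<epsilon>"
          by (intro mult_right_mono) (auto simp: \<epsilon>_def)
        then show ?thesis using big unfolding \<epsilon>_def by linarith
      qed
      have small1: "(4 * real M + 2) * \<epsilon> < 1"
      proof -
        have "(4 * real M + 2) * \<epsilon> \<le> (4 * real (2 * M) + 2) * \<epsilon>"
          by (intro mult_right_mono) (auto simp: \<epsilon>_def)
        then show ?thesis using small2 by linarith
      qed
      have aN: "a q = A.ell_max N / real N" "b q = A.ell_max (2 * N) / (2 * real N)"
        by (simp_all add: a_def b_def N_def)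
      have aM: "a q' = A.ell_max M / real M" "b q' = A.ell_max (2 * M) / real (2 * M)"
        by (simp_all add: a_def b_def M_def)
      have gq: "a q - b q \<le> g / 16" "g \<le> a q - 2 * (a q - b q) - 10 * C3 * y powr (- e)"
        using good by (auto simp: good_def y_def)
      have ga: "g \<le> a q"
      proof -
        have "10 * C3 * y powr (- e) \<ge> 0" using C3 by simp
        then show ?thesis using gq(2) ba[OF q1] by (simp add: algebra_simps)
      qed
      have gN: "2 * ln 2 \<le> real N * g"
      proof -
        have "y * g \<le> real N * g" using Nb(3) g by (intro mult_right_mono) (auto simp: y_def)
        then show ?thesis using big by linarith
      qed
      define d where "d = C3 * y powr (- e)"
      have err: "2 * \<tau> + \<tau>' + 1 / real N + (4 * \<Gamma> + 3) * real N / real K \<le> d" if K: "M \<le> K" for K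
      proof -
        have "1 / real N \<le> 1 / y powr 1" using Nb(3) y2 by (intro divide_left_mono) (auto simp: y_def)
        also have "\<dots> = y powr (- 1)" using y2 by (simp add: powr_minus divide_inverse)
        also have "\<dots> \<le> y powr (- e)" using y2 e1 by (intro powr_mono) auto
        finally have 1: "1 / real N \<le> y powr (- e)" .
        have "real N / real K \<le> 2 * y powr (1 + e) / z powr (1 + e)"
          using Nb Mb K y2 zy by (intro frac_le) auto
        also have "\<dots> \<le> 2 * y powr (1 + e) / (y powr (1 + 2 * e)) powr (1 + e)"
          using q'(1) e0 y2 zy by (intro divide_left_mono powr_mono2) (auto simp: z_def)
        also have "\<dots> = 2 * (y powr (1 + e) / (y powr (1 + 2 * e)) powr (1 + e))" by simp
        also have "y powr (1 + e) / (y powr (1 + 2 * e)) powr (1 + e) = y powr ((1 + e) - (1 + 2 * e) * (1 + e))"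
          by (simp only: powr_powr powr_diff)
        also have "(1 + e) - (1 + 2 * e) * (1 + e) = - e - (e + 2 * (e * e))" by algebra
        also have "2 * y powr (- e - (e + 2 * (e * e))) \<le> 2 * y powr (- e)"
        proof -
          have "0 \<le> e + 2 * (e * e)" using e0 by (intro add_nonneg_nonneg mult_nonneg_nonneg) auto
          then have "- e - (e + 2 * (e * e)) \<le> - e" by simp
          then show ?thesis using y2 by (intro mult_left_mono powr_mono) auto
        qed
        finally have "(4 * \<Gamma> + 3) * (real N / real K) \<le> (4 * \<Gamma> + 3) * (2 * y powr (- e))"
          using \<Gamma> by (intro mult_left_mono) auto
        moreover have "(4 * \<Gamma> + 3) * (2 * y powr (- e)) = (8 * \<Gamma> + 6) * y powr (- e)" by (simp add: algebra_simps)
        ultimately have 2: "(4 * \<Gamma> + 3) * real N / real K \<le> (8 * \<Gamma> + 6) * y powr (- e)"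
          by (simp only: times_divide_eq_right)
        have "d = 3 * \<tau> + y powr (- e) + (8 * \<Gamma> + 6) * y powr (- e)"
          by (simp add: d_def C3_def \<tau>_def algebra_simps)
        then show ?thesis using 1 2 \<tau> by linarith
      qed
      have s1: "\<bar>a q' - (2 * b q - a q)\<bar> \<le> d"
        unfolding aM
        by (rule order_trans[OF A.scale_step[OF Nb(4) aN g ga gq(1) \<tau>(4) gN \<tau>(1,2) NM m1 m2 m3 small1] err[OF order_refl]])
      have "N \<le> 2 * M" "M \<le> 2 * M" using NM by auto
      then have s2: "\<bar>b q' - (2 * b q - a q)\<bar> \<le> d"
        unfolding aM
        using order_trans[OF A.scale_step[OF Nb(4) aN g ga gq(1) \<tau>(4) gN \<tau>(1,2) _ m1 m2 m4 small2] err] by blast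
      have d': "C3 * z powr (- e) \<le> d / 2"
        using mult_left_mono[OF ze, of C3] C3 by (simp add: d_def)
      have "2 * d \<le> g / 16" using big by (simp add: d_def)
      then have "a q' - b q' \<le> g / 16" using s1 s2 by linarith
      \<comment> \<open>Both new rates are within \<open>d\<close> of \<open>2 * b q - a q\<close>,
        so \<open>2 * b q' - a q'\<close> loses at most \<open>3 * d\<close>. The new slack is at
        most \<open>5 * d\<close>, and \<open>10 * d\<close> was available.\<close>
      moreover have "g \<le> a q' - 2 * (a q' - b q') - 10 * C3 * real q' powr (- e)"
        using s1 s2 gq(2) d' ba[OF q1] unfolding z_def[symmetric] by (simp add: d_def abs_le_iff mult.assoc)
      ultimately have "good q'" using adm' zQ by (simp add: good_def z_def)
      then show ?thesis using qq by blast
    qed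
    have "\<exists>q. good q \<and> q \<ge> k" for k
    proof (induction k)
      case (Suc k)
      then show ?case using step by (meson Suc_leI le_less_trans)
    qed (use good0 in auto)
    then obtain qf where qf: "\<And>k. good (qf k)" "\<And>k. qf k \<ge> k" by metis
    have lim: "filterlim (\<lambda>k. real (qf k)) at_top sequentially"
      by (rule filterlim_at_top_mono[OF filterlim_real_sequentially]) (simp add: qf(2))
    have limN: "filterlim (\<lambda>k. scale e (qf k)) at_top sequentially"
    proof (rule filterlim_at_top_mono[OF filterlim_ident], rule eventually_sequentiallyI[of 1])
      fix k :: nat assume "1 \<le> k"
      then show "k \<le> scale e (qf k)" using scale_bounds(3)[of "qf k" e] qf(2)[of k] e0 by linarith
    qed
    have L1: "(\<lambda>k. A.ell_mean (scale e (qf k)) / real (scale e (qf k))) \<longlonglongrightarrow> lyapunov \<alpha> (schrodinger_cocycle V E)"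
      by (rule filterlim_compose[OF A.lyapunov_limit limN])
    have "((\<lambda>y. (1 - exp (- (y powr (\<eta> + 5 * e)))) * g) \<longlongrightarrow> g) at_top"
    proof -
      define c where "c = \<eta> + 5 * e"
      have "c > 0" using e0 \<eta> by (simp add: c_def)
      then show ?thesis unfolding c_def[symmetric] by real_asymp
    qed
    then have L2: "(\<lambda>k. (1 - exp (- (real (qf k) powr (\<eta> + 5 * e)))) * g) \<longlonglongrightarrow> g"
      by (rule filterlim_compose[OF _ lim])
    show "g \<le> lyapunov \<alpha> (schrodinger_cocycle V E)"
    proof (rule LIMSEQ_le[OF L2 L1], intro exI allI impI)
      fix k :: nat assume "0 \<le> k"
      define q where "q = qf k"
      have gd: "good q" by (simp add: q_def qf)
      have q2: "real q \<ge> 2" using gd Q1[of "real q"] by (simp add: good_def)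
      then have q1: "q \<ge> 1" by simp
      have N1: "scale e q \<ge> 1" using scale_bounds(4)[OF q1 e0] .
      have "measure lborel (A.deviation_set (scale e q) (C0 * real q powr (- e))) \<le> exp (- (real q powr (\<eta> + 5 * e)))"
        by (rule dev) (use gd scale_bounds[OF q1 e0] q2 in \<open>auto simp: good_def\<close>)
      moreover have "g \<le> A.ell_max (scale e q) / real (scale e q) - C0 * real q powr (- e)"
      proof -
        have "C0 * real q powr (- e) \<le> 10 * C3 * real q powr (- e)" using C3 by (intro mult_right_mono) auto
        moreover have "g \<le> a q - 2 * (a q - b q) - 10 * C3 * real q powr (- e)" using gd by (simp add: good_def)
        ultimately show ?thesis using ba[OF q1] unfolding a_def[symmetric] by (simp add: algebra_simps)
      qed
      ultimately show "(1 - exp (- (real (qf k) powr (\<eta> + 5 * e)))) * g \<le> A.ell_mean (scale e (qf k)) / real (scale e (qf k))"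
        using A.mean_ge_of_deviation[OF N1 _ less_imp_le[OF g]] unfolding q_def by blast
    qed
  qed
qed

end

section \<open>Continuity\<close>

context gevrey_series
begin

text \<open>The constant grows exponentially with \<open>N\<close>, so the length has to be fixed
  before the neighbourhood of energies is chosen.\<close>

lemma ell_energy_lipschitz:
  assumes "\<bar>E\<bar> + B + 2 \<le> exp \<Gamma>" "\<bar>F\<bar> + B + 2 \<le> exp \<Gamma>"
  shows "\<bar>lell \<alpha> E N x - lell \<alpha> F N x\<bar>
    \<le> 2 * real N * exp (real N * \<Gamma>) * \<bar>E - F\<bar>"
  by (rule ell_perturb[OF sl2_cocycle_V[OF assms(1)] sl2_cocycle_V[OF assms(2)]]) (simp add: norm_schrodinger_diff)

lemma ell_max_energy_le:
  assumes E: "\<bar>E\<bar> + B + 2 \<le> exp \<Gamma>" and F: "\<bar>F\<bar> + B + 2 \<le> exp \<Gamma>"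
  shows "lmax \<alpha> E N
    \<le> lmax \<alpha> F N + 2 * real N * exp (real N * \<Gamma>) * \<bar>E - F\<bar>"
proof -
  interpret E: sl2_cocycle \<alpha> "schrodinger_cocycle V E" \<Gamma> by (rule sl2_cocycle_V[OF E])
  interpret F: sl2_cocycle \<alpha> "schrodinger_cocycle V F" \<Gamma> by (rule sl2_cocycle_V[OF F])
  obtain x where "E.ell N x = E.ell_max N" using E.ell_max_attained by blast
  then show ?thesis using ell_energy_lipschitz[OF E F, of \<alpha> N x] F.ell_le_max[of N x] by linarith
qed

lemma ell_mean_energy_le:
  assumes E: "\<bar>E\<bar> + B + 2 \<le> exp \<Gamma>" and F: "\<bar>F\<bar> + B + 2 \<le> exp \<Gamma>"
  shows "sl2_cocycle.ell_mean \<alpha> (schrodinger_cocycle V E) N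
    \<le> sl2_cocycle.ell_mean \<alpha> (schrodinger_cocycle V F) N + 2 * real N * exp (real N * \<Gamma>) * \<bar>E - F\<bar>"
proof -
  interpret E: sl2_cocycle \<alpha> "schrodinger_cocycle V E" \<Gamma> by (rule sl2_cocycle_V[OF E])
  interpret F: sl2_cocycle \<alpha> "schrodinger_cocycle V F" \<Gamma> by (rule sl2_cocycle_V[OF F])
  let ?K = "2 * real N * exp (real N * \<Gamma>) * \<bar>E - F\<bar>"
  have "E.ell_mean N \<le> integral {0..1} (\<lambda>x. F.ell N x + ?K)"
    unfolding E.ell_mean_def
  proof (rule integral_le)
    show "(\<lambda>x. F.ell N x + ?K) integrable_on {0..1}"
      by (intro integrable_add F.ell_integrable) auto
    show "E.ell N x \<le> F.ell N x + ?K" for x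
      using ell_energy_lipschitz[OF E F, of \<alpha> N x] by linarith
  qed (rule E.ell_integrable)
  also have "\<dots> = F.ell_mean N + ?K"
    unfolding F.ell_mean_def by (subst integral_add) (auto intro: F.ell_integrable)
  finally show ?thesis .
qed

text \<open>From above, the exponent is bounded by the mean at one fixed length, which varies
  continuously with the energy. From below, nonnegativity settles the case of an exponent under
  \<epsilon>; otherwise the finite-scale criterion is verified at \<open>E0\<close> with room to
  spare and carried to nearby energies.\<close>

lemma lyapunov_continuous:
  assumes s2: "s < 2" and \<eta>: "0 < \<eta>" "\<eta> < 2 - s" and \<alpha>: "\<alpha> \<in> Omega \<eta>"
  shows "continuous_on UNIV (\<lambda>E. lyapunov \<alpha> (schrodinger_cocycle V E))"
  unfolding continuous_on_iff dist_real_def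
proof (intro ballI allI impI)
  fix E0 \<epsilon> :: real assume \<epsilon>: "\<epsilon> > 0"
  define L where "L E = lyapunov \<alpha> (schrodinger_cocycle V E)" for E
  define \<Gamma> where "\<Gamma> = max 1 (ln (\<bar>E0\<bar> + B + 3))"
  have \<Gamma>1: "\<Gamma> \<ge> 1" by (simp add: \<Gamma>_def)
  have "\<bar>E0\<bar> + B + 3 = exp (ln (\<bar>E0\<bar> + B + 3))" using B_nonneg by simp
  also have "\<dots> \<le> exp \<Gamma>" by (simp add: \<Gamma>_def)
  finally have ball: "\<bar>E\<bar> + B + 2 \<le> exp \<Gamma>" if "\<bar>E - E0\<bar> \<le> 1" for E using that by linarith
  have bE0: "\<bar>E0\<bar> + B + 2 \<le> exp \<Gamma>" by (rule ball) simp
  interpret A0: sl2_cocycle \<alpha> "schrodinger_cocycle V E0" \<Gamma> by (rule sl2_cocycle_V[OF bE0])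
  define K where "K N = 2 * real N * exp (real N * \<Gamma>)" for N
  have K0: "K N \<ge> 0" for N by (simp add: K_def)
  have upper: "\<exists>d>0. \<forall>E. \<bar>E - E0\<bar> < d \<longrightarrow> L E < L E0 + \<epsilon>"
  proof -
    have "\<forall>\<^sub>F N in sequentially. A0.ell_mean N / real N < L E0 + \<epsilon> / 2 \<and> N \<ge> 1"
      unfolding L_def using \<epsilon>
      by (intro eventually_conj order_tendstoD(2)[OF A0.lyapunov_limit] eventually_ge_at_top) auto
    then obtain N where N: "A0.ell_mean N / real N < L E0 + \<epsilon> / 2" "N \<ge> 1"
      using eventually_happens'[OF sequentially_bot] by blast
    define d where "d = min 1 (\<epsilon> / (4 * (K N + 1)))"
    have d: "d > 0" using \<epsilon> K0[of N] by (simp add: d_def)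
    show ?thesis
    proof (intro exI[of _ d] conjI d allI impI)
      fix E assume E: "\<bar>E - E0\<bar> < d"
      then have bE: "\<bar>E\<bar> + B + 2 \<le> exp \<Gamma>" by (intro ball) (simp add: d_def)
      interpret A: sl2_cocycle \<alpha> "schrodinger_cocycle V E" \<Gamma> by (rule sl2_cocycle_V[OF bE])
      have "K N * \<bar>E - E0\<bar> \<le> (K N + 1) * (\<epsilon> / (4 * (K N + 1)))"
        using E K0[of N] by (intro mult_mono) (auto simp: d_def)
      also have "\<dots> = \<epsilon> / 4"
      proof -
        have "w * (\<epsilon> / (4 * w)) = \<epsilon> / 4" if "w > 0" for w using that by simp
        then show ?thesis using K0[of N] by (simp only: add_nonneg_pos zero_less_one)
      qed
      finally have "K N * \<bar>E - E0\<bar> \<le> \<epsilon> / 4" .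
      then have "A.ell_mean N \<le> A0.ell_mean N + \<epsilon> / 4"
        using ell_mean_energy_le[OF bE bE0, of \<alpha> N] by (simp add: K_def)
      then have "A.ell_mean N / real N \<le> (A0.ell_mean N + \<epsilon> / 4) / real N" by (intro divide_right_mono) auto
      also have "\<dots> = A0.ell_mean N / real N + \<epsilon> / 4 / real N" by (simp add: add_divide_distrib)
      also have "\<epsilon> / 4 / real N \<le> \<epsilon> / 4 / 1" using \<epsilon> N by (intro divide_left_mono) auto
      finally have "A.ell_mean N / real N \<le> A0.ell_mean N / real N + \<epsilon> / 4" by simp
      then show "L E < L E0 + \<epsilon>" using N A.lyapunov_le[OF N(2)] \<epsilon> unfolding L_def by linarith
    qed
  qed
  have lower: "\<exists>d>0. \<forall>E. \<bar>E - E0\<bar> < d \<longrightarrow> L E0 - \<epsilon> < L E"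
  proof (cases "L E0 < \<epsilon>")
    case True
    show ?thesis
    proof (intro exI[of _ 1] conjI allI impI)
      fix E assume "\<bar>E - E0\<bar> < 1"
      then have bE: "\<bar>E\<bar> + B + 2 \<le> exp \<Gamma>" by (intro ball) simp
      interpret A: sl2_cocycle \<alpha> "schrodinger_cocycle V E" \<Gamma> by (rule sl2_cocycle_V[OF bE])
      show "L E0 - \<epsilon> < L E" using A.lyapunov_nonneg True unfolding L_def by linarith
    qed simp
  next
    case False
    define g where "g = L E0 - \<epsilon> / 2"
    have g: "g > 0" using False \<epsilon> by (simp add: g_def)
    define e where "e = (2 - s - \<eta>) / 8"
    have e0: "e > 0" using \<eta> by (simp add: e_def)
    obtain C Q where C: "C > 0" and main: "\<And>E q a b. \<bar>E\<bar> + B + 2 \<le> exp \<Gamma> \<Longrightarrow> admissible \<alpha> q \<Longrightarrow> Q \<le> real q \<Longrightarrow>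
      a = lmax \<alpha> E (scale e q) / real (scale e q) \<Longrightarrow>
      b = lmax \<alpha> E (2 * scale e q) / (2 * real (scale e q)) \<Longrightarrow>
      a - b \<le> g / 16 \<Longrightarrow> g \<le> a - 2 * (a - b) - C * real q powr (- e) \<Longrightarrow>
      g \<le> lyapunov \<alpha> (schrodinger_cocycle V E)"
      using lyapunov_ge_of_initial_scale[OF s2 \<eta> e_def \<Gamma>1 \<alpha> g] by blast
    \<comment> \<open>Near \<open>E0\<close> the gap \<open>a - b\<close> is at most
      \<open>3 * \<mu>\<close>, whence \<open>g / 48\<close>. The total loss
      \<open>7 * \<mu> + \<epsilon> / 8\<close> stays below \<open>\<epsilon> / 2\<close>, whence
      \<open>\<epsilon> / 32\<close>.\<close>
    define \<mu> where "\<mu> = min (g / 48) (\<epsilon> / 32)"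
    have \<mu>: "\<mu> > 0" "\<mu> \<le> g / 48" "\<mu> \<le> \<epsilon> / 32" using g \<epsilon> by (auto simp: \<mu>_def)
    obtain U where U: "(\<lambda>n. A0.ell_max n / real n) \<longlonglongrightarrow> U" "\<And>n. n \<ge> 1 \<Longrightarrow> U \<le> A0.ell_max n / real n"
      using fekete[OF A0.ell_max_add A0.ell_max_nonneg] by blast
    have UL: "L E0 \<le> U"
      unfolding L_def using A0.ell_mean_le_max
      by (intro LIMSEQ_le[OF A0.lyapunov_limit U(1)]) (auto intro!: divide_right_mono)
    obtain N1 where N1: "\<And>n. n \<ge> N1 \<Longrightarrow> A0.ell_max n / real n < U + \<mu>"
      using order_tendstoD(2)[OF U(1), of "U + \<mu>"] \<mu> unfolding eventually_sequentially by auto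
    have "\<forall>\<^sub>F y in at_top. C * y powr (- e) \<le> \<epsilon> / 8" using e0 \<epsilon> by real_asymp
    then obtain Y where Y: "\<And>y. y \<ge> Y \<Longrightarrow> C * y powr (- e) \<le> \<epsilon> / 8"
      unfolding eventually_at_top_linorder by blast
    \<comment> \<open>The scale is chosen from data at \<open>E0\<close> and constants uniform in
      \<open>E\<close>, before \<open>E\<close> itself.\<close>
    define X where "X = max 2 (max Q (max Y (real N1)))"
    have "X > 1" by (simp add: X_def)
    then obtain q where adm: "admissible \<alpha> q" and q: "X \<le> real q"
      using Omega_approximants[OF \<alpha> less_imp_le[OF \<eta>(1)]] by metis
    have qX: "Q \<le> real q" "Y \<le> real q" "N1 \<le> q" "q \<ge> 1" using q by (auto simp: X_def)
    define N where "N = scale e q"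
    have N: "N \<ge> 1" "N \<ge> N1" using scale_bounds[OF qX(4) e0] qX(3) by (auto simp: N_def)
    define a0 b0 where "a0 = A0.ell_max N / real N" and "b0 = A0.ell_max (2 * N) / (2 * real N)"
    have ab0: "U \<le> a0" "a0 < U + \<mu>" "U \<le> b0"
      using U(2)[OF N(1)] U(2)[of "2 * N"] N1[OF N(2)] N by (auto simp: a0_def b0_def)
    define d where "d = min 1 (\<mu> / (K N + K (2 * N) + 1))"
    have Kpos: "K N + K (2 * N) + 1 > 0" using K0[of N] K0[of "2 * N"] by linarith
    have d: "d > 0" using \<mu> Kpos by (simp add: d_def)
    show ?thesis
    proof (intro exI[of _ d] conjI d allI impI)
      fix E assume E: "\<bar>E - E0\<bar> < d"
      then have bE: "\<bar>E\<bar> + B + 2 \<le> exp \<Gamma>" by (intro ball) (simp add: d_def)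
      interpret A: sl2_cocycle \<alpha> "schrodinger_cocycle V E" \<Gamma> by (rule sl2_cocycle_V[OF bE])
      have Kd: "K m * \<bar>E - E0\<bar> \<le> \<mu>" if "m = N \<or> m = 2 * N" for m
      proof -
        have "K m * \<bar>E - E0\<bar> \<le> (K N + K (2 * N) + 1) * (\<mu> / (K N + K (2 * N) + 1))"
          using E K0[of N] K0[of "2 * N"] Kpos that by (intro mult_mono) (auto simp: d_def)
        moreover have "w * (\<mu> / w) = \<mu>" if "w > 0" for w using that by simp
        ultimately show ?thesis using Kpos by metis
      qed
      have close: "\<bar>A.ell_max m / real m - A0.ell_max m / real m\<bar> \<le> \<mu>" if "m = N \<or> m = 2 * N" for m
      proof -
        have m1: "real m \<ge> 1" using that N by auto
        have "\<bar>A.ell_max m - A0.ell_max m\<bar> \<le> \<mu>"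
          using ell_max_energy_le[OF bE bE0, of \<alpha> m] ell_max_energy_le[OF bE0 bE, of \<alpha> m] Kd[OF that]
          by (simp add: K_def abs_minus_commute abs_le_iff)
        then have "\<bar>A.ell_max m - A0.ell_max m\<bar> / real m \<le> \<mu> / 1" using m1 \<mu> by (intro frac_le) auto
        then show ?thesis using m1 by (simp add: abs_divide diff_divide_distrib[symmetric])
      qed
      define a b where "a = A.ell_max N / real N" and "b = A.ell_max (2 * N) / (2 * real N)"
      have ab: "\<bar>a - a0\<bar> \<le> \<mu>" "\<bar>b - b0\<bar> \<le> \<mu>"
        using close[of N] close[of "2 * N"] by (simp_all add: a_def b_def a0_def b0_def)
      have "g \<le> lyapunov \<alpha> (schrodinger_cocycle V E)"
      proof (rule main[OF bE adm qX(1)])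
        show "a = A.ell_max (scale e q) / real (scale e q)" by (simp add: a_def N_def)
        show "b = A.ell_max (2 * scale e q) / (2 * real (scale e q))" by (simp add: b_def N_def)
        have gap: "a - b \<le> 3 * \<mu>" using ab ab0 by linarith
        then show "a - b \<le> g / 16" using \<mu> by linarith
        have "a \<ge> L E0 - \<mu>" using ab ab0 UL by linarith
        moreover have "C * real q powr (- e) \<le> \<epsilon> / 8" by (rule Y[OF qX(2)])
        ultimately show "g \<le> a - 2 * (a - b) - C * real q powr (- e)"
          using gap \<mu> unfolding g_def by (simp add: algebra_simps)
      qed
      then show "L E0 - \<epsilon> < L E" using \<epsilon> by (simp add: L_def g_def)
    qed
  qed
  obtain d1 d2 where "d1 > 0" "d2 > 0" "\<And>E. \<bar>E - E0\<bar> < d1 \<Longrightarrow> L E < L E0 + \<epsilon>" "\<And>E. \<bar>E - E0\<bar> < d2 \<Longrightarrow> L E0 - \<epsilon> < L E"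
    using upper lower by blast
  then show "\<exists>d>0. \<forall>E\<in>UNIV. \<bar>E - E0\<bar> < d \<longrightarrow>
      \<bar>lyapunov \<alpha> (schrodinger_cocycle V E) - lyapunov \<alpha> (schrodinger_cocycle V E0)\<bar> < \<epsilon>"
    unfolding L_def[symmetric] by (intro exI[of _ "min d1 d2"]) (auto simp: abs_less_iff algebra_simps)
qed

end

theorem theorem1p2:
  fixes \<rho> s \<eta> \<alpha> :: real and V :: "real \<Rightarrow> real"
  assumes "\<rho> > 0"
    and "1 < s" and "s < 2"
    and "0 < \<eta>" and "\<eta> < 2 - s"
    and "\<alpha> \<in> Omega \<eta>"
    and "V \<in> gevrey s \<rho>"
  shows "continuous_on UNIV (\<lambda>E::real. lyapunov \<alpha> (schrodinger_cocycle V E))"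
proof -
  interpret gevrey_series "fourier_coeff V" V s \<rho>
    by unfold_locales (use assms in \<open>auto simp: gevrey_def\<close>)
  show ?thesis by (rule lyapunov_continuous) (use assms in auto)
qed

end
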